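(* Let $p\ge13$ be a prime, $m$ an even positive integer, $n=2m$. Let $a\in\mathbb{F}_{p^n}$ with $a^{p^m+1}\in\mathbb{F}_{p^2}$, let $b\in\mathbb{F}_p$, and let $t$ be an integer with $\gcd(t,p^m+1)=1$. Then the $p$-ary function $$f_{a,b,t}(x)=\mathrm{Tr}^n_1\!\left(ax^{t(p^m-1)}\right)+bx^{\frac{p^n-1}{2}}$$ on $\mathbb{F}_{p^n}$ is not a regular bent function.
   Context: $\mathrm{Tr}^n_1(x)=\sum_{k=0}^{n-1}x^{p^k}$ is the trace from $\mathbb{F}_{p^n}$ to $\mathbb{F}_p$; note $x^{(p^n-1)/2}\in\{0,1,-1\}\subseteq\mathbb{F}_p$, so $f_{a,b,t}$ maps $\mathbb{F}_{p^n}$ to $\mathbb{F}_p$. Let $\zeta=e^{2\pi\sqrt{-1}/p}$ (with $\zeta^c$ for $c\in\mathbb{F}_p$ meaning $\zeta$ to any integer representative). For $f:\mathbb{F}_{p^n}\to\mathbb{F}_p$, the Walsh transform is $W_f(\lambda)=\sum_{x\in\mathbb{F}_{p^n}}\zeta^{f(x)-\mathrm{Tr}^n_1(\lambda x)}$. $f$ is bent if $|W_f(\lambda)|=p^{n/2}$ for all $\lambda\in\mathbb{F}_{p^n}$, and regular bent if for every $\lambda$, $W_f(\lambda)=p^{n/2}\zeta^{f^*(\lambda)}$ for some function $f^*:\mathbb{F}_{p^n}\to\mathbb{F}_p$. *)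

theory Defs
  imports Complex_Main "HOL-Computational_Algebra.Primes"
begin

text \<open>The finite field F_{p^n} is modelled by a finite field type 'a with CARD('a) = p^n
  (p prime), so its characteristic is p. The prime subfield F_p is the image of the integers.\<close>

definition prime_subfield :: "'a::field set" where
  "prime_subfield = range (of_int :: int \<Rightarrow> 'a)"

definition tr :: "nat \<Rightarrow> nat \<Rightarrow> 'a::field \<Rightarrow> 'a" where
  "tr p n x = (\<Sum>k<n. x ^ (p ^ k))"

definition zeta_pow :: "nat \<Rightarrow> 'a::field \<Rightarrow> complex" where
  "zeta_pow p c = cis (2 * pi * real_of_int (SOME k::int. of_int k = c) / real p)"

definition walsh :: "nat \<Rightarrow> nat \<Rightarrow> ('a::{field,finite} \<Rightarrow> 'a) \<Rightarrow> 'a \<Rightarrow> complex" where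
  "walsh p n f lam = (\<Sum>x\<in>UNIV. zeta_pow p (f x - tr p n (lam * x)))"

definition regular_bent :: "nat \<Rightarrow> nat \<Rightarrow> ('a::{field,finite} \<Rightarrow> 'a) \<Rightarrow> bool" where
  "regular_bent p n f \<longleftrightarrow>
     (\<forall>lam. \<exists>c \<in> (prime_subfield :: 'a set). walsh p n f lam = complex_of_real (sqrt (real p) ^ n) * zeta_pow p c)"

text \<open>f_{a,b,t}(x) = Tr(a x^{t(p^m-1)}) + b x^{(p^n-1)/2}; negative exponents via powi
  (with 0 powi k = 0 for k < 0, agreeing with reducing exponents mod p^n - 1).\<close>
definition f_abt :: "nat \<Rightarrow> nat \<Rightarrow> 'a::field \<Rightarrow> 'a \<Rightarrow> int \<Rightarrow> 'a \<Rightarrow> 'a" where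
  "f_abt p m a b t x =
     tr p (2*m) (a * x powi (t * (int p ^ m - 1))) + b * x ^ ((p ^ (2*m) - 1) div 2)"

end

theory Submission
  imports Defs
    "HOL-Computational_Algebra.Computational_Algebra"
    "HOL-Computational_Algebra.Field_as_Ring"
    "HOL-Number_Theory.Cong"
begin

text \<open>Write \<open>q = p ^ m\<close>. The function is constant on the cosets of the multiplicative group of the
  field with \<open>q\<close> elements, so its Walsh transform is governed by the sum \<open>K\<close> of
  \<open>zeta\<close> to the power \<open>Tr (a u) + b u ^ ((q + 1) / 2)\<close> over the group \<open>U\<close> of \<open>(q + 1)\<close>-th roots of
  unity, and regular bentness forces \<open>K = 1\<close>.

  By irreducibility of the cyclotomic polynomial, \<open>K = 1\<close> means that the exponent is equidistributed,
  so that its power moments vanish modulo \<open>p\<close>. Since exponents of weight below \<open>p\<close> cannot wrap around,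
  the moments can be read off the generating function
  \<open>cosh (b T) * (I (A T\<^sup>2) * I (A ^ p T\<^sup>2)) ^ (m / 2)\<close>, where \<open>I z\<close> is the sum of the \<open>z ^ c / c!\<^sup>2\<close> and
  \<open>A = a ^ (q + 1)\<close>; it must be \<open>1\<close> modulo \<open>T ^ p\<close>. Comparing logarithmic derivatives up to degree 12
  (this uses \<open>p \<ge> 13\<close>) gives six equations which leave only \<open>b = 0\<close> and \<open>p\<close> dividing \<open>m / 2\<close>.

  In that case put \<open>M = p ^ (m / p)\<close>. The sum \<open>K\<close> is the negative of the Kloosterman sum
  of \<open>A\<close> over the field with \<open>q = M ^ p\<close> elements, which is determined by the one over the field
  with \<open>M\<close> elements: if \<open>- w\<close> is the latter, then \<open>K = V p\<close> for the Lucas sequence \<open>V 0 = 2\<close>,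
  \<open>V 1 = w\<close>, \<open>V (n + 2) = w * V (n + 1) - M * V n\<close>. Now \<open>V p = 1\<close> together with
  \<open>w = 1\<close> modulo \<open>(1 - zeta)\<^sup>2\<close> gives \<open>w = 1 + M\<close> modulo \<open>M * (1 - zeta)\<close>, which is impossible because
  \<open>- w\<close> is a sum of only \<open>M - 1\<close> roots of unity.\<close>

section \<open>Cyclotomic integers of prime conductor\<close>

text \<open>Only the Walsh values at 0 and 1 are used. Both are \<open>q\<close> times a power of
  \<zeta>. Averaging the value at 1 over the multiplicative group of the field with \<open>q\<close>
  elements turns them into one integer relation among at most four powers of \<zeta>, and since p >
  4 such a relation has to be trivial. The moment method has a blind spot. In characteristic p a
  series with constant term 1, raised to a multiple of p, is 1 modulo T ^ p; so for b = 0 and p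
  dividing m / 2 the generating identity carries no information, and a second argument is
  unavoidable. It works (1 - \<zeta>)-adically: near 1 a p-th power multiplies the distance to 1 by
  p, so the exact value 1 of the lifted sum fixes w very precisely, and counting terms contradicts
  this. The Lucas sequence comes from the L-polynomial of the Kloosterman sum, which is quadratic;
  \<open>V n\<close> is the n-th power sum of its reciprocal roots.\<close>

lemma eisenstein_int_poly:
  fixes f :: "int poly" and p :: int
  assumes p: "prime p" and lc: "\<not> p dvd lead_coeff f"
    and low: "\<And>i. i < degree f \<Longrightarrow> p dvd coeff f i"
    and c0: "\<not> p\<^sup>2 dvd coeff f 0" and fgh: "f = g * h"
  shows "degree g = 0 \<or> degree h = 0"
proof -
  \<comment> \<open>Let \<open>i\<close> be the lowest index at which \<open>p\<close> does not
    divide the coefficient of \<open>g\<close>. If \<open>p\<close> does not divide the constant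
    term of the cofactor either, then it does not divide the coefficient of \<open>f\<close> at
    \<open>i\<close>. So \<open>i\<close> is at least \<open>degree f\<close>, and no degree is left
    for the cofactor.\<close>
  have aux: "degree k = 0" if f: "f = g * k" and k0: "\<not> p dvd coeff k 0" for g k
  proof -
    have lcg: "\<not> p dvd lead_coeff g"
      using lc f by (auto simp: lead_coeff_mult)
    define i where "i = (LEAST i. \<not> p dvd coeff g i)"
    have i: "\<not> p dvd coeff g i" unfolding i_def using lcg by (rule LeastI)
    have less: "p dvd coeff g j" if "j < i" for j
      using that not_less_Least unfolding i_def by blast
    have ile: "i \<le> degree g"
      unfolding i_def by (rule Least_le) (use lcg in simp)
    have nz: "g \<noteq> 0" "k \<noteq> 0" using lc f by auto
    have "coeff f i = (\<Sum>j\<le>i. coeff g j * coeff k (i - j))"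
      by (simp add: f coeff_mult)
    also have "\<dots> = (\<Sum>j<i. coeff g j * coeff k (i - j)) + coeff g i * coeff k 0"
      by (simp flip: lessThan_Suc_atMost)
    finally have eq: "coeff f i = (\<Sum>j<i. coeff g j * coeff k (i - j)) + coeff g i * coeff k 0" .
    have s: "p dvd (\<Sum>j<i. coeff g j * coeff k (i - j))"
      by (intro dvd_sum dvd_mult2) (use less in auto)
    have "\<not> p dvd coeff g i * coeff k 0"
      using i k0 p by (simp add: prime_dvd_mult_iff)
    hence "\<not> p dvd coeff f i"
      using eq s by (simp add: dvd_add_right_iff)
    hence "i \<ge> degree f" using low by (meson not_less)
    moreover have "degree f = degree g + degree k"
      using nz by (simp add: f degree_mult_eq)
    ultimately show ?thesis using ile by simp
  qed
  have f0: "coeff f 0 = coeff g 0 * coeff h 0"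
    by (simp add: fgh coeff_mult)
  consider "degree f = 0" | "\<not> p dvd coeff g 0" | "\<not> p dvd coeff h 0"
    using c0 f0 by (metis mult_dvd_mono power2_eq_square)
  thus ?thesis
  proof cases
    case 1
    have "g \<noteq> 0" "h \<noteq> 0" using lc fgh by auto
    with 1 show ?thesis by (simp add: fgh degree_mult_eq)
  next
    case 2
    have "f = h * g" by (simp add: fgh)
    with 2 show ?thesis using aux[of h g] by auto
  next
    case 3
    with fgh show ?thesis using aux[of g h] by auto
  qed
qed

text \<open>For prime \<open>p\<close> this is the cyclotomic polynomial at 1 + X, that is ((1 + X)
  ^ p - 1) / X. The shift makes it an Eisenstein polynomial. The type stays open because it is
  factored over the integers and evaluated over the complex numbers.\<close>

definition shifted_cyclotomic :: "nat \<Rightarrow> 'a::comm_ring_1 poly" where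
  "shifted_cyclotomic p = (\<Sum>i<p. monom (of_nat (p choose (Suc i))) i)"

lemma coeff_shifted_cyclotomic:
  "coeff (shifted_cyclotomic p) i = (if i < p then of_nat (p choose (Suc i)) else 0)"
  by (simp add: shifted_cyclotomic_def coeff_sum if_distrib[of of_nat] cong: if_cong)

lemma poly_shifted_cyclotomic:
  "poly (shifted_cyclotomic p) x * x = (1 + x) ^ p - (1 :: 'a :: comm_ring_1)"
proof -
  have "(1 + x) ^ p = (\<Sum>k\<le>p. of_nat (p choose k) * x ^ k)"
    using binomial_ring[of x 1 p] by (simp add: add.commute)
  also have "\<dots> = 1 + (\<Sum>i<p. of_nat (p choose Suc i) * x ^ Suc i)"
    by (simp add: sum.lessThan_Suc_shift del: sum.lessThan_Suc binomial_Suc_Suc power_Suc flip: lessThan_Suc_atMost)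
  finally show ?thesis
    by (simp add: shifted_cyclotomic_def poly_sum poly_monom sum_distrib_left sum_distrib_right mult_ac)
qed

lemma degree_shifted_cyclotomic:
  assumes "p > 0"
  shows "degree (shifted_cyclotomic p :: 'a :: comm_ring_1 poly) = p - 1"
proof (rule antisym)
  show "degree (shifted_cyclotomic p :: 'a poly) \<le> p - 1"
    by (rule degree_le) (auto simp: coeff_shifted_cyclotomic)
  show "p - 1 \<le> degree (shifted_cyclotomic p :: 'a poly)"
    by (rule le_degree) (use assms in \<open>simp add: coeff_shifted_cyclotomic\<close>)
qed


text \<open>An arbitrary additive and multiplicative map is allowed because three are needed:
  \<open>of_int\<close>, the embedding \<open>\<iota>\<close> of a subfield, and the Frobenius
  \<open>\<lambda>c. c ^ Q\<close>.\<close>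

lemma map_poly_mult_hom:
  fixes f :: "'a::comm_semiring_0 \<Rightarrow> 'b::comm_semiring_0"
  assumes "f 0 = 0" "\<And>x y. f (x + y) = f x + f y" "\<And>x y. f (x * y) = f x * f y"
  shows "map_poly f (p * q) = map_poly f p * map_poly f q"
proof -
  have s: "f (sum g A) = (\<Sum>x\<in>A. f (g x))" for g :: "nat \<Rightarrow> 'a" and A
    by (induction A rule: infinite_finite_induct) (auto simp: assms)
  show ?thesis
    by (intro poly_eqI) (simp add: coeff_map_poly coeff_mult assms s)
qed

lemma map_poly_of_int_mult:
  "map_poly of_int (p * q) = (map_poly of_int p * map_poly of_int q :: 'a :: comm_ring_1 poly)"
  by (rule map_poly_mult_hom) auto

lemma map_poly_of_int_add:
  "map_poly of_int (p + q) = (map_poly of_int p + map_poly of_int q :: 'a :: comm_ring_1 poly)"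
  by (intro poly_eqI) (simp add: coeff_map_poly)

lemma map_poly_of_int_shifted_cyclotomic:
  "map_poly of_int (shifted_cyclotomic p) = (shifted_cyclotomic p :: 'a :: comm_ring_1 poly)"
  by (intro poly_eqI) (simp add: coeff_map_poly coeff_shifted_cyclotomic)

text \<open>The shifted cyclotomic polynomial \<open>f\<close> is prime in the factorial ring of
  integer polynomials. By pseudo-division, a nonzero \<open>h\<close> of least degree vanishing at
  \<open>z - 1\<close> divides a constant multiple \<open>[:a:] * f\<close>. So \<open>f\<close>
  divides \<open>h\<close>, whose degree is too small, or the cofactor, and then \<open>h\<close>
  divides a constant.\<close>

lemma int_poly_root_of_unity_degree:
  fixes z :: complex and g :: "int poly"
  assumes p: "prime p" and z: "z ^ p = 1" "z \<noteq> 1"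
    and root: "poly (map_poly of_int g) (z - 1) = 0" and deg: "degree g < p - 1"
  shows "g = 0"
proof (rule ccontr)
  assume "g \<noteq> 0"
  define f where "f = (shifted_cyclotomic p :: int poly)"
  define R where "R = (\<lambda>g::int poly. g \<noteq> 0 \<and> poly (map_poly of_int g) (z - 1) = 0)"
  have p0: "p > 1" using p by (simp add: prime_gt_Suc_0_nat)
  have "poly (map_poly of_int f) (z - 1) = 0"
    using poly_shifted_cyclotomic[of p "z - 1"] z
    by (simp add: f_def map_poly_of_int_shifted_cyclotomic)
  have "R g" using \<open>g \<noteq> 0\<close> root by (simp add: R_def)
  then obtain h where h: "R h" and hmin: "\<And>k. R k \<Longrightarrow> degree h \<le> degree k"
    using ex_has_least_nat[of R g degree] by blast
  have hz: "h \<noteq> 0" using h by (simp add: R_def)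
  have dh: "degree h < p - 1" using hmin[OF \<open>R g\<close>] deg by simp
  have df: "degree f = p - 1" using p0 by (simp add: f_def degree_shifted_cyclotomic)
  have dh0: "degree h > 0"
  proof (rule ccontr)
    assume "\<not> degree h > 0"
    then obtain c where "h = [:c:]" by (auto elim: degree_eq_zeroE)
    with h show False by (auto simp: R_def map_poly_pCons)
  qed
  obtain a q where a: "a \<noteq> 0" "smult a f = h * q + pseudo_mod f h"
    using pseudo_mod(1)[OF hz, of f] by blast
  have "pseudo_mod f h = 0"
  proof (rule ccontr)
    assume nz: "pseudo_mod f h \<noteq> 0"
    have "[:a:] * f = h * q + pseudo_mod f h" using a by simp
    hence "poly (map_poly of_int ([:a:] * f)) (z - 1) = poly (map_poly of_int (h * q + pseudo_mod f h)) (z - 1)"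
      by simp
    hence "R (pseudo_mod f h)" using nz h \<open>poly (map_poly of_int f) (z - 1) = 0\<close>
      unfolding map_poly_of_int_mult map_poly_of_int_add by (simp add: R_def)
    from hmin[OF this] show False using pseudo_mod(2)[OF hz, of f] nz by simp
  qed
  hence af: "[:a:] * f = h * q" using a by simp
  have lcf: "lead_coeff f = 1"
    unfolding df using p0 by (simp add: f_def coeff_shifted_cyclotomic del: binomial_Suc_Suc)
  have fac: "degree g = 0 \<or> degree h = 0" if "f = g * h" for g h
  proof (rule eisenstein_int_poly[where p = "int p"])
    show "prime (int p)" using p by simp
    show "\<not> int p dvd lead_coeff f" using lcf p0 by simp
    show "int p dvd coeff f i" if "i < degree f" for i
    proof -
      have "p dvd (p choose Suc i)"
        using that df by (intro dvd_choose_prime) (auto simp: p)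
      thus ?thesis using that df by (simp add: f_def coeff_shifted_cyclotomic del: binomial_Suc_Suc)
    qed
    have "\<not> p\<^sup>2 dvd p" using p0 by (auto simp: power2_eq_square dest: dvd_imp_le)
    hence "\<not> (int p)\<^sup>2 dvd int p" by (metis int_dvd_int_iff of_nat_power)
    thus "\<not> (int p)\<^sup>2 dvd coeff f 0"
      using p0 by (simp add: f_def coeff_shifted_cyclotomic)
  qed (fact that)
  have irr: "irreducible f"
  proof (rule irreducibleI)
    show "f \<noteq> 0" using lcf by auto
    show "\<not> f dvd 1" using df dh by (auto simp: is_unit_poly_iff)
    fix u v assume uv: "f = u * v"
    have "lead_coeff u * lead_coeff v = 1" using lcf uv by (simp add: lead_coeff_mult)
    hence "is_unit (lead_coeff u)" "is_unit (lead_coeff v)"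
      by (metis dvd_triv_left, metis dvd_triv_right)
    thus "u dvd 1 \<or> v dvd 1" using fac[OF uv] by (auto simp: is_unit_poly_iff elim!: degree_eq_zeroE)
  qed
  hence pf: "prime_elem f" by (rule irreducible_imp_prime_elem)
  have "f dvd h * q" unfolding af[symmetric] by (rule dvd_triv_right)
  hence "f dvd h \<or> f dvd q" using pf by (simp add: prime_elem_dvd_mult_iff)
  thus False
  proof
    assume "f dvd h"
    thus False using dvd_imp_degree_le[of f h] hz df dh by simp
  next
    assume "f dvd q"
    then obtain s where "q = f * s" by blast
    with af have "f * [:a:] = f * (h * s)" by (simp add: mult_ac)
    moreover have "f \<noteq> 0" using lcf by auto
    ultimately have as: "[:a:] = h * s" using mult_left_cancel by blast
    hence "s \<noteq> 0" using a by auto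
    hence "degree [:a:] = degree h + degree s" unfolding as using hz by (intro degree_mult_eq)
    thus False using dh0 by simp
  qed
qed

lemma poly_map_poly_of_int_pcompose:
  fixes x :: "'a :: comm_ring_1"
  shows "poly (map_poly of_int (pcompose g h)) x = poly (map_poly of_int g) (poly (map_poly of_int h) x)"
  by (induction g) (simp_all add: pcompose_pCons map_poly_of_int_add map_poly_of_int_mult map_poly_pCons)

section \<open>Linear relations and divisibility in the ring Z[z]\<close>

locale prime_root =
  fixes p :: nat and z :: complex
  assumes prime_p: "prime p" and z_pow: "z ^ p = 1" and z_neq: "z \<noteq> 1"
begin

lemma sum_powers: "(\<Sum>j<p. z ^ j) = 0"
  using z_neq z_pow by (simp add: geometric_sum)

text \<open>Subtracting \<open>c (p - 1)\<close> times the vanishing sum of all powers leaves an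
  integer polynomial of degree below \<open>p - 1\<close> with root \<open>z\<close>, hence zero.
  Every passage from an identity of character sums to one of multiplicities goes through this
  lemma.\<close>

lemma int_relation:
  fixes c :: "nat \<Rightarrow> int"
  assumes rel: "(\<Sum>j<p. of_int (c j) * z ^ j) = 0" and j: "j < p"
  shows "c j = c (p - 1)"
proof -
  define d where "d j = c j - c (p - 1)" for j
  define g where "g = (\<Sum>j<p - 1. monom (d j) j)"
  have cg: "coeff g i = (if i < p - 1 then d i else 0)" for i
    by (simp add: g_def coeff_sum)
  have p0: "p > 1" using prime_p by (simp add: prime_gt_Suc_0_nat)
  have dg: "degree g < p - 1"
    by (rule degree_lessI) (use p0 cg in auto)
  have "poly (map_poly of_int g) z = (\<Sum>j<p - 1. of_int (d j) * z ^ j)"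
  proof -
    have "map_poly of_int g = (\<Sum>j<p - 1. monom (of_int (d j) :: complex) j)"
      by (intro poly_eqI) (simp add: coeff_map_poly cg coeff_sum)
    thus ?thesis by (simp add: poly_sum poly_monom)
  qed
  also have "\<dots> = (\<Sum>j<p. of_int (d j) * z ^ j)"
  proof (intro sum.mono_neutral_left ballI)
    fix i assume "i \<in> {..<p} - {..<p - 1}"
    hence "i = p - 1" by auto
    thus "of_int (d i) * z ^ i = 0" by (simp add: d_def)
  qed auto
  also have "\<dots> = (\<Sum>j<p. of_int (c j) * z ^ j) - of_int (c (p - 1)) * (\<Sum>j<p. z ^ j)"
    by (simp add: d_def left_diff_distrib sum_subtractf sum_distrib_left)
  also have "\<dots> = 0" by (simp add: rel sum_powers)
  finally have "poly (map_poly of_int (pcompose g [:1, 1:])) (z - 1) = 0"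
    by (simp add: poly_map_poly_of_int_pcompose map_poly_pCons)
  moreover have "degree (pcompose g [:1, 1:]) < p - 1"
    using dg by (simp add: degree_pcompose)
  ultimately have "pcompose g [:1, 1:] = 0"
    by (intro int_poly_root_of_unity_degree[OF prime_p z_pow z_neq])
  hence "g = 0" by (rule pcompose_eq_0) simp
  hence "d j = 0" if "j < p - 1" using cg[of j] that by simp
  thus ?thesis using j by (cases "j = p - 1") (auto simp: d_def)
qed

definition zint :: "complex set" where
  "zint = {w. \<exists>c::nat \<Rightarrow> int. w = (\<Sum>j<p. of_int (c j) * z ^ j)}"

lemma power_mod: "z ^ (n mod p) = z ^ n"
proof -
  have "z ^ n = z ^ (p * (n div p) + n mod p)" by simp
  also have "\<dots> = z ^ (n mod p)" by (simp only: power_add power_mult z_pow) simp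
  finally show ?thesis ..
qed

lemma p_pos: "p > 0"
  using prime_p by (simp add: prime_gt_0_nat)

lemma fold_exponents:
  assumes "finite S"
  shows "(\<Sum>s\<in>S. of_int (w s) * z ^ e s) = (\<Sum>j<p. of_int (\<Sum>s\<in>{s\<in>S. e s mod p = j}. w s) * z ^ j)"
proof -
  have "(\<Sum>j<p. of_int (\<Sum>s\<in>{s\<in>S. e s mod p = j}. w s) * z ^ j)
      = (\<Sum>j<p. \<Sum>s\<in>{s\<in>S. e s mod p = j}. of_int (w s) * z ^ e s)"
    by (intro sum.cong refl) (auto simp: sum_distrib_right power_mod intro!: sum.cong)
  also have "\<dots> = (\<Sum>s\<in>S. of_int (w s) * z ^ e s)"
    by (rule sum.group) (use assms p_pos in auto)
  finally show ?thesis ..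
qed

lemma zint_sum_powers: "finite S \<Longrightarrow> (\<Sum>s\<in>S. of_int (w s) * z ^ e s) \<in> zint"
  unfolding zint_def by (intro CollectI exI) (rule fold_exponents)

lemma zint_of_int [simp, intro]: "of_int k \<in> zint"
  using zint_sum_powers[of "{0::nat}" "\<lambda>_. k" "\<lambda>_. 0"] by simp

lemma zint_of_nat [simp, intro]: "of_nat k \<in> zint"
  using zint_of_int[of "int k"] by simp

lemma zint_0 [simp, intro]: "0 \<in> zint" and zint_1 [simp, intro]: "1 \<in> zint"
  using zint_of_int[of 0] zint_of_int[of 1] by simp_all

lemma zint_numeral [simp, intro]: "numeral k \<in> zint"
  using zint_of_int[of "numeral k"] by simp

lemma zint_power_z [simp, intro]: "z ^ k \<in> zint"
  using zint_sum_powers[of "{0::nat}" "\<lambda>_. 1" "\<lambda>_. k"] by simp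

lemma zint_z [simp, intro]: "z \<in> zint"
  using zint_power_z[of 1] by simp

lemma zint_add [simp, intro]: "a \<in> zint \<Longrightarrow> b \<in> zint \<Longrightarrow> a + b \<in> zint"
  unfolding zint_def
proof safe
  fix c d :: "nat \<Rightarrow> int"
  show "\<exists>ca. (\<Sum>j<p. of_int (c j) * z ^ j) + (\<Sum>j<p. of_int (d j) * z ^ j) = (\<Sum>j<p. of_int (ca j) * z ^ j)"
    by (rule exI[of _ "\<lambda>j. c j + d j"]) (simp add: sum.distrib algebra_simps)
qed

lemma zint_mult [simp, intro]: "a \<in> zint \<Longrightarrow> b \<in> zint \<Longrightarrow> a * b \<in> zint"
proof -
  assume "a \<in> zint" "b \<in> zint"
  then obtain c d where a: "a = (\<Sum>j<p. of_int (c j) * z ^ j)" and b: "b = (\<Sum>j<p. of_int (d j) * z ^ j)"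
    by (auto simp: zint_def)
  have "a * b = (\<Sum>(i,j)\<in>{..<p}\<times>{..<p}. of_int (c i * d j) * z ^ (i + j))"
    by (simp add: a b sum_product sum.cartesian_product power_add mult_ac)
  also have "\<dots> \<in> zint"
    using zint_sum_powers[of "{..<p}\<times>{..<p}" "\<lambda>(i,j). c i * d j" "\<lambda>(i,j). i + j"]
    by (simp add: case_prod_unfold)
  finally show ?thesis .
qed

lemma zint_uminus [simp, intro]: "a \<in> zint \<Longrightarrow> - a \<in> zint"
  using zint_mult[of "of_int (- 1)" a] zint_of_int[of "- 1"] by simp

lemma zint_diff [simp, intro]: "a \<in> zint \<Longrightarrow> b \<in> zint \<Longrightarrow> a - b \<in> zint"
  using zint_add[of a "- b"] by simp

lemma zint_power [simp, intro]: "a \<in> zint \<Longrightarrow> a ^ k \<in> zint"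
  by (induction k) auto

lemma zint_sum [intro]: "(\<And>x. x \<in> S \<Longrightarrow> f x \<in> zint) \<Longrightarrow> sum f S \<in> zint"
  by (induction S rule: infinite_finite_induct) auto

text \<open>Divisibility has to be taken relative to \<open>zint\<close>, since \<open>dvd\<close>
  on the field of complex numbers says nothing.\<close>

definition zdvd :: "complex \<Rightarrow> complex \<Rightarrow> bool" where
  "zdvd m a \<longleftrightarrow> (\<exists>c\<in>zint. a = m * c)"

lemma zdvd_0 [simp]: "zdvd m 0"
  unfolding zdvd_def by (intro bexI[of _ 0]) auto

lemma zdvd_triv [intro]: "c \<in> zint \<Longrightarrow> zdvd m (m * c)" "c \<in> zint \<Longrightarrow> zdvd m (c * m)"
  by (auto simp: zdvd_def mult_ac)

lemma zdvd_add [intro]: "zdvd m a \<Longrightarrow> zdvd m b \<Longrightarrow> zdvd m (a + b)"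
  unfolding zdvd_def by (metis zint_add distrib_left)

lemma zdvd_uminus [intro]: "zdvd m a \<Longrightarrow> zdvd m (- a)"
  unfolding zdvd_def by (metis zint_uminus mult_minus_right)

lemma zdvd_diff [intro]: "zdvd m a \<Longrightarrow> zdvd m b \<Longrightarrow> zdvd m (a - b)"
  using zdvd_add[of m a "- b"] by auto

lemma zdvd_mult [intro]: "zdvd m a \<Longrightarrow> c \<in> zint \<Longrightarrow> zdvd m (a * c)" "zdvd m a \<Longrightarrow> c \<in> zint \<Longrightarrow> zdvd m (c * a)"
  unfolding zdvd_def by (metis zint_mult mult.assoc, metis zint_mult mult.assoc mult.commute)

lemma zdvd_mono: "zdvd m a \<Longrightarrow> zdvd n b \<Longrightarrow> zdvd (m * n) (a * b)"
  unfolding zdvd_def by (auto intro!: bexI[of _ "_ * _"] simp: mult_ac)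

lemma zdvd_trans: "zdvd a b \<Longrightarrow> zdvd b c \<Longrightarrow> zdvd a c"
  unfolding zdvd_def by (metis zint_mult mult.assoc)

lemma zdvd_sum [intro]: "(\<And>x. x \<in> S \<Longrightarrow> zdvd m (f x)) \<Longrightarrow> zdvd m (sum f S)"
  by (induction S rule: infinite_finite_induct) auto

lemma zdvd_power_diff:
  assumes "a \<in> zint" "b \<in> zint" shows "zdvd (a - b) (a ^ k - b ^ k)"
  unfolding power_diff_sumr2 using assms by (intro zdvd_triv zint_sum) auto

section \<open>The element rho = z - 1 above p, and p-th powers near 1\<close>

definition rho :: complex where "rho = z - 1"

lemma zint_rho [simp, intro]: "rho \<in> zint"
  by (simp add: rho_def)

lemma shifted_cyclotomic_value:
  assumes t: "t \<in> zint" and p2: "p > 2"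
  obtains y where "y \<in> zint" "poly (shifted_cyclotomic p) t = of_nat p + of_nat p * t * y + t ^ (p - 1)"
proof -
  have "p dvd (p choose Suc i)" if "i \<in> {1..<p - 1}" for i
    using that by (intro dvd_choose_prime) (auto simp: prime_p)
  hence "\<exists>c. \<forall>i\<in>{1..<p - 1}. (p choose Suc i) = p * c i"
    by (intro bchoice) (auto simp: dvd_def)
  then obtain c where c: "\<And>i. i \<in> {1..<p - 1} \<Longrightarrow> (p choose Suc i) = p * c i" by blast
  define y where "y = (\<Sum>i\<in>{1..<p - 1}. of_nat (c i) * t ^ (i - 1))"
  have dec: "{..<p} = insert 0 (insert (p - 1) {1..<p - 1})" using p2 by auto
  have "poly (shifted_cyclotomic p) t = (\<Sum>i<p. of_nat (p choose Suc i) * t ^ i)"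
    by (simp add: shifted_cyclotomic_def poly_sum poly_monom)
  also have "\<dots> = of_nat p + t ^ (p - 1) + (\<Sum>i\<in>{1..<p - 1}. of_nat (p choose Suc i) * t ^ i)"
    unfolding dec using p2 by (simp del: binomial_Suc_Suc)
  also have "(\<Sum>i\<in>{1..<p - 1}. of_nat (p choose Suc i) * t ^ i)
      = (\<Sum>i\<in>{1..<p - 1}. of_nat p * t * (of_nat (c i) * t ^ (i - 1)))"
  proof (rule sum.cong)
    fix i assume i: "i \<in> {1..<p - 1}"
    hence "t ^ i = t * t ^ (i - 1)" by (cases i) auto
    thus "of_nat (p choose Suc i) * t ^ i = of_nat p * t * (of_nat (c i) * t ^ (i - 1))"
      by (simp add: c[OF i] mult_ac)
  qed simp
  also have "\<dots> = of_nat p * t * y" by (simp add: y_def sum_distrib_left)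
  finally show ?thesis
    using that[of y] t by (auto simp: y_def intro!: zint_sum zint_mult simp: add_ac)
qed

lemma rho_power:
  assumes "p > 2" obtains y where "y \<in> zint" "rho ^ (p - 1) = - (of_nat p * (1 + rho * y))"
proof -
  obtain y where y: "y \<in> zint" "poly (shifted_cyclotomic p) rho = of_nat p + of_nat p * rho * y + rho ^ (p - 1)"
    using shifted_cyclotomic_value[of rho] assms by auto
  have "poly (shifted_cyclotomic p) rho = 0"
    using poly_shifted_cyclotomic[of p rho] z_neq z_pow by (simp add: rho_def)
  with y show ?thesis by (intro that[of y]) (auto simp: algebra_simps eq_neg_iff_add_eq_0)
qed

text \<open>No unit is inverted. The equation p = - rho ^ (p - 1) - rho * p * y shows that rho
  divides p; then its last term has a second factor rho, and its first has one because p - 1 is at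
  least 2.\<close>

lemma zdvd_rho2_p:
  assumes "p > 2" shows "zdvd (rho\<^sup>2) (of_nat p)"
proof -
  obtain y where y: "y \<in> zint" "rho ^ (p - 1) = - (of_nat p * (1 + rho * y))"
    using rho_power assms by blast
  have eq: "of_nat p = - (rho ^ (p - 1)) - rho * (of_nat p * y)"
    unfolding y(2) by (simp add: algebra_simps)
  have r: "rho ^ (p - 1) = rho\<^sup>2 * rho ^ (p - 3)"
  proof -
    have "p - 1 = 2 + (p - 3)" using assms by simp
    thus ?thesis by (simp only: power_add)
  qed
  have r2: "zdvd (rho\<^sup>2) (rho ^ (p - 1))" unfolding r by (intro zdvd_triv) auto
  have "rho\<^sup>2 = rho * rho" by (simp add: power2_eq_square)
  hence r1: "zdvd rho (rho ^ (p - 1))" by (intro zdvd_trans[OF _ r2]) (auto intro!: zdvd_triv)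
  have "zdvd rho (of_nat p)"
    by (subst eq) (use r1 y(1) in auto)
  hence "zdvd (rho * rho) (rho * (of_nat p * y))"
    using y(1) by (intro zdvd_mono) (auto simp: zdvd_def intro: exI[of _ 1] bexI[of _ 1])
  hence "zdvd (rho\<^sup>2) (rho * (of_nat p * y))" by (simp add: power2_eq_square)
  thus ?thesis by (subst eq) (use r2 in auto)
qed

text \<open>Since \<open>t\<close> is divisible by \<open>rho ^ 2\<close>, the term
  \<open>t ^ (p - 1)\<close> contains \<open>rho ^ (p - 1)\<close> twice: one copy supplies the
  factor \<open>p\<close>, the other a spare \<open>rho\<close>.\<close>

lemma power_p_minus_1:
  assumes "p > 2" "t \<in> zint" "zdvd (rho\<^sup>2) t"
  obtains s where "s \<in> zint" "(1 + t) ^ p - 1 = of_nat p * t * (1 + rho * s)"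
proof -
  obtain y where y: "y \<in> zint" "poly (shifted_cyclotomic p) t = of_nat p + of_nat p * t * y + t ^ (p - 1)"
    using shifted_cyclotomic_value[of t] assms by auto
  obtain u where u: "u \<in> zint" "t = rho\<^sup>2 * u" using assms by (auto simp: zdvd_def)
  obtain v where v: "v \<in> zint" "rho ^ (p - 1) = - (of_nat p * (1 + rho * v))"
    using rho_power assms by blast
  have "t ^ (p - 1) = rho ^ (p - 1) * rho ^ (p - 1) * u ^ (p - 1)"
    by (simp add: u(2) power_mult_distrib power2_eq_square)
  also have "\<dots> = of_nat p * rho * (- ((1 + rho * v) * rho ^ (p - 2) * u ^ (p - 1)))"
  proof -
    have "p - 1 = Suc (p - 2)" using assms by simp
    hence "rho ^ (p - 1) = rho * rho ^ (p - 2)" by (simp only: power_Suc)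
    hence "rho ^ (p - 1) * rho ^ (p - 1) = - (of_nat p * (1 + rho * v)) * (rho * rho ^ (p - 2))"
      by (metis v(2))
    thus ?thesis by (simp add: mult_ac)
  qed
  finally have "t ^ (p - 1) = of_nat p * rho * (- ((1 + rho * v) * rho ^ (p - 2) * u ^ (p - 1)))" .
  hence "poly (shifted_cyclotomic p) t
      = of_nat p * (1 + rho * (rho * u * y - ((1 + rho * v) * rho ^ (p - 2) * u ^ (p - 1))))"
    unfolding y(2) by (simp add: u(2) algebra_simps power2_eq_square)
  moreover have "(1 + t) ^ p - 1 = poly (shifted_cyclotomic p) t * t"
    by (simp add: poly_shifted_cyclotomic)
  ultimately show ?thesis using u v y
    by (intro that[of "rho * u * y - ((1 + rho * v) * rho ^ (p - 2) * u ^ (p - 1))"])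
       (auto simp: mult_ac)
qed

section \<open>Lucas sequences in Z[z]\<close>

lemma lucas_expansion:
  fixes V :: "nat \<Rightarrow> complex" and M :: complex
  assumes "w \<in> zint" "M \<in> zint" "V 0 = 2" "V 1 = w" "\<And>n. V (n + 2) = w * V (n + 1) - M * V n"
  shows "zdvd (M\<^sup>2) (V (n + 2) - (w ^ (n + 2) - of_nat (n + 2) * M * w ^ n))"
proof -
  let ?D = "\<lambda>n. V (n + 2) - (w ^ (n + 2) - of_nat (n + 2) * M * w ^ n)"
  \<comment> \<open>If w = \<alpha> + \<beta> and M = \<alpha> * \<beta>, then \<open>V n\<close> is
    \<alpha> ^ n + \<beta> ^ n, and the two subtracted terms begin its expansion in powers of M. The
    recurrence has order two, so two consecutive indices are carried along.\<close>
  have "zdvd (M\<^sup>2) (?D n) \<and> zdvd (M\<^sup>2) (?D (n + 1)) \<and> ?D n \<in> zint"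
  proof (induction n)
    case 0
    have "V 2 = w * w - 2 * M" using assms(3,4) assms(5)[of 0] by (simp add: numeral_2_eq_2 mult.commute)
    moreover have "V 3 = w * V 2 - M * w" using assms(4) assms(5)[of 1] by (simp add: numeral_eq_Suc)
    hence "V 3 = w * (w * w - 2 * M) - M * w" using calculation by simp
    ultimately have "V 2 - (w ^ 2 - of_nat 2 * M * w ^ 0) = 0" "V 3 - (w ^ 3 - of_nat 3 * M * w ^ 1) = 0"
      using assms(3) by (simp_all add: power2_eq_square power3_eq_cube algebra_simps)
    moreover have "0 + 2 = (2::nat)" "0 + 1 + 2 = (3::nat)" by simp_all
    ultimately show ?case by (metis zdvd_0 zint_0 add_0)
  next
    case (Suc n)
    have "?D (n + 2) = w * ?D (n + 1) - M * ?D n + M\<^sup>2 * (of_nat (n + 2) * w ^ n)"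
      using assms(5)[of "n + 2"]
      by (simp add: algebra_simps power2_eq_square numeral_eq_Suc)
    moreover have "zdvd (M\<^sup>2) (w * ?D (n + 1) - M * ?D n + M\<^sup>2 * (of_nat (n + 2) * w ^ n))"
    proof (rule zdvd_add[OF zdvd_diff])
      show "zdvd (M\<^sup>2) (M\<^sup>2 * (of_nat (n + 2) * w ^ n))"
        using assms(1) by (intro zdvd_triv zint_mult zint_power zint_of_nat)
      show "zdvd (M\<^sup>2) (w * ?D (n + 1))" using Suc assms(1) by (intro zdvd_mult(2)) auto
      show "zdvd (M\<^sup>2) (M * ?D n)" using Suc assms(2) by (intro zdvd_mult(2)) auto
    qed
    ultimately have d: "zdvd (M\<^sup>2) (?D (n + 2))" by simp
    have "?D (n + 1) \<in> zint"
      using Suc assms(2) unfolding zdvd_def by (metis zint_mult zint_power)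
    moreover have "Suc n + 1 = n + 2" by simp
    ultimately show ?case using Suc d by (metis Suc_eq_plus1)
  qed
  thus ?thesis by blast
qed

text \<open>For t = w - 1, \<open>power_p_minus_1\<close> gives w ^ p - 1 = p * t * (1 + rho * s),
  while \<open>V p = 1\<close> makes the same number congruent to p * M * w ^ (p - 2) modulo M ^ 2.
  Cancelling p shows that t and M agree up to factors congruent to 1 modulo rho.\<close>

lemma lucas_one_imp:
  fixes V :: "nat \<Rightarrow> complex"
  assumes p2: "p > 2" and N: "N \<ge> 2" and M: "M = of_nat (p ^ N)"
    and w: "w \<in> zint" "zdvd (rho\<^sup>2) (w - 1)"
    and V: "V 0 = 2" "V 1 = w" "\<And>n. V (n + 2) = w * V (n + 1) - M * V n"
    and one: "V p = 1"
  obtains r where "r \<in> zint" "w - 1 = M * (1 + rho * r)"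
proof -
  define P where "P = (of_nat p :: complex)"
  have P0: "P \<noteq> 0" using p_pos by (simp add: P_def)
  have MP: "M = P ^ N" by (simp add: M P_def)
  have Mz: "M \<in> zint" by (simp add: M)
  have Pz: "P \<in> zint" by (simp add: P_def)
  define t where "t = w - 1"
  have tz: "t \<in> zint" using w by (simp add: t_def)
  obtain s where s: "s \<in> zint" "(1 + t) ^ p - 1 = P * t * (1 + rho * s)"
    using power_p_minus_1[OF p2 tz] w by (auto simp: P_def t_def)
  obtain g where g: "g \<in> zint" "V p - (w ^ p - of_nat p * M * w ^ (p - 2)) = M\<^sup>2 * g"
  proof -
    have "p - 2 + 2 = p" using p2 by simp
    with lucas_expansion[of w M V "p - 2"] w(1) V Mz that show ?thesis
      unfolding zdvd_def by metis
  qed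
  have rP: "zdvd rho P"
    using zdvd_trans[OF _ zdvd_rho2_p[OF p2], of rho] unfolding P_def power2_eq_square by auto
  have rt: "zdvd rho t"
    using zdvd_trans[OF _ w(2), of rho] unfolding t_def power2_eq_square by auto
  \<comment> \<open>This is where \<open>N \<ge> 2\<close> matters: after p * M is split off from M
    ^ 2, a factor p remains, which is 0 modulo \<open>rho\<close>.\<close>
  have MM: "M\<^sup>2 = P * M * (P * P ^ (N - 2))"
  proof -
    have "N = Suc (Suc (N - 2))" using N by simp
    hence "P ^ N = P * (P * P ^ (N - 2))" by (metis power_Suc)
    thus ?thesis by (simp add: MP power2_eq_square mult_ac)
  qed
  have "w ^ p - 1 = P * M * w ^ (p - 2) - M\<^sup>2 * g"
    using g(2) one by (simp add: P_def algebra_simps)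
  also have "\<dots> = P * (M * (w ^ (p - 2) - P * P ^ (N - 2) * g))"
    unfolding MM by (simp add: algebra_simps)
  finally have "P * (t * (1 + rho * s)) = P * (M * (w ^ (p - 2) - P * P ^ (N - 2) * g))"
    using s(2) unfolding t_def by (metis add.commute diff_add_cancel mult.assoc)
  hence e1: "t * (1 + rho * s) = M * (w ^ (p - 2) - P * P ^ (N - 2) * g)"
    using P0 mult_left_cancel by blast
  have "zdvd (w - 1) (w ^ (p - 2) - 1 ^ (p - 2))"
    using w(1) by (intro zdvd_power_diff) auto
  hence d1: "zdvd rho (w ^ (p - 2) - 1 ^ (p - 2))"
    using rt zdvd_trans unfolding t_def by blast
  have d2: "zdvd rho (P * P ^ (N - 2) * g)"
    using zdvd_mult(1)[OF zdvd_mult(1)[OF rP]] g(1) Pz by blast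
  have "zdvd rho ((w ^ (p - 2) - 1 ^ (p - 2)) - P * P ^ (N - 2) * g)"
    by (rule zdvd_diff[OF d1 d2])
  then obtain r0 where r0: "r0 \<in> zint" "w ^ (p - 2) - P * P ^ (N - 2) * g = 1 + rho * r0"
    by (auto simp: zdvd_def algebra_simps)
  have e2: "t = M * (1 + rho * r0) - rho * s * t"
    using e1 r0(2) by (simp add: algebra_simps)
  \<comment> \<open>Instead of dividing by 1 + rho * s, the equation for \<open>t\<close> is
    substituted into itself. The error term gains a factor \<open>rho\<close> each time, until at (p
    - 1) * N factors it contains M.\<close>
  have "\<exists>r\<in>zint. \<exists>e\<in>zint. t = M * (1 + rho * r) + rho ^ Suc k * e * t" for k
  proof (induction k)
    case 0
    show ?case using e2 r0(1) s(1)
      by (intro bexI[of _ r0] bexI[of _ "- s"]) auto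
  next
    case (Suc k)
    then obtain r e where re: "r \<in> zint" "e \<in> zint" "t = M * (1 + rho * r) + rho ^ Suc k * e * t" by blast
    have "t = M * (1 + rho * r) + rho ^ Suc k * e * (M * (1 + rho * r0) - rho * s * t)"
      using re(3) e2 by simp
    also have "\<dots> = M * (1 + rho * (r + rho ^ k * e * (1 + rho * r0))) + rho ^ Suc (Suc k) * (- (e * s)) * t"
      by (simp add: algebra_simps)
    finally show ?case
      using re r0 s by (intro bexI[of _ "r + rho ^ k * e * (1 + rho * r0)"] bexI[of _ "- (e * s)"]) auto
  qed
  from this[of "(p - 1) * N"] obtain r e where re: "r \<in> zint" "e \<in> zint"
    "t = M * (1 + rho * r) + rho * (rho ^ (p - 1)) ^ N * e * t"
    by (auto simp: power_mult)
  obtain y where y: "y \<in> zint" "rho ^ (p - 1) = - (P * (1 + rho * y))"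
    using rho_power[OF p2] by (auto simp: P_def)
  define Y where "Y = (- (1 + rho * y)) ^ N"
  have Y: "Y \<in> zint" using y(1) by (simp add: Y_def)
  have "rho ^ (p - 1) = P * (- (1 + rho * y))" unfolding y(2) by (simp only: mult_minus_right)
  hence "(rho ^ (p - 1)) ^ N = M * Y"
    unfolding MP Y_def by (simp only: power_mult_distrib)
  hence "t = M * (1 + rho * r) + rho * (M * Y) * e * t"
    using re(3) by simp
  also have "\<dots> = M * (1 + rho * (r + Y * e * t))"
    by (simp add: algebra_simps)
  finally show ?thesis using re(1,2) Y tz
    by (intro that[of "r + Y * e * t"]) (auto simp: t_def)
qed

text \<open>For roots of unity \<open>v\<close>, \<open>v'\<close> with product 1,
  \<open>v + v' - 2 = (v - 1) ^ 2 * v'\<close> is divisible by \<open>rho ^ 2\<close>. The pairing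
  thus gains one factor \<open>rho\<close> over what a sum of powers of \<open>z\<close> satisfies
  by itself.\<close>

lemma sum_pair_real:
  assumes \<sigma>: "bij_betw \<sigma> X X"
    and h: "\<And>x. x \<in> X \<Longrightarrow> z ^ h x * z ^ h (\<sigma> x) = 1"
    and p2: "p > 2" and card: "zdvd (rho\<^sup>2) (of_nat (card X) + 1)"
  shows "zdvd (rho\<^sup>2) (- (\<Sum>x\<in>X. z ^ h x) - 1)"
proof -
  define w where "w = - (\<Sum>x\<in>X. z ^ h x)"
  have pair: "zdvd (rho\<^sup>2) (z ^ h x + z ^ h (\<sigma> x) - 2)" if "x \<in> X" for x
  proof -
    have "z ^ h x + z ^ h (\<sigma> x) - 2 = (z ^ h x - 1)\<^sup>2 * z ^ h (\<sigma> x)"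
      using h[OF that] by (simp add: power2_eq_square algebra_simps)
    moreover have "zdvd rho (z ^ h x - 1 ^ h x)"
      unfolding rho_def by (intro zdvd_power_diff) auto
    hence "zdvd (rho\<^sup>2) ((z ^ h x - 1)\<^sup>2)"
      unfolding power2_eq_square by (intro zdvd_mono) simp_all
    ultimately show ?thesis by auto
  qed
  have "(\<Sum>x\<in>X. z ^ h (\<sigma> x)) = (\<Sum>x\<in>X. z ^ h x)"
    by (rule sum.reindex_bij_betw[OF \<sigma>])
  hence "(\<Sum>x\<in>X. z ^ h x + z ^ h (\<sigma> x) - 2) = - 2 * w - 2 * of_nat (card X)"
    by (simp add: w_def sum.distrib sum_subtractf)
  moreover have "zdvd (rho\<^sup>2) (\<Sum>x\<in>X. z ^ h x + z ^ h (\<sigma> x) - 2)"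
    using pair by (rule zdvd_sum)
  ultimately have "zdvd (rho\<^sup>2) (- 2 * w - 2 * of_nat (card X))" by simp
  hence "zdvd (rho\<^sup>2) (- (- 2 * w - 2 * of_nat (card X)) - 2 * (of_nat (card X) + 1))"
    by (rule zdvd_diff[OF zdvd_uminus zdvd_mult(2)[OF card zint_numeral]])
  hence d: "zdvd (rho\<^sup>2) (2 * (w - 1))" by (simp add: algebra_simps)
  \<comment> \<open>Halving: 2 has the inverse \<open>k = (p + 1) / 2\<close> modulo
    \<open>rho ^ 2\<close>, because \<open>rho ^ 2\<close> divides \<open>p\<close>.\<close>
  have "odd p" using prime_p p2 by (simp add: prime_odd_nat)
  then obtain k where k: "p + 1 = 2 * k" by (metis dvd_def even_plus_one_iff)
  hence k': "of_nat k * 2 = (of_nat p + 1 :: complex)"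
    by (metis mult.commute of_nat_1 of_nat_add of_nat_mult of_nat_numeral)
  have "w - 1 = of_nat k * (2 * (w - 1)) - of_nat p * (w - 1)"
    unfolding mult.assoc[symmetric] k' by (simp add: algebra_simps)
  moreover have "zdvd (rho\<^sup>2) (of_nat k * (2 * (w - 1)) - of_nat p * (w - 1))"
    using d zdvd_rho2_p[OF p2] by (intro zdvd_diff zdvd_mult(2)[OF d] zdvd_mult(1)) (auto simp: w_def)
  ultimately show ?thesis by (simp add: w_def)
qed

text \<open>Otherwise w = 1 + M * (1 + rho * r). Read as a relation among powers of
  \<open>z\<close>, its coefficients are all equal and sum to 2 * M, so they are
  \<open>e = 2 * M / p\<close>, strictly between 0 and M. The multiplicities of the character sum,
  with 1 added at exponent 0, are nonnegative and congruent to \<open>e\<close> modulo M, hence at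
  least \<open>e\<close>; but they sum to M only.\<close>

lemma lucas_character_sum_neq_1:
  fixes V :: "nat \<Rightarrow> complex"
  assumes fin: "finite X" and \<sigma>: "bij_betw \<sigma> X X"
    and h: "\<And>x. x \<in> X \<Longrightarrow> z ^ h x * z ^ h (\<sigma> x) = 1"
    and p2: "p > 2" and N: "N \<ge> 2" and card: "card X + 1 = p ^ N"
    and V: "V 0 = 2" "V 1 = - (\<Sum>x\<in>X. z ^ h x)"
      "\<And>n. V (n + 2) = V 1 * V (n + 1) - of_nat (p ^ N) * V n"
  shows "V p \<noteq> 1"
proof
  assume one: "V p = 1"
  define M where "M = p ^ N"
  have cardM: "int (card X) + 1 = int M"
    using card unfolding M_def by (metis of_nat_1 of_nat_add)
  have "zdvd (rho\<^sup>2) (of_nat M)"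
  proof -
    have "M = p * p ^ (N - 1)" using N by (simp add: M_def flip: power_Suc)
    hence "of_nat M = (of_nat p * of_nat (p ^ (N - 1)) :: complex)" by (simp only: of_nat_mult)
    thus ?thesis using zdvd_rho2_p[OF p2] by auto
  qed
  moreover have "of_nat (card X) + 1 = (of_nat M :: complex)"
    using card unfolding M_def by (metis of_nat_1 of_nat_add)
  ultimately have "zdvd (rho\<^sup>2) (of_nat (card X) + 1)" by simp
  hence w: "zdvd (rho\<^sup>2) (V 1 - 1)"
    unfolding V(2) by (intro sum_pair_real[where \<sigma> = \<sigma>] \<sigma> h p2)
  have "V 1 \<in> zint" unfolding V(2) by (intro zint_uminus zint_sum) auto
  from lucas_one_imp[OF p2 N refl this w V(1) refl V(3) one]
  obtain r where r: "r \<in> zint" "V 1 - 1 = of_nat M * (1 + rho * r)"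
    unfolding M_def by blast
  obtain c where c: "r = (\<Sum>j<p. of_int (c j) * z ^ j)"
    using r(1) by (auto simp: zint_def)
  \<comment> \<open>The cyclic shift of \<open>c\<close> gives coefficients of \<open>z * r\<close>,
    so \<open>rho * r\<close> has the coefficients \<open>c' - c\<close>, whose total is 0.\<close>
  define c' where "c' j = c (if j = 0 then p - 1 else j - 1)" for j
  have zr: "z * r = (\<Sum>j<p. of_int (c' j) * z ^ j)"
  proof -
    have pS: "p = Suc (p - 1)" using p2 by simp
    have "z * r = (\<Sum>j<p. of_int (c j) * z ^ Suc j)"
      by (simp add: c sum_distrib_left mult_ac)
    also have "\<dots> = (\<Sum>j<p - 1. of_int (c j) * z ^ Suc j) + of_int (c (p - 1)) * z ^ p"
      by (subst (1) pS, subst sum.lessThan_Suc) (use pS in simp)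
    also have "\<dots> = of_int (c (p - 1)) + (\<Sum>j<p - 1. of_int (c' (Suc j)) * z ^ Suc j)"
      by (simp add: z_pow c'_def)
    also have "\<dots> = (\<Sum>j<p. of_int (c' j) * z ^ j)"
      by (subst (2) pS, subst sum.lessThan_Suc_shift) (simp add: c'_def)
    finally show ?thesis .
  qed
  have csum: "(\<Sum>j<p. c' j) = (\<Sum>j<p. c j)"
  proof -
    have pS: "p = Suc (p - 1)" using p2 by simp
    have "(\<Sum>j<p. c' j) = c (p - 1) + (\<Sum>j<p - 1. c j)"
      by (subst pS, subst sum.lessThan_Suc_shift) (simp add: c'_def)
    also have "\<dots> = (\<Sum>j<p. c j)"
      by (subst (3) pS, subst sum.lessThan_Suc) simp
    finally show ?thesis .
  qed
  define n where "n j = (\<Sum>x\<in>{x\<in>X. h x mod p = j}. 1 :: int)" for j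
  have wn: "(\<Sum>x\<in>X. z ^ h x) = (\<Sum>j<p. of_int (n j) * z ^ j)"
    using fold_exponents[OF fin, of "\<lambda>_. 1" h] by (simp add: n_def)
  have nsum: "(\<Sum>j<p. n j) = int (card X)"
  proof -
    have "(\<Sum>j<p. n j) = (\<Sum>x\<in>X. 1)"
      unfolding n_def by (rule sum.group) (use fin p_pos in auto)
    thus ?thesis by simp
  qed
  define d where "d j = (if j = 0 then 1 + int M else 0) + n j + int M * (c' j - c j)" for j
  have "(\<Sum>j<p. of_int (d j) * z ^ j)
      = (\<Sum>j<p. of_int (if j = 0 then 1 + int M else 0) * z ^ j) + (\<Sum>j<p. of_int (n j) * z ^ j)
        + of_nat M * ((\<Sum>j<p. of_int (c' j) * z ^ j) - (\<Sum>j<p. of_int (c j) * z ^ j))"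
    by (simp add: d_def algebra_simps sum.distrib sum_subtractf sum_distrib_left)
  also have "(\<Sum>j<p. of_int (if j = 0 then 1 + int M else 0) * z ^ j) = (1 + of_nat M :: complex)"
  proof -
    have "(\<Sum>j<p. of_int (if j = 0 then 1 + int M else 0) * z ^ j)
        = (\<Sum>j\<in>{0}. of_int (if j = 0 then 1 + int M else 0) * z ^ j)"
      using p_pos by (intro sum.mono_neutral_right) auto
    thus ?thesis by simp
  qed
  also have "1 + of_nat M + (\<Sum>j<p. of_int (n j) * z ^ j)
        + of_nat M * ((\<Sum>j<p. of_int (c' j) * z ^ j) - (\<Sum>j<p. of_int (c j) * z ^ j))
      = 1 + of_nat M - V 1 + of_nat M * (rho * r)"
    using V(2) by (simp add: c[symmetric] zr[symmetric] wn[symmetric] rho_def algebra_simps)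
  also have "\<dots> = 0" using r(2) by (simp add: algebra_simps)
  finally have deq: "d j = d (p - 1)" if "j < p" for j
    using int_relation[of d] that by blast
  define e where "e = d (p - 1)"
  have de: "d j = e" if "j < p" for j unfolding e_def by (rule deq[OF that])
  have "(\<Sum>j<p. d j) = (\<Sum>j<p. e)" by (intro sum.cong refl) (use de in blast)
  hence "int p * e = (\<Sum>j<p. d j)" by simp
  also have "\<dots> = (\<Sum>j<p. if j = 0 then 1 + int M else 0) + (\<Sum>j<p. n j) + int M * ((\<Sum>j<p. c' j) - (\<Sum>j<p. c j))"
    by (simp add: d_def sum.distrib sum_distrib_left sum_subtractf right_diff_distrib)
  also have "\<dots> = 1 + int M + int (card X)"
    using p_pos by (simp add: csum nsum)
  also have "\<dots> = 2 * int M" using cardM by simp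
  finally have pe: "int p * e = 2 * int M" .
  have Mpos: "int M > 0" using p_pos by (simp add: M_def)
  have epos: "e > 0" 
  proof -
    have "int p * e > 0" using pe Mpos by simp
    thus ?thesis using p_pos by (simp add: zero_less_mult_iff)
  qed
  have elt: "e < int M"
  proof -
    have "2 * e < int p * e" using epos p2 by (intro mult_strict_right_mono) auto
    thus ?thesis using pe by simp
  qed
  define k where "k j = (if j = 0 then 1 else 0) + n j" for j
  have n_nonneg: "n j \<ge> 0" for j by (simp add: n_def)
  have ksum: "(\<Sum>j<p. k j) = int M"
    using nsum cardM p_pos by (simp add: k_def sum.distrib)
  have keq: "int M dvd k j - e" if "j < p" for j
  proof -
    have "k j - e = int M * (- (if j = 0 then 1 else 0) - (c' j - c j))"
      using de[OF that] by (auto simp: d_def k_def algebra_simps)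
    thus ?thesis by simp
  qed
  have kge: "k j \<ge> e" if "j < p" for j
  proof (rule ccontr)
    assume "\<not> k j \<ge> e"
    moreover have "k j \<ge> 0" using n_nonneg[of j] by (simp add: k_def)
    ultimately have "\<bar>k j - e\<bar> < int M" "k j - e \<noteq> 0" using elt by auto
    thus False using dvd_imp_le_int[OF _ keq[OF that]] by simp
  qed
  have "int p * e \<le> (\<Sum>j<p. k j)"
    using sum_mono[of "{..<p}" "\<lambda>_. e" k] kge by simp
  thus False using pe ksum Mpos by simp
qed

end

section \<open>Lifting Kloosterman sums\<close>

text \<open>This is f'(0) / f(0), which turns products into sums. For a monic polynomial with
  nonzero roots it is minus the sum of the inverse roots, and on the reflected polynomial minus the
  sum of the roots.\<close>

definition log_deriv_0 :: "'k::field poly \<Rightarrow> 'k" where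
  "log_deriv_0 g = coeff g 1 / coeff g 0"

lemma log_deriv_0_1 [simp]: "log_deriv_0 1 = 0"
  by (simp add: log_deriv_0_def)

lemma log_deriv_0_mult:
  assumes "coeff f 0 \<noteq> 0" "coeff g 0 \<noteq> 0"
  shows "log_deriv_0 (f * g) = log_deriv_0 f + log_deriv_0 g"
proof -
  have "{..Suc 0} = {0, Suc 0}" by auto
  thus ?thesis using assms
    by (simp add: log_deriv_0_def coeff_mult field_simps)
qed

lemma log_deriv_0_prod:
  assumes "\<And>x. x \<in> S \<Longrightarrow> coeff (f x) 0 \<noteq> 0"
  shows "log_deriv_0 (\<Prod>x\<in>S. f x) = (\<Sum>x\<in>S. log_deriv_0 (f x))"
  using assms
proof (induction S rule: infinite_finite_induct)
  case (insert x S)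
  have "coeff (\<Prod>x\<in>S. f x) 0 = (\<Prod>x\<in>S. coeff (f x) 0)" by (induction S rule: infinite_finite_induct) (auto simp: coeff_mult)
  with insert show ?case by (simp add: log_deriv_0_mult)
qed auto

definition unit_monics :: "nat \<Rightarrow> 'k::field poly set" where
  "unit_monics d = {g. lead_coeff g = 1 \<and> degree g = d \<and> coeff g 0 \<noteq> 0}"

definition unit_irreducibles :: "'k::field poly set" where
  "unit_irreducibles = {P. irreducible P \<and> lead_coeff P = 1 \<and> coeff P 0 \<noteq> 0}"

lemma finite_degree_le: "finite {g :: 'k::{field,finite} poly. degree g \<le> d}"
proof (rule finite_subset)
  show "{g :: 'k poly. degree g \<le> d} \<subseteq> Poly ` {xs. set xs \<subseteq> UNIV \<and> length xs \<le> Suc d}"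
  proof
    fix g :: "'k poly" assume "g \<in> {g. degree g \<le> d}"
    hence "length (coeffs g) \<le> Suc d" by (cases "g = 0") (auto simp: length_coeffs_degree)
    thus "g \<in> Poly ` {xs. set xs \<subseteq> UNIV \<and> length xs \<le> Suc d}"
      by (intro image_eqI[of _ _ "coeffs g"]) auto
  qed
qed (intro finite_imageI finite_lists_length_le finite)

lemma finite_unit_monics [simp, intro]: "finite (unit_monics d :: 'k::{field,finite} poly set)"
  by (rule finite_subset[OF _ finite_degree_le[of d]]) (auto simp: unit_monics_def)

lemma unit_monics_0: "unit_monics 0 = {1}"
  by (auto simp: unit_monics_def one_pCons elim!: degree_eq_zeroE)

lemma unit_monics_1: "unit_monics 1 = (\<lambda>x. [:- x, 1:]) ` (UNIV - {0})"
proof (intro equalityI subsetI)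
  fix g :: "'a poly" assume g: "g \<in> unit_monics 1"
  obtain a h where gh: "g = pCons a h" by (cases g)
  have "degree h = 0" using g by (auto simp: unit_monics_def gh split: if_splits)
  then obtain b where "g = [:a, b:]" using gh by (auto elim: degree_eq_zeroE)
  with g show "g \<in> (\<lambda>x. [:- x, 1:]) ` (UNIV - {0})"
    by (intro image_eqI[of _ _ "- a"]) (auto simp: unit_monics_def split: if_splits)
qed (auto simp: unit_monics_def)

lemma unit_irreducibles_degree: "P \<in> unit_irreducibles \<Longrightarrow> degree P > 0"
  by (auto simp: unit_irreducibles_def irreducible_def is_unit_iff_degree intro!: Nat.gr0I)

lemma degree_eq_sum_prime_powers:
  fixes g :: "'k::{field_gcd,finite} poly"
  assumes g: "g \<in> unit_monics d"
  shows "(\<Sum>(P,k)\<in>{(P,k). P \<in> unit_irreducibles \<and> 1 \<le> k \<and> P ^ k dvd g}. degree P) = d"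
proof -
  have g0: "g \<noteq> 0" and lg: "lead_coeff g = 1" and dg: "degree g = d" and cg: "coeff g 0 \<noteq> 0"
    using g by (auto simp: unit_monics_def)
  have ng: "normalize g = g"
    using lg by (simp add: normalize_poly_eq_map_poly)
  have lc1: "lead_coeff P = 1" if "prime P" for P :: "'k poly"
  proof -
    have "unit_factor P = 1" using that by (metis prime_def normalize_1_iff prime_elem_not_zeroI unit_factor_normalize that)
    hence "unit_factor (lead_coeff P) = 1" by (simp add: unit_factor_poly_def one_pCons)
    moreover have "lead_coeff P dvd 1" using that by (auto simp: dvd_field_iff)
    ultimately show ?thesis by (simp add: is_unit_unit_factor)
  qed
  have pf: "prime_factors g = {P \<in> unit_irreducibles. P dvd g}"
  proof safe
    fix P assume P: "P \<in> prime_factors g"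
    hence "P dvd g" "prime P" by (auto simp: in_prime_factors_iff)
    thus "P dvd g" by simp
    from \<open>P dvd g\<close> obtain h where "g = P * h" by blast
    with cg have "coeff P 0 \<noteq> 0" by (auto simp: coeff_mult)
    with \<open>prime P\<close> lc1 show "P \<in> unit_irreducibles"
      by (auto simp: unit_irreducibles_def prime_def intro: prime_elem_imp_irreducible)
  next
    fix P assume P: "P \<in> unit_irreducibles" "P dvd g"
    hence "prime_elem P" "lead_coeff P = 1"
      by (auto simp: unit_irreducibles_def field_poly_irreducible_imp_prime)
    hence "prime P" by (simp add: prime_def normalize_poly_eq_map_poly)
    with P g0 show "P \<in> prime_factors g" by (auto simp: in_prime_factors_iff)
  qed
  have eq: "{(P,k). P \<in> unit_irreducibles \<and> 1 \<le> k \<and> P ^ k dvd g}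
      = Sigma (prime_factors g) (\<lambda>P. {1..multiplicity P g})"
  proof -
    have iff: "P ^ k dvd g \<longleftrightarrow> k \<le> multiplicity P g" if "P \<in> unit_irreducibles" for P k
    proof (rule power_dvd_iff_le_multiplicity)
      show "\<not> P dvd 1" using that by (auto simp: unit_irreducibles_def irreducible_def)
    qed (rule g0)
    have dvd: "P dvd g" if "1 \<le> k" "P ^ k dvd g" for P k
      using that(1) by (intro dvd_trans[OF dvd_power that(2)]) simp
    show ?thesis unfolding pf
    proof (intro equalityI subsetI)
      fix x assume "x \<in> {(P, k). P \<in> unit_irreducibles \<and> 1 \<le> k \<and> P ^ k dvd g}"
      then obtain P k where "x = (P, k)" "P \<in> unit_irreducibles" "1 \<le> k" "P ^ k dvd g" by blast
      thus "x \<in> Sigma {P \<in> unit_irreducibles. P dvd g} (\<lambda>P. {1..multiplicity P g})"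
        using dvd[of k P] iff[of P k] by simp
    next
      fix x assume "x \<in> Sigma {P \<in> unit_irreducibles. P dvd g} (\<lambda>P. {1..multiplicity P g})"
      then obtain P k where "x = (P, k)" "P \<in> unit_irreducibles" "1 \<le> k" "k \<le> multiplicity P g" by auto
      thus "x \<in> {(P, k). P \<in> unit_irreducibles \<and> 1 \<le> k \<and> P ^ k dvd g}"
        using iff[of P k] by simp
    qed
  qed
  have "d = degree (\<Prod>P\<in>prime_factors g. P ^ multiplicity P g)"
    using prod_prime_factors[OF g0] ng dg by simp
  also have "\<dots> = (\<Sum>P\<in>prime_factors g. degree (P ^ multiplicity P g))"
    by (intro degree_prod_sum_eq) auto
  also have "\<dots> = (\<Sum>P\<in>prime_factors g. multiplicity P g * degree P)"
    by (intro sum.cong refl degree_power_eq) auto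
  also have "\<dots> = (\<Sum>P\<in>prime_factors g. \<Sum>k\<in>{1..multiplicity P g}. degree P)"
    by simp
  also have "\<dots> = (\<Sum>(P,k)\<in>Sigma (prime_factors g) (\<lambda>P. {1..multiplicity P g}). degree P)"
    by (rule sum.Sigma) auto
  finally show ?thesis unfolding eq by (rule sym)
qed

section \<open>L-series of completely multiplicative functions of monic polynomials\<close>

locale multiplicative_poly_fun =
  fixes L :: "'k::{field_gcd,finite} poly \<Rightarrow> complex"
  assumes L_1: "L 1 = 1"
    and L_mult: "coeff f 0 \<noteq> 0 \<Longrightarrow> coeff g 0 \<noteq> 0 \<Longrightarrow> L (f * g) = L f * L g"
begin

lemma L_power: "coeff f 0 \<noteq> 0 \<Longrightarrow> L (f ^ k) = L f ^ k"
  by (induction k) (simp_all add: L_1 L_mult coeff_0_power)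

text \<open>With Z(X) the L-series of \<open>L\<close>, \<open>C d\<close> is the coefficient of X ^
  d in Z, and \<open>S j\<close> below is the coefficient of X ^ j in X * Z' / Z, read off from the
  Euler product.\<close>

definition C :: "nat \<Rightarrow> complex" where "C d = (\<Sum>g\<in>unit_monics d. L g)"

definition T :: "nat \<Rightarrow> ('k poly \<times> nat) set" where
  "T j = {(P,k). P \<in> unit_irreducibles \<and> 1 \<le> k \<and> k * degree P = j}"

definition S :: "nat \<Rightarrow> complex" where "S j = (\<Sum>(P,k)\<in>T j. of_nat (degree P) * L P ^ k)"

definition D :: "nat \<Rightarrow> ('k poly \<times> nat) set" where
  "D d = {(P,k). P \<in> unit_irreducibles \<and> 1 \<le> k \<and> k * degree P \<le> d}"

lemma finite_D: "finite (D d)"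
proof (rule finite_subset)
  show "D d \<subseteq> {P. degree P \<le> d} \<times> {..d}"
  proof
    fix x assume "x \<in> D d"
    then obtain P k where x: "x = (P, k)" and P: "P \<in> unit_irreducibles" and k: "1 \<le> k" "k * degree P \<le> d"
      by (auto simp: D_def)
    have "degree P \<le> k * degree P" "k \<le> k * degree P"
      using k unit_irreducibles_degree[OF P] by auto
    with k have "degree P \<le> d" "k \<le> d" by linarith+
    thus "x \<in> {P. degree P \<le> d} \<times> {..d}" by (simp add: x)
  qed
qed (simp add: finite_degree_le)

lemma C_0: "C 0 = 1"
  by (simp add: C_def unit_monics_0 L_1)

lemma sum_multiples:
  assumes P: "P \<in> unit_irreducibles" and k: "k * degree P \<le> d"
  shows "(\<Sum>g\<in>{g\<in>unit_monics d. P ^ k dvd g}. L g) = L P ^ k * C (d - k * degree P)"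
proof -
  have lP: "lead_coeff P = 1" "coeff P 0 \<noteq> 0" "P \<noteq> 0" using P by (auto simp: unit_irreducibles_def)
  have eq: "{g\<in>unit_monics d. P ^ k dvd g} = (\<lambda>h. P ^ k * h) ` unit_monics (d - k * degree P)"
  proof (intro equalityI subsetI)
    fix g assume "g \<in> {g\<in>unit_monics d. P ^ k dvd g}"
    then obtain h where g: "g \<in> unit_monics d" "g = P ^ k * h" by auto
    have "lead_coeff g = lead_coeff h"
      unfolding g(2) lead_coeff_mult lead_coeff_power by (simp add: lP)
    moreover have "coeff g 0 = coeff P 0 ^ k * coeff h 0"
      by (simp add: g(2) coeff_mult coeff_0_power)
    ultimately have "lead_coeff h = 1" "coeff h 0 \<noteq> 0" using g(1)
      by (auto simp: unit_monics_def)
    from this(1) have "h \<noteq> 0" by auto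
    hence "degree g = k * degree P + degree h"
      using lP by (simp add: g(2) degree_mult_eq degree_power_eq)
    moreover have "degree g = d" using g by (simp add: unit_monics_def)
    ultimately have "degree h = d - k * degree P" by simp
    with \<open>lead_coeff h = 1\<close> \<open>coeff h 0 \<noteq> 0\<close>
    have "h \<in> unit_monics (d - k * degree P)" by (simp add: unit_monics_def)
    thus "g \<in> (\<lambda>h. P ^ k * h) ` unit_monics (d - k * degree P)" using g by auto
  next
    fix g assume "g \<in> (\<lambda>h. P ^ k * h) ` unit_monics (d - k * degree P)"
    then obtain h where h: "h \<in> unit_monics (d - k * degree P)" "g = P ^ k * h" by auto
    hence "h \<noteq> 0" by (auto simp: unit_monics_def)
    hence "degree g = k * degree P + degree h"
      using lP by (simp add: h(2) degree_mult_eq degree_power_eq)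
    moreover have "lead_coeff g = lead_coeff h"
      unfolding h(2) lead_coeff_mult lead_coeff_power by (simp add: lP)
    moreover have "coeff g 0 = coeff P 0 ^ k * coeff h 0"
      by (simp add: h(2) coeff_mult coeff_0_power)
    ultimately show "g \<in> {g\<in>unit_monics d. P ^ k dvd g}"
      using h lP k by (auto simp: unit_monics_def)
  qed
  have "(\<Sum>g\<in>{g\<in>unit_monics d. P ^ k dvd g}. L g) = (\<Sum>h\<in>unit_monics (d - k * degree P). L (P ^ k * h))"
    unfolding eq by (subst sum.reindex) (use lP in \<open>auto simp: inj_on_def\<close>)
  also have "\<dots> = (\<Sum>h\<in>unit_monics (d - k * degree P). L P ^ k * L h)"
    by (intro sum.cong refl) (use lP in \<open>auto simp: L_mult L_power coeff_0_power unit_monics_def\<close>)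
  finally show ?thesis by (simp add: C_def sum_distrib_left)
qed

text \<open>Coefficientwise this is X * Z' = Z * (X * Z' / Z). It is proved without series:
  \<open>d\<close> is the weighted number of prime powers dividing \<open>g\<close>, the sums are
  exchanged, and \<open>P ^ k\<close> is cancelled from its multiples.\<close>

theorem newton_identity: "of_nat d * C d = (\<Sum>j\<in>{1..d}. S j * C (d - j))"
proof -
  have "of_nat d * C d = (\<Sum>g\<in>unit_monics d. \<Sum>(P,k)\<in>{x\<in>D d. fst x ^ snd x dvd g}. of_nat (degree P) * L g)"
    unfolding C_def sum_distrib_left
  proof (rule sum.cong)
    fix g :: "'k poly" assume g: "g \<in> unit_monics d"
    have g0: "g \<noteq> 0" "degree g = d" using g by (auto simp: unit_monics_def)
    have "{x\<in>D d. fst x ^ snd x dvd g} = {(P,k). P \<in> unit_irreducibles \<and> 1 \<le> k \<and> P ^ k dvd g}"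
    proof -
      have "k * degree P \<le> d" if "P ^ k dvd g" "P \<in> unit_irreducibles" for P k
      proof -
        have "P \<noteq> 0" using that by (auto simp: unit_irreducibles_def)
        thus ?thesis using dvd_imp_degree_le[OF that(1) g0(1)] g0 by (simp add: degree_power_eq)
      qed
      thus ?thesis by (auto simp: D_def)
    qed
    hence "(\<Sum>(P,k)\<in>{x\<in>D d. fst x ^ snd x dvd g}. degree P) = d"
      using degree_eq_sum_prime_powers[OF g] by simp
    hence "of_nat d * L g = of_nat (\<Sum>(P,k)\<in>{x\<in>D d. fst x ^ snd x dvd g}. degree P) * L g" by simp
    thus "of_nat d * L g = (\<Sum>(P,k)\<in>{x\<in>D d. fst x ^ snd x dvd g}. of_nat (degree P) * L g)"
      by (simp add: sum_distrib_right case_prod_unfold)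
  qed simp
  also have "\<dots> = (\<Sum>x\<in>D d. \<Sum>g\<in>{g\<in>unit_monics d. fst x ^ snd x dvd g}. of_nat (degree (fst x)) * L g)"
    using sum.swap_restrict[OF finite_unit_monics finite_D,
        of "\<lambda>g x. of_nat (degree (fst x)) * L g" d "\<lambda>g x. fst x ^ snd x dvd g" d]
    by (simp add: case_prod_unfold)
  also have "\<dots> = (\<Sum>x\<in>D d. of_nat (degree (fst x)) * L (fst x) ^ snd x * C (d - snd x * degree (fst x)))"
  proof (rule sum.cong)
    fix x assume "x \<in> D d"
    hence "fst x \<in> unit_irreducibles" "snd x * degree (fst x) \<le> d" by (auto simp: D_def)
    from sum_multiples[OF this]
    show "(\<Sum>g\<in>{g\<in>unit_monics d. fst x ^ snd x dvd g}. of_nat (degree (fst x)) * L g)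
        = of_nat (degree (fst x)) * L (fst x) ^ snd x * C (d - snd x * degree (fst x))"
      by (simp flip: sum_distrib_left)
  qed simp
  also have "\<dots> = (\<Sum>j\<in>{1..d}. \<Sum>x\<in>{x\<in>D d. snd x * degree (fst x) = j}.
      of_nat (degree (fst x)) * L (fst x) ^ snd x * C (d - snd x * degree (fst x)))"
  proof (rule sum.group[symmetric])
    show "(\<lambda>x. snd x * degree (fst x)) ` D d \<subseteq> {1..d}"
      using unit_irreducibles_degree by (force simp: D_def)
  qed (auto intro: finite_D)
  also have "\<dots> = (\<Sum>j\<in>{1..d}. S j * C (d - j))"
  proof (rule sum.cong)
    fix j assume "j \<in> {1..d}"
    hence "{x\<in>D d. snd x * degree (fst x) = j} = T j" by (auto simp: D_def T_def)
    thus "(\<Sum>x\<in>{x\<in>D d. snd x * degree (fst x) = j}.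
      of_nat (degree (fst x)) * L (fst x) ^ snd x * C (d - snd x * degree (fst x))) = S j * C (d - j)"
      unfolding S_def sum_distrib_right
      by (intro sum.cong) (auto simp: T_def)
  qed simp
  finally show ?thesis .
qed

text \<open>Primality of \<open>r\<close> leaves two kinds of prime powers. Later they match the
  elements of the small field and the remaining elements of its extension of degree
  \<open>r\<close>.\<close>

lemma T_prime:
  assumes "prime r"
  shows "T r = (\<lambda>P. (P, r)) ` unit_monics 1 \<union> (\<lambda>P. (P, 1)) ` (unit_irreducibles \<inter> unit_monics r)"
proof -
  have u1: "P \<in> unit_irreducibles" if "P \<in> unit_monics 1" for P :: "'k poly"
    using that unfolding unit_monics_1
    by (auto simp: unit_irreducibles_def intro!: irreducible_linear_field_poly)
  show ?thesis
  proof (intro equalityI subsetI)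
    fix x assume "x \<in> T r"
    then obtain P k where x: "x = (P,k)" "P \<in> unit_irreducibles" "k * degree P = r" by (auto simp: T_def)
    hence "k dvd r" by auto
    hence "k = 1 \<or> k = r" using assms by (metis prime_nat_iff)
    thus "x \<in> (\<lambda>P. (P, r)) ` unit_monics 1 \<union> (\<lambda>P. (P, 1)) ` (unit_irreducibles \<inter> unit_monics r)"
      using x assms by (auto simp: unit_irreducibles_def unit_monics_def)
  next
    fix x :: "'k poly \<times> nat"
    assume "x \<in> (\<lambda>P. (P, r)) ` unit_monics 1 \<union> (\<lambda>P. (P, 1)) ` (unit_irreducibles \<inter> unit_monics r)"
    thus "x \<in> T r" using assms u1 by (auto simp: T_def unit_monics_def Suc_le_eq prime_gt_0_nat)
  qed
qed

lemma S_prime: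
  assumes "prime r"
  shows "S r = (\<Sum>P\<in>unit_monics 1. L P ^ r) + of_nat r * (\<Sum>P\<in>unit_irreducibles \<inter> unit_monics r. L P)"
proof -
  have r1: "r \<noteq> 1" using assms by auto
  have "S r = (\<Sum>(P,k)\<in>(\<lambda>P. (P, r)) ` unit_monics 1. of_nat (degree P) * L P ^ k)
            + (\<Sum>(P,k)\<in>(\<lambda>P. (P, 1)) ` (unit_irreducibles \<inter> unit_monics r). of_nat (degree P) * L P ^ k)"
    unfolding S_def T_prime[OF assms] by (rule sum.union_disjoint) (use r1 in auto)
  also have "(\<Sum>(P,k)\<in>(\<lambda>P. (P, r)) ` unit_monics 1. of_nat (degree P) * L P ^ k) = (\<Sum>P\<in>unit_monics 1. L P ^ r)"
    by (subst sum.reindex) (auto simp: inj_on_def unit_monics_def intro!: sum.cong)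
  also have "(\<Sum>(P,k)\<in>(\<lambda>P. (P, 1)) ` (unit_irreducibles \<inter> unit_monics r). of_nat (degree P) * L P ^ k)
      = of_nat r * (\<Sum>P\<in>unit_irreducibles \<inter> unit_monics r. L P)"
    by (subst sum.reindex) (auto simp: inj_on_def unit_monics_def sum_distrib_left intro!: sum.cong)
  finally show ?thesis .
qed

end

lemma card_monics: "card {g :: 'k::{field,finite} poly. lead_coeff g = 1 \<and> degree g = d} = card (UNIV :: 'k set) ^ d"
proof (induction d)
  case 0
  have "{g :: 'k poly. lead_coeff g = 1 \<and> degree g = 0} = {1}"
    by (auto simp: one_pCons elim!: degree_eq_zeroE)
  thus ?case by simp
next
  case (Suc d)
  have "{g :: 'k poly. lead_coeff g = 1 \<and> degree g = Suc d}
      = case_prod pCons ` (UNIV \<times> {g. lead_coeff g = 1 \<and> degree g = d})"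
  proof (intro equalityI subsetI)
    fix g :: "'k poly" assume g: "g \<in> {g. lead_coeff g = 1 \<and> degree g = Suc d}"
    obtain a h where gh: "g = pCons a h" by (cases g)
    with g have "h \<noteq> 0" by auto
    with g gh show "g \<in> case_prod pCons ` (UNIV \<times> {g. lead_coeff g = 1 \<and> degree g = d})"
      by (auto intro!: image_eqI[of _ _ "(a, h)"])
  next
    fix g :: "'k poly" assume "g \<in> case_prod pCons ` (UNIV \<times> {g. lead_coeff g = 1 \<and> degree g = d})"
    then obtain a h where "g = pCons a h" "lead_coeff h = 1" "degree h = d" by auto
    moreover from this have "h \<noteq> 0" by auto
    ultimately show "g \<in> {g. lead_coeff g = 1 \<and> degree g = Suc d}" by auto
  qed
  hence "card {g :: 'k poly. lead_coeff g = 1 \<and> degree g = Suc d}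
      = card (UNIV \<times> {g :: 'k poly. lead_coeff g = 1 \<and> degree g = d} :: ('k \<times> 'k poly) set)"
    by (simp add: card_image inj_on_def)
  thus ?case using Suc by (simp add: card_cartesian_product)
qed

lemma card_unit_monics:
  "card (unit_monics (Suc d) :: 'k::{field,finite} poly set) = (card (UNIV :: 'k set) - 1) * card (UNIV :: 'k set) ^ d"
proof -
  have "(unit_monics (Suc d) :: 'k poly set)
      = case_prod pCons ` ((UNIV - {0}) \<times> {g. lead_coeff g = 1 \<and> degree g = d})"
  proof (intro equalityI subsetI)
    fix g :: "'k poly" assume g: "g \<in> unit_monics (Suc d)"
    obtain a h where gh: "g = pCons a h" by (cases g)
    with g have "h \<noteq> 0" "a \<noteq> 0" by (auto simp: unit_monics_def)
    with g gh show "g \<in> case_prod pCons ` ((UNIV - {0}) \<times> {g. lead_coeff g = 1 \<and> degree g = d})"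
      by (auto simp: unit_monics_def intro!: image_eqI[of _ _ "(a, h)"])
  next
    fix g :: "'k poly" assume "g \<in> case_prod pCons ` ((UNIV - {0}) \<times> {g. lead_coeff g = 1 \<and> degree g = d})"
    then obtain a h where "g = pCons a h" "a \<noteq> 0" "lead_coeff h = 1" "degree h = d" by auto
    moreover from this have "h \<noteq> 0" by auto
    ultimately show "g \<in> unit_monics (Suc d)" by (auto simp: unit_monics_def)
  qed
  hence "card (unit_monics (Suc d) :: 'k poly set)
      = card ((UNIV - {0}) \<times> {g :: 'k poly. lead_coeff g = 1 \<and> degree g = d} :: ('k \<times> 'k poly) set)"
    by (simp add: card_image inj_on_def)
  thus ?thesis using card_monics[of d, where ?'k = 'k] by (simp add: card_cartesian_product card_Diff_singleton)
qed

text \<open>For \<open>L = 1\<close> the L-series is (1 - X) / (1 - Q * X). The prime case is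
  applied in order to count irreducible polynomials.\<close>

lemma S_trivial:
  fixes d :: nat
  assumes "d \<ge> 1"
  defines "Q \<equiv> of_nat (card (UNIV :: 'k::{field_gcd,finite} set)) :: complex"
  shows "multiplicative_poly_fun.S (\<lambda>_ :: 'k poly. 1) d = Q ^ d - 1"
proof -
  interpret multiplicative_poly_fun "\<lambda>_ :: 'k poly. 1" by standard auto
  have C: "C (Suc e) = (Q - 1) * Q ^ e" for e
    using card_unit_monics[of e, where ?'k = 'k]
    by (simp add: C_def Q_def of_nat_diff Suc_le_eq card_gt_0_iff)
  show ?thesis using assms(1)
  proof (induction d rule: less_induct)
    case (less d)
    then obtain e where d: "d = Suc e" by (cases d) auto
    have tele: "(\<Sum>j\<in>{1..n}. (Q ^ j - 1) * ((Q - 1) * Q ^ (n - j))) = of_nat n * (Q - 1) * Q ^ n - (Q ^ n - 1)" for n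
    proof (induction n)
      case (Suc n)
      have "(\<Sum>j\<in>{1..Suc n}. (Q ^ j - 1) * ((Q - 1) * Q ^ (Suc n - j)))
          = (\<Sum>j\<in>{1..n}. Q * ((Q ^ j - 1) * ((Q - 1) * Q ^ (n - j)))) + (Q ^ Suc n - 1) * (Q - 1)"
        by (simp add: Suc_diff_le mult_ac)
      also have "\<dots> = Q * (of_nat n * (Q - 1) * Q ^ n - (Q ^ n - 1)) + (Q ^ Suc n - 1) * (Q - 1)"
        by (simp only: Suc.IH flip: sum_distrib_left)
      finally show ?case by (simp add: algebra_simps)
    qed simp
    have "of_nat d * C d = (\<Sum>j\<in>{1..e}. S j * C (d - j)) + S d * C 0"
      unfolding newton_identity d by simp
    also have "(\<Sum>j\<in>{1..e}. S j * C (d - j)) = (\<Sum>j\<in>{1..e}. (Q ^ j - 1) * ((Q - 1) * Q ^ (e - j)))"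
      by (intro sum.cong) (auto simp: less.IH d Suc_diff_le C)
    finally show ?case
      unfolding tele by (simp add: d C C_0 algebra_simps)
  qed
qed

lemma sum_additive_char:
  fixes \<psi> :: "'k::{field,finite} \<Rightarrow> complex"
  assumes add: "\<And>x y. \<psi> (x + y) = \<psi> x * \<psi> y" and nontriv: "\<psi> s \<noteq> 1" and c: "c \<noteq> 0"
  shows "(\<Sum>x\<in>UNIV. \<psi> (c * x)) = 0"
proof -
  have "(\<Sum>x\<in>UNIV. \<psi> (c * x)) = (\<Sum>x\<in>UNIV. \<psi> x)"
    by (rule sum.reindex_bij_witness[of _ "\<lambda>x. x / c" "\<lambda>x. c * x"]) (use c in auto)
  moreover have "(\<Sum>x\<in>UNIV. \<psi> x) = (\<Sum>x\<in>UNIV. \<psi> (s + x))"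
    by (rule sum.reindex_bij_witness[of _ "\<lambda>x. s + x" "\<lambda>x. x - s"]) auto
  hence "(\<Sum>x\<in>UNIV. \<psi> x) * (1 - \<psi> s) = 0"
    by (simp add: add right_diff_distrib mult.commute[of "\<psi> s"] flip: sum_distrib_right)
  ultimately show ?thesis using nontriv by simp
qed

section \<open>The L-polynomial of a Kloosterman sum\<close>

locale kloosterman_char =
  fixes \<psi> :: "'k::{field_gcd,finite} \<Rightarrow> complex" and A :: 'k
  assumes psi_0: "\<psi> 0 = 1" and psi_add: "\<psi> (x + y) = \<psi> x * \<psi> y"
    and psi_nontriv: "\<exists>s. \<psi> s \<noteq> 1" and A_nz: "A \<noteq> 0"
begin

text \<open>For monic \<open>g\<close> this is \<open>\<psi>\<close> of the sum of
  \<open>x + A / x\<close> over the roots \<open>x\<close> of \<open>g\<close>, expressed through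
  coefficients so that no splitting field is needed.\<close>

definition lam :: "'k poly \<Rightarrow> complex" where
  "lam g = \<psi> (- log_deriv_0 (reflect_poly g) - A * log_deriv_0 g)"

sublocale multiplicative_poly_fun lam
proof
  show "lam 1 = 1" by (simp add: lam_def psi_0)
  fix f g :: "'k poly" assume fg: "coeff f 0 \<noteq> 0" "coeff g 0 \<noteq> 0"
  hence "f \<noteq> 0" "g \<noteq> 0" by auto
  with fg have "log_deriv_0 (reflect_poly (f * g)) = log_deriv_0 (reflect_poly f) + log_deriv_0 (reflect_poly g)"
    by (simp add: reflect_poly_mult log_deriv_0_mult)
  moreover have "log_deriv_0 (f * g) = log_deriv_0 f + log_deriv_0 g"
    using fg by (rule log_deriv_0_mult)
  ultimately show "lam (f * g) = lam f * lam g"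
    by (simp add: lam_def algebra_simps flip: psi_add)
qed

lemma lam_linear: "x \<noteq> 0 \<Longrightarrow> lam [:- x, 1:] = \<psi> (x + A / x)"
  by (simp add: lam_def log_deriv_0_def reflect_poly_pCons coeff_reflect_poly)

lemma C_1: "C 1 = (\<Sum>x\<in>UNIV - {0}. \<psi> (x + A / x))"
  unfolding C_def unit_monics_1 by (subst sum.reindex) (auto simp: inj_on_def lam_linear)

text \<open>On \<open>[:a, b, 1:]\<close> the value of \<open>lam\<close> is an additive character
  in \<open>b\<close> with multiplier \<open>- (1 + A / a)\<close>, so only \<open>a = - A\<close>
  survives the sum over \<open>b\<close>.\<close>

lemma C_2: "C 2 = of_nat (card (UNIV :: 'k set))"
proof -
  obtain s where s: "\<psi> s \<noteq> 1" using psi_nontriv by blast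
  have eq: "unit_monics 2 = (\<lambda>(a, b). [:a, b, 1:]) ` ((UNIV - {0 :: 'k}) \<times> UNIV)"
  proof (intro equalityI subsetI)
    fix g :: "'k poly" assume g: "g \<in> unit_monics 2"
    obtain a h where gh: "g = pCons a h" by (cases g)
    obtain b k where hk: "h = pCons b k" by (cases h)
    have "degree k = 0" using g by (auto simp: unit_monics_def gh hk split: if_splits)
    then obtain c where "k = [:c:]" by (auto elim: degree_eq_zeroE)
    with g show "g \<in> (\<lambda>(a, b). [:a, b, 1:]) ` ((UNIV - {0 :: 'k}) \<times> UNIV)"
      by (auto simp: unit_monics_def gh hk split: if_splits)
  qed (auto simp: unit_monics_def)
  have lam2: "lam [:a, b, 1:] = \<psi> ((- (1 + A / a)) * b)" for a b
    by (simp add: lam_def log_deriv_0_def coeff_reflect_poly algebra_simps)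
  have "C 2 = (\<Sum>(a,b)\<in>(UNIV - {0}) \<times> UNIV. lam [:a, b, 1:])"
    unfolding C_def eq by (subst sum.reindex) (auto simp: inj_on_def case_prod_unfold)
  also have "\<dots> = (\<Sum>a\<in>UNIV - {0}. \<Sum>b\<in>UNIV. \<psi> ((- (1 + A / a)) * b))"
    by (simp add: lam2 sum.cartesian_product)
  also have "\<dots> = (\<Sum>a\<in>UNIV - {0}. if a = - A then of_nat (card (UNIV :: 'k set)) else 0)"
  proof (rule sum.cong)
    fix a :: 'k assume a: "a \<in> UNIV - {0}"
    show "(\<Sum>b\<in>UNIV. \<psi> ((- (1 + A / a)) * b)) = (if a = - A then of_nat (card (UNIV :: 'k set)) else 0)"
    proof (cases "a = - A")
      case True
      thus ?thesis using a by (simp add: psi_0)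
    next
      case False
      hence "- (1 + A / a) \<noteq> 0" using a by (auto simp: field_simps add_eq_0_iff)
      thus ?thesis using sum_additive_char[OF psi_add s] False by simp
    qed
  qed simp
  also have "\<dots> = of_nat (card (UNIV :: 'k set))"
    using A_nz by (subst sum.delta) auto
  finally show ?thesis .
qed

text \<open>For \<open>d \<ge> 3\<close> the coefficient at \<open>d - 1\<close> is not one of the
  two lowest, so shifting it by \<open>s\<close> multiplies \<open>lam\<close> by the constant
  \<open>\<psi> (- s)\<close>. With \<open>C_2\<close> the L-series becomes a quadratic
  polynomial.\<close>

lemma C_ge_3: assumes "d \<ge> 3" shows "C d = 0"
proof -
  obtain s where s: "\<psi> s \<noteq> 1" using psi_nontriv by blast
  define sh where "sh t g = g + monom t (d - 1)" for t and g :: "'k poly"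
  have deg: "degree (sh t g) = d \<and> lead_coeff (sh t g) = 1 \<and> sh t g \<in> unit_monics d"
    if "g \<in> unit_monics d" for t g
  proof -
    have "degree (monom t (d - 1)) < degree g"
      using that assms degree_monom_le[of t "d - 1"] by (auto simp: unit_monics_def)
    hence "degree (sh t g) = degree g" unfolding sh_def by (rule degree_add_eq_left)
    moreover from this have "lead_coeff (sh t g) = lead_coeff g"
      using that assms by (auto simp: sh_def unit_monics_def)
    ultimately show ?thesis
      using that assms by (auto simp: unit_monics_def sh_def)
  qed
  have lsh: "lam (sh s g) = \<psi> (- s) * lam g" if g: "g \<in> unit_monics d" for g
  proof -
    have "log_deriv_0 (reflect_poly (sh s g)) = log_deriv_0 (reflect_poly g) + s"
    proof -
      have e: "degree (sh s g) = d" "degree g = d" "lead_coeff (sh s g) = 1" "lead_coeff g = 1"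
        using deg[OF g, of s] g by (auto simp: unit_monics_def)
      have "coeff (sh s g) (d - 1) = coeff g (d - 1) + s" by (simp add: sh_def)
      thus ?thesis using assms e unfolding log_deriv_0_def coeff_reflect_poly e by simp
    qed
    moreover have "log_deriv_0 (sh s g) = log_deriv_0 g"
      using assms by (simp add: log_deriv_0_def sh_def)
    ultimately show ?thesis by (simp add: lam_def algebra_simps flip: psi_add)
  qed
  have sh_inv: "sh (- t) (sh t g) = g" "sh t (sh (- t) g) = g" for t g
    by (simp_all add: sh_def add.assoc add_monom)
  have "C d = (\<Sum>g\<in>unit_monics d. lam (sh s g))"
    unfolding C_def
    by (rule sum.reindex_bij_witness[of _ "sh s" "sh (- s)"]) (use deg sh_inv in auto)
  also have "\<dots> = \<psi> (- s) * C d" by (simp add: lsh C_def sum_distrib_left)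
  finally have "C d * (1 - \<psi> (- s)) = 0" by (simp add: algebra_simps)
  moreover have "\<psi> (- s) \<noteq> 1" using psi_add[of s "- s"] s psi_0 by auto
  ultimately show ?thesis by simp
qed

text \<open>The power sums of the reciprocal roots of \<open>1 + C 1 * X + C 2 * X ^ 2\<close>.
  Index 0 needs its own value, since X * Z' / Z has no constant term.\<close>

definition V :: "nat \<Rightarrow> complex" where "V j = (if j = 0 then 2 else - S j)"

lemma V_0: "V 0 = 2" and V_1: "V 1 = - (\<Sum>x\<in>UNIV - {0}. \<psi> (x + A / x))"
  using newton_identity[of 1] by (simp_all add: V_def C_0 C_1[simplified])

lemma V_rec: "V (n + 2) = V 1 * V (n + 1) - of_nat (card (UNIV :: 'k set)) * V n"
proof -
  have S1: "S 1 = C 1" using newton_identity[of 1] by (simp add: C_0)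
  show ?thesis
  proof (cases n)
    case 0
    have "{1..2} = {1, 2 :: nat}" by auto
    hence "2 * C 2 = S 1 * C 1 + S 2" using newton_identity[of 2] by (simp add: C_0)
    thus ?thesis using 0 S1 by (simp add: V_def C_2 numeral_2_eq_2[symmetric] algebra_simps)
  next
    case (Suc k)
    have "0 = (\<Sum>j\<in>{1..n + 2}. S j * C (n + 2 - j))"
      using newton_identity[of "n + 2"] C_ge_3[of "n + 2"] Suc by simp
    also have "\<dots> = (\<Sum>j\<in>{n, n + 1, n + 2}. S j * C (n + 2 - j))"
      by (rule sum.mono_neutral_right) (use Suc in \<open>auto intro!: C_ge_3\<close>)
    also have "\<dots> = S n * C 2 + S (n + 1) * C 1 + S (n + 2)"
      by (simp add: C_0)
    finally show ?thesis using Suc S1 by (simp add: V_def C_2 algebra_simps neg_eq_iff_add_eq_0)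
  qed
qed

end


section \<open>The lifting relation for an extension of prime degree\<close>

locale kloosterman_lift = kloosterman_char \<psi> A
  for \<psi> :: "'k::{field_gcd,finite} \<Rightarrow> complex" and A :: 'k +
  fixes \<iota> :: "'k \<Rightarrow> 'a::{field,finite}" and Q r :: nat
  assumes iota_add: "\<iota> (x + y) = \<iota> x + \<iota> y" and iota_mult: "\<iota> (x * y) = \<iota> x * \<iota> y"
    and iota_1: "\<iota> 1 = 1"
    and range_iota: "range \<iota> = {x. x ^ Q = x}"
    and card_k: "card (UNIV :: 'k set) = Q"
    and frob: "(u + v) ^ Q = u ^ Q + (v :: 'a) ^ Q"
    and prime_r: "prime r"
    and card_E: "card {x :: 'a. x ^ (Q ^ r) = x} = Q ^ r"
begin

abbreviation I :: "'k poly set" where "I \<equiv> unit_irreducibles \<inter> unit_monics r"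

definition E :: "'a set" where "E = {x. x ^ (Q ^ r) = x}"

lemma iota_0 [simp]: "\<iota> 0 = 0"
  using iota_add[of 0 0] by (metis add.right_neutral add_left_cancel)

lemma iota_uminus: "\<iota> (- x) = - \<iota> x"
  using iota_add[of x "- x"] by (simp add: eq_neg_iff_add_eq_0 add.commute)

lemma iota_eq_0_iff [simp]: "\<iota> x = 0 \<longleftrightarrow> x = 0"
proof
  assume "\<iota> x = 0"
  thus "x = 0" using iota_mult[of x "inverse x"] iota_1 by (cases "x = 0") auto
qed simp

lemma inj_iota: "inj \<iota>"
proof (rule injI)
  fix x y assume "\<iota> x = \<iota> y"
  hence "\<iota> (x + - y) = 0" unfolding iota_add iota_uminus by simp
  thus "x = y" by simp
qed

lemma iota_inverse: "\<iota> (inverse x) = inverse (\<iota> x)"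
proof (cases "x = 0")
  case False
  hence "\<iota> x * \<iota> (inverse x) = 1" by (simp add: iota_1 flip: iota_mult)
  thus ?thesis by (simp add: inverse_unique)
qed simp

lemma iota_divide: "\<iota> (x / y) = \<iota> x / \<iota> y"
  by (simp add: divide_inverse iota_mult iota_inverse)

lemma inv_iota [simp]: "inv \<iota> (\<iota> x) = x"
  by (rule inv_f_f[OF inj_iota])

lemma iota_inv: "x ^ Q = x \<Longrightarrow> \<iota> (inv \<iota> x) = x"
  by (rule f_inv_into_f) (simp add: range_iota)

lemma iota_pow_Q: "\<iota> x ^ Q = \<iota> x"
proof -
  have "\<iota> x \<in> {x. x ^ Q = x}" unfolding range_iota[symmetric] by simp
  thus ?thesis by simp
qed

lemma Q_pos: "Q > 0" unfolding card_k[symmetric] by (rule finite_UNIV_card_ge_0[OF finite])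

lemma pow_Q_0: "(0 :: 'a) ^ Q = 0" using Q_pos by simp

lemma frob_uminus: "(- u) ^ Q = - (u ^ Q :: 'a)"
  using frob[of u "- u"] pow_Q_0 by (simp add: eq_neg_iff_add_eq_0 add.commute)

lemma frob_sum: "(sum f J) ^ Q = (\<Sum>x\<in>J. (f x :: 'a) ^ Q)"
  by (induction J rule: infinite_finite_induct) (auto simp: frob pow_Q_0)

lemma pow_Q_pow: "((x :: 'a) ^ (Q ^ i)) ^ (Q ^ j) = x ^ (Q ^ (i + j))"
  by (simp add: power_add flip: power_mult)

lemma iota_pow_Q_pow: "\<iota> x ^ (Q ^ i) = \<iota> x"
  by (induction i) (simp_all add: iota_pow_Q power_mult mult.commute[of Q])

lemma map_iota_mult: "map_poly \<iota> (f * g) = map_poly \<iota> f * map_poly \<iota> g"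
  by (rule map_poly_mult_hom) (auto simp: iota_add iota_mult)

lemma degree_map_iota [simp]: "degree (map_poly \<iota> f) = degree f"
  by (rule degree_map_poly) auto

lemma coeff_map_iota [simp]: "coeff (map_poly \<iota> f) i = \<iota> (coeff f i)"
  by (rule coeff_map_poly) simp

definition conjugate_poly :: "'a \<Rightarrow> 'a poly" where
  "conjugate_poly x = (\<Prod>i<r. [:- (x ^ (Q ^ i)), 1:])"

text \<open>For \<open>x\<close> in \<open>E\<close> this is the characteristic polynomial over the
  small field. It is the minimal polynomial when \<open>x\<close> is outside
  \<open>range \<iota>\<close>, and the \<open>r\<close>-th power of a linear polynomial
  otherwise.\<close>

definition min_poly :: "'a \<Rightarrow> 'k poly" where
  "min_poly x = map_poly (inv \<iota>) (conjugate_poly x)"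

lemma prod_shift_conjugates:
  assumes "x \<in> E"
  shows "(\<Prod>i<r. F (x ^ (Q ^ Suc i))) = (\<Prod>i<r. F (x ^ (Q ^ i)) :: 'b :: comm_monoid_mult)"
proof -
  obtain s where s: "r = Suc s" using prime_r by (metis not0_implies_Suc not_prime_0)
  have "(\<Prod>i<r. F (x ^ (Q ^ Suc i))) = (\<Prod>i<s. F (x ^ (Q ^ Suc i))) * F (x ^ (Q ^ r))"
    unfolding s by simp
  also have "x ^ (Q ^ r) = x ^ (Q ^ 0)" using assms by (simp add: E_def)
  finally show ?thesis unfolding s prod.lessThan_Suc_shift by (simp add: mult.commute)
qed

text \<open>The Frobenius permutes the factors of \<open>conjugate_poly x\<close> cyclically and so
  fixes its coefficients; hence these lie in \<open>range \<iota>\<close>, where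
  \<open>inv \<iota>\<close> is a genuine inverse.\<close>

lemma map_iota_min_poly:
  assumes x: "x \<in> E" shows "map_poly \<iota> (min_poly x) = conjugate_poly x"
proof -
  have p: "map_poly (\<lambda>c. c ^ Q) (prod f J) = (\<Prod>i\<in>J. map_poly (\<lambda>c. c ^ Q) (f i :: 'a poly))" for f and J :: "nat set"
  proof (induction J rule: infinite_finite_induct)
    case (insert x J)
    have "map_poly (\<lambda>c. c ^ Q) (f x * prod f J) = map_poly (\<lambda>c. c ^ Q) (f x) * map_poly (\<lambda>c. c ^ Q) (prod f J)"
      by (rule map_poly_mult_hom) (auto simp: frob pow_Q_0 power_mult_distrib)
    with insert show ?case by simp
  qed auto
  have "map_poly (\<lambda>c. c ^ Q) (conjugate_poly x) = (\<Prod>i<r. [:- (x ^ (Q ^ Suc i)), 1:])"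
    unfolding conjugate_poly_def p
    by (intro prod.cong refl)
       (simp add: map_poly_pCons pow_Q_0 frob_uminus mult.commute[of Q] flip: power_mult)
  also have "\<dots> = conjugate_poly x"
    unfolding conjugate_poly_def using prod_shift_conjugates[OF x, of "\<lambda>c. [:- c, 1:]"] .
  finally have "coeff (map_poly (\<lambda>c. c ^ Q) (conjugate_poly x)) i = coeff (conjugate_poly x) i" for i
    by simp
  hence "coeff (conjugate_poly x) i ^ Q = coeff (conjugate_poly x) i" for i
    by (simp add: coeff_map_poly pow_Q_0)
  hence "\<iota> (inv \<iota> (coeff (conjugate_poly x) i)) = coeff (conjugate_poly x) i" for i
    by (rule iota_inv)
  moreover have "inv \<iota> 0 = 0" by (metis inv_iota iota_0)
  ultimately show ?thesis
    by (intro poly_eqI) (simp add: min_poly_def coeff_map_poly)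
qed

lemma degree_conjugate_poly: "degree (conjugate_poly x) = r"
  unfolding conjugate_poly_def by (subst degree_prod_sum_eq) auto

lemma lead_coeff_conjugate_poly: "lead_coeff (conjugate_poly x) = 1"
  unfolding conjugate_poly_def lead_coeff_prod by simp

lemma coeff_0_conjugate_poly: "x \<noteq> 0 \<Longrightarrow> coeff (conjugate_poly x) 0 \<noteq> 0"
  by (simp add: conjugate_poly_def poly_prod flip: poly_0_coeff_0)

lemma min_poly_unit_monics:
  assumes "x \<in> E" "x \<noteq> 0" shows "min_poly x \<in> unit_monics r"
proof -
  have d: "degree (min_poly x) = r"
    using degree_conjugate_poly[of x] map_iota_min_poly[OF assms(1)] by (metis degree_map_iota)
  have "\<iota> (lead_coeff (min_poly x)) = 1"
    using lead_coeff_conjugate_poly[of x] map_iota_min_poly[OF assms(1)]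
    by (metis degree_map_iota coeff_map_iota)
  hence "lead_coeff (min_poly x) = 1" by (metis inv_iota iota_1)
  moreover have "\<iota> (coeff (min_poly x) 0) \<noteq> 0"
    using coeff_0_conjugate_poly[OF assms(2)] map_iota_min_poly[OF assms(1)] by (metis coeff_map_iota)
  ultimately show ?thesis using d by (auto simp: unit_monics_def)
qed

definition ext_char :: "'a \<Rightarrow> complex" where
  "ext_char y = \<psi> (inv \<iota> (\<Sum>i<r. y ^ (Q ^ i)))"

lemma lam_min_poly:
  assumes x: "x \<in> E" "x \<noteq> 0"
  shows "lam (min_poly x) = ext_char (x + \<iota> A / x)"
proof -
  have ld: "\<iota> (log_deriv_0 g) = log_deriv_0 (map_poly \<iota> g)" for g
    by (simp add: log_deriv_0_def iota_divide)
  have rf: "map_poly \<iota> (reflect_poly g) = reflect_poly (map_poly \<iota> g)" for g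
    by (intro poly_eqI) (simp add: coeff_reflect_poly)
  have "\<iota> (log_deriv_0 (min_poly x)) = (\<Sum>i<r. log_deriv_0 [:- (x ^ (Q ^ i)), 1:])"
    unfolding ld map_iota_min_poly[OF x(1)] conjugate_poly_def
    by (rule log_deriv_0_prod) (use x in simp)
  hence b: "\<iota> (log_deriv_0 (min_poly x)) = - (\<Sum>i<r. 1 / x ^ (Q ^ i))"
    by (simp add: log_deriv_0_def sum_negf)
  have "\<iota> (log_deriv_0 (reflect_poly (min_poly x))) = (\<Sum>i<r. log_deriv_0 (reflect_poly [:- (x ^ (Q ^ i)), 1:]))"
    unfolding ld rf map_iota_min_poly[OF x(1)] conjugate_poly_def reflect_poly_prod
    by (rule log_deriv_0_prod) simp
  hence t: "\<iota> (log_deriv_0 (reflect_poly (min_poly x))) = - (\<Sum>i<r. x ^ (Q ^ i))"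
    by (simp add: log_deriv_0_def coeff_reflect_poly sum_negf)
  have fr: "(u + v) ^ (Q ^ i) = u ^ (Q ^ i) + (v :: 'a) ^ (Q ^ i)" for u v i
    by (induction i) (simp_all add: power_mult mult.commute[of Q] frob)
  have "\<iota> (- log_deriv_0 (reflect_poly (min_poly x)) - A * log_deriv_0 (min_poly x))
      = (\<Sum>i<r. x ^ (Q ^ i)) + \<iota> A * (\<Sum>i<r. 1 / x ^ (Q ^ i))"
    using iota_add[of "- log_deriv_0 (reflect_poly (min_poly x))" "- (A * log_deriv_0 (min_poly x))"]
    by (simp add: iota_uminus iota_mult b t)
  also have "\<dots> = (\<Sum>i<r. (x + \<iota> A / x) ^ (Q ^ i))"
    by (simp add: fr power_divide iota_pow_Q_pow sum.distrib sum_distrib_left)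
  finally show ?thesis unfolding lam_def ext_char_def by (metis inv_iota)
qed

lemma lam_linear_power:
  assumes "y \<noteq> 0" shows "lam [:- y, 1:] ^ r = ext_char (\<iota> y + \<iota> A / \<iota> y)"
proof -
  have "(\<Sum>i<r. (\<iota> y + \<iota> A / \<iota> y) ^ (Q ^ i)) = \<iota> (of_nat r * (y + A / y))"
  proof -
    have "(\<iota> y + \<iota> A / \<iota> y) ^ (Q ^ i) = \<iota> (y + A / y)" for i
      by (metis iota_pow_Q_pow iota_add iota_divide)
    moreover have "\<iota> (of_nat n) = of_nat n" for n by (induction n) (simp_all add: iota_add iota_1)
    ultimately show ?thesis by (simp add: iota_mult)
  qed
  moreover have "\<psi> (of_nat n * x) = \<psi> x ^ n" for n x
    by (induction n) (simp_all add: psi_0 psi_add algebra_simps)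
  ultimately show ?thesis using assms by (simp add: ext_char_def lam_linear)
qed

text \<open>If two conjugates agree, some Frobenius power with positive exponent below
  \<open>r\<close> fixes \<open>x\<close>. That exponent is coprime to the prime \<open>r\<close>,
  and the \<open>r\<close>-th power fixes \<open>x\<close> too, so by Bezout the Frobenius itself
  does.\<close>

lemma conjugates_distinct:
  assumes x: "x \<in> E" "x \<notin> range \<iota>"
  shows "inj_on (\<lambda>i. x ^ (Q ^ i)) {..<r}"
proof -
  have per: "x ^ (Q ^ (n * a)) = x" if "x ^ (Q ^ a) = x" for a n
  proof (induction n)
    case (Suc n)
    have "x ^ (Q ^ (Suc n * a)) = (x ^ (Q ^ a)) ^ (Q ^ (n * a))" unfolding pow_Q_pow by simp
    thus ?case using Suc that by simp
  qed simp
  have xr: "x ^ (Q ^ r) = x" using x by (simp add: E_def)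
  have no: False if ij: "i < j" "j < r" "x ^ (Q ^ i) = x ^ (Q ^ j)" for i j
  proof -
    have "x = (x ^ (Q ^ i)) ^ (Q ^ (r - i))" unfolding pow_Q_pow using ij xr by simp
    also have "\<dots> = (x ^ (Q ^ r)) ^ (Q ^ (j - i))" unfolding ij(3) pow_Q_pow using ij by (simp add: add.commute)
    finally have s: "x ^ (Q ^ (j - i)) = x" using xr by simp
    have "coprime (j - i) r"
      using prime_r ij by (metis coprime_commute diff_less dual_order.strict_trans2 gr_implies_not0 leI
          less_imp_diff_less nat_dvd_not_less not_gr_zero prime_imp_coprime zero_less_diff)
    hence "gcd (j - i) r = 1" by simp
    then obtain u v where "u * (j - i) = v * r + 1"
      using bezout_nat[of "j - i" r] ij by (auto simp: mult.commute)
    hence "x ^ (Q ^ (v * r + 1)) = x" using per[OF s, of u] by simp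
    moreover have "x ^ (Q ^ (v * r + 1)) = (x ^ (Q ^ (v * r))) ^ (Q ^ 1)" by (simp only: pow_Q_pow)
    ultimately have "x ^ Q = x" using per[OF xr, of v] by simp
    thus False using x range_iota by blast
  qed
  show ?thesis
  proof (rule inj_onI)
    fix i j assume "i \<in> {..<r}" "j \<in> {..<r}" "x ^ (Q ^ i) = x ^ (Q ^ j)"
    thus "i = j" using no[of i j] no[of j i] by (cases i j rule: linorder_cases) auto
  qed
qed

lemma degree_ge_if_root:
  assumes x: "x \<in> E" "x \<notin> range \<iota>" and f: "f \<noteq> 0" "poly (map_poly \<iota> f) x = 0"
  shows "degree f \<ge> r"
proof -
  have root: "poly (map_poly \<iota> f) (y ^ Q) = (poly (map_poly \<iota> f) y) ^ Q" for y
    by (simp add: poly_altdef frob_sum power_mult_distrib iota_pow_Q flip: power_mult) (simp add: mult.commute)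
  have "poly (map_poly \<iota> f) (x ^ (Q ^ i)) = 0" for i
  proof (induction i)
    case (Suc i)
    have "x ^ (Q ^ Suc i) = (x ^ (Q ^ i)) ^ Q" by (simp add: mult.commute flip: power_mult)
    thus ?case using Suc root pow_Q_0 by simp
  qed (use f in simp)
  hence "(\<lambda>i. x ^ (Q ^ i)) ` {..<r} \<subseteq> {y. poly (map_poly \<iota> f) y = 0}" by auto
  hence "card ((\<lambda>i. x ^ (Q ^ i)) ` {..<r}) \<le> card {y. poly (map_poly \<iota> f) y = 0}"
    by (intro card_mono) auto
  also have "card ((\<lambda>i. x ^ (Q ^ i)) ` {..<r}) = r"
    using conjugates_distinct[OF x] by (simp add: card_image)
  also have "map_poly \<iota> f \<noteq> 0" using f(1) by (metis degree_map_iota coeff_map_iota iota_eq_0_iff leading_coeff_0_iff)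
  hence "card {y. poly (map_poly \<iota> f) y = 0} \<le> degree (map_poly \<iota> f)" by (rule card_poly_roots_bound)
  finally show ?thesis by simp
qed

lemma poly_conjugate_poly: "poly (conjugate_poly x) x = 0"
proof -
  have "\<exists>i\<in>{..<r}. poly [:- (x ^ (Q ^ i)), 1:] x = 0"
    using prime_r by (intro bexI[of _ 0]) (auto simp: prime_gt_0_nat)
  thus ?thesis by (auto simp: conjugate_poly_def poly_prod)
qed

lemma irreducible_min_poly:
  assumes x: "x \<in> E" "x \<notin> range \<iota>"
  shows "min_poly x \<in> I"
proof -
  have x0: "x \<noteq> 0" using x iota_0 by (metis rangeI)
  have m: "min_poly x \<in> unit_monics r" by (rule min_poly_unit_monics[OF x(1) x0])
  hence d: "degree (min_poly x) = r" and nz: "min_poly x \<noteq> 0" by (auto simp: unit_monics_def)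
  have aux: "degree h = 0" if fh: "min_poly x = f * h" and f: "poly (map_poly \<iota> f) x = 0" for f h
  proof -
    have nz': "f \<noteq> 0" "h \<noteq> 0" using nz fh by auto
    hence "degree f + degree h = r" using d fh by (simp add: degree_mult_eq)
    thus ?thesis using degree_ge_if_root[OF x nz'(1) f] by simp
  qed
  have "irreducible (min_poly x)"
  proof (rule irreducibleI)
    show "min_poly x \<noteq> 0" by fact
    show "\<not> min_poly x dvd 1" using d nz prime_r by (auto simp: is_unit_iff_degree)
    fix f h assume fh: "min_poly x = f * h"
    have "poly (map_poly \<iota> f) x * poly (map_poly \<iota> h) x = 0"
      using poly_conjugate_poly[of x] map_iota_min_poly[OF x(1)] fh by (metis map_iota_mult poly_mult)
    hence "degree h = 0 \<or> degree f = 0"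
      using aux[OF fh] aux[of h f] fh by (auto simp: mult.commute)
    moreover have "f \<noteq> 0" "h \<noteq> 0" using nz fh by auto
    ultimately show "f dvd 1 \<or> h dvd 1" by (auto simp: is_unit_iff_degree)
  qed
  thus ?thesis using m by (auto simp: unit_irreducibles_def unit_monics_def)
qed

lemma range_subset_E: "range \<iota> \<subseteq> E"
  using iota_pow_Q_pow by (auto simp: E_def)

lemma card_E_minus: "card (E - range \<iota>) = Q ^ r - Q"
  using card_Diff_subset[OF _ range_subset_E] card_E inj_iota card_k by (simp add: E_def card_image)

lemma r_card_irreducibles:
  "r * card I = Q ^ r - Q"
proof -
  interpret triv: multiplicative_poly_fun "\<lambda>_ :: 'k poly. 1" by standard auto
  have "complex_of_nat Q ^ r - 1 = (of_nat Q - 1) + of_nat r * of_nat (card I)"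
    using S_trivial[of r, where ?'k = 'k] triv.S_prime[OF prime_r] prime_r card_k Q_pos
      card_unit_monics[of 0, where ?'k = 'k] prime_ge_1_nat[OF prime_r] by (simp add: of_nat_diff)
  hence "complex_of_nat (Q ^ r) = of_nat (Q + r * card I)"
    by (simp add: algebra_simps)
  hence "Q ^ r = Q + r * card I"
    by (simp only: of_nat_eq_iff)
  thus ?thesis by simp
qed

text \<open>Irreducible polynomials of degree \<open>r\<close> get their roots in \<open>E\<close>
  by counting: a fibre has at most \<open>r\<close> elements, and by
  \<open>r_card_irreducibles\<close> the fibres can only fill \<open>E - range \<iota>\<close> if
  all of them are full.\<close>

lemma card_fibre:
  assumes P: "P \<in> I"
  shows "card {x \<in> E - range \<iota>. min_poly x = P} = r"
proof -
  have le: "card {x \<in> E - range \<iota>. min_poly x = P} \<le> r" if "P \<in> I" for P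
  proof -
    have P0: "map_poly \<iota> P \<noteq> 0" "degree P = r" using that
      by (auto simp: unit_monics_def) (metis coeff_map_iota coeff_0 iota_eq_0_iff)
    have "{x \<in> E - range \<iota>. min_poly x = P} \<subseteq> {x. poly (map_poly \<iota> P) x = 0}"
      using map_iota_min_poly poly_conjugate_poly by auto
    hence "card {x \<in> E - range \<iota>. min_poly x = P} \<le> card {x. poly (map_poly \<iota> P) x = 0}"
      by (intro card_mono) auto
    thus ?thesis using card_poly_roots_bound[OF P0(1)] P0(2) by simp
  qed
  have "(\<Sum>P\<in>I. card {x \<in> E - range \<iota>. min_poly x = P}) = card (E - range \<iota>)"
    using sum.group[of "E - range \<iota>" I min_poly "\<lambda>_. 1 :: nat"] irreducible_min_poly by auto
  also have "\<dots> = (\<Sum>P\<in>I. r)"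
    using card_E_minus r_card_irreducibles by (simp add: mult.commute)
  finally show ?thesis using le P by (rule sum_mono_inv) auto
qed

text \<open>A relation of Davenport-Hasse type. In \<open>S r\<close> a linear polynomial gives the
  term of its root in the small field, and an irreducible polynomial of degree \<open>r\<close>,
  weighted by its degree, gives the \<open>r\<close> equal terms of its roots.\<close>

theorem V_r: "V r = - (\<Sum>x\<in>E - {0}. ext_char (x + \<iota> A / x))"
proof -
  have "(\<Sum>x\<in>E - range \<iota>. ext_char (x + \<iota> A / x)) = (\<Sum>x\<in>E - range \<iota>. lam (min_poly x))"
  proof (rule sum.cong)
    fix x assume "x \<in> E - range \<iota>"
    moreover from this have "x \<noteq> 0" using iota_0 by (metis DiffD2 rangeI)
    ultimately show "ext_char (x + \<iota> A / x) = lam (min_poly x)" by (simp add: lam_min_poly)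
  qed simp
  also have "\<dots> = (\<Sum>P\<in>I. \<Sum>x\<in>{x \<in> E - range \<iota>. min_poly x = P}. lam (min_poly x))"
    by (rule sum.group[symmetric]) (use irreducible_min_poly in auto)
  also have "\<dots> = (\<Sum>P\<in>I. of_nat r * lam P)"
  proof (rule sum.cong)
    fix P assume P: "P \<in> I"
    have "(\<Sum>x\<in>{x \<in> E - range \<iota>. min_poly x = P}. lam (min_poly x))
        = (\<Sum>x\<in>{x \<in> E - range \<iota>. min_poly x = P}. lam P)"
      by (rule sum.cong) auto
    also have "\<dots> = of_nat r * lam P" unfolding sum_constant card_fibre[OF P] ..
    finally show "(\<Sum>x\<in>{x \<in> E - range \<iota>. min_poly x = P}. lam (min_poly x)) = of_nat r * lam P" .
  qed simp
  finally have nr: "(\<Sum>x\<in>E - range \<iota>. ext_char (x + \<iota> A / x)) = of_nat r * (\<Sum>P\<in>I. lam P)"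
    by (simp add: sum_distrib_left)
  have "(\<Sum>P\<in>unit_monics 1. lam P ^ r) = (\<Sum>y\<in>UNIV - {0}. ext_char (\<iota> y + \<iota> A / \<iota> y))"
    unfolding unit_monics_1 by (subst sum.reindex) (auto simp: inj_on_def lam_linear_power)
  also have "\<dots> = (\<Sum>x\<in>\<iota> ` (UNIV - {0}). ext_char (x + \<iota> A / x))"
    by (subst sum.reindex) (auto intro: inj_on_subset[OF inj_iota])
  finally have lin: "(\<Sum>P\<in>unit_monics 1. lam P ^ r) = (\<Sum>x\<in>\<iota> ` (UNIV - {0}). ext_char (x + \<iota> A / x))" .
  have "E - {0} = \<iota> ` (UNIV - {0}) \<union> (E - range \<iota>)"
    using range_subset_E iota_0 by (auto simp: image_iff)
  moreover have "(\<Sum>x\<in>\<iota> ` (UNIV - {0}) \<union> (E - range \<iota>). ext_char (x + \<iota> A / x))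
      = (\<Sum>x\<in>\<iota> ` (UNIV - {0}). ext_char (x + \<iota> A / x)) + (\<Sum>x\<in>E - range \<iota>. ext_char (x + \<iota> A / x))"
    by (rule sum.union_disjoint) auto
  ultimately show ?thesis
    using prime_r by (simp add: V_def S_prime lin[unfolded One_nat_def] nr)
qed

end

section \<open>Finite fields and the canonical additive character\<close>

lemma of_nat_card_UNIV: "of_nat (card (UNIV :: 'a set)) = (0 :: 'a::{ring_1,finite})"
proof -
  have "(\<Sum>x\<in>UNIV. x) = (\<Sum>x\<in>UNIV. x + 1 :: 'a)"
    by (rule sum.reindex_bij_witness[of _ "\<lambda>x. x + 1" "\<lambda>x. x - 1"]) auto
  thus ?thesis by (simp add: sum.distrib)
qed

lemma nonzero_power_card_minus_1:
  fixes x :: "'a::{field,finite}"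
  assumes "x \<noteq> 0" shows "x ^ (card (UNIV :: 'a set) - 1) = 1"
proof -
  have "(\<Prod>y\<in>UNIV - {0}. y) = (\<Prod>y\<in>UNIV - {0}. x * y)"
    by (rule prod.reindex_bij_witness[of _ "\<lambda>y. x * y" "\<lambda>y. y / x"]) (use assms in auto)
  also have "\<dots> = x ^ card (UNIV - {0 :: 'a}) * (\<Prod>y\<in>UNIV - {0}. y)"
    by (simp add: prod.distrib)
  finally have "(x ^ card (UNIV - {0 :: 'a}) - 1) * (\<Prod>y\<in>UNIV - {0}. y) = 0"
    by (simp add: algebra_simps)
  thus ?thesis by (simp add: card_Diff_singleton)
qed

lemma card_power_eq_le:
  fixes y :: "'a::idom" assumes "e > 0"
  shows "finite {x. x ^ e = y}" "card {x. x ^ e = y} \<le> e"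
proof -
  let ?f = "monom 1 e + [:- y:]"
  have eq: "{x. x ^ e = y} = {x. poly ?f x = 0}" by (simp add: poly_monom eq_neg_iff_add_eq_0 flip: diff_conv_add_uminus)
  have d: "degree ?f = e" using assms
    by (subst degree_add_eq_left) (simp_all add: degree_monom_eq)
  hence nz: "?f \<noteq> 0" using assms by (metis degree_0 less_irrefl)
  show "finite {x. x ^ e = y}" unfolding eq by (rule poly_roots_finite[OF nz])
  show "card {x. x ^ e = y} \<le> e"
    unfolding eq using card_poly_roots_bound[OF nz] unfolding d .
qed

text \<open>This replaces the cyclicity of the multiplicative group: all fibres of a power map are as
  large as the degree allows, since otherwise they would not cover the group.\<close>

lemma card_power_fibre:
  fixes y :: "'a::{field,finite}"
  assumes ed: "e * d = card (UNIV :: 'a set) - 1" and y: "y ^ d = 1"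
  shows "card {x. x ^ e = y} = e"
proof -
  let ?Y = "{y :: 'a. y ^ d = 1}"
  have "card {0, 1 :: 'a} \<le> card (UNIV :: 'a set)" by (rule card_mono) auto
  hence "card (UNIV :: 'a set) - 1 > 0" by simp
  hence e: "e > 0" and d: "d > 0" unfolding ed[symmetric] by auto
  have "(\<Sum>y\<in>?Y. card {x. x ^ e = y}) = (\<Sum>y\<in>?Y. card {x \<in> UNIV - {0}. x ^ e = y})"
    by (intro sum.cong arg_cong[where f = card]) (use e d in \<open>auto simp: power_0_left\<close>)
  also have "\<dots> = (\<Sum>y\<in>?Y. \<Sum>x\<in>{x \<in> UNIV - {0}. x ^ e = y}. 1)" by simp
  also have "\<dots> = (\<Sum>x\<in>UNIV - {0 :: 'a}. 1)"
    by (rule sum.group) (auto simp: ed nonzero_power_card_minus_1[unfolded One_nat_def] simp flip: power_mult)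
  also have "\<dots> = e * d" by (simp add: ed card_Diff_singleton)
  finally have s: "(\<Sum>y\<in>?Y. card {x. x ^ e = y}) = e * d" .
  moreover have "(\<Sum>y\<in>?Y. card {x. x ^ e = y}) \<le> (\<Sum>y\<in>?Y. e)"
    by (intro sum_mono card_power_eq_le e)
  moreover have "(\<Sum>y\<in>?Y. e) \<le> e * d" using card_power_eq_le(2)[OF d, of "1 :: 'a"] by simp
  ultimately have "(\<Sum>y\<in>?Y. card {x. x ^ e = y}) = (\<Sum>y\<in>?Y. e)" by linarith
  thus ?thesis by (rule sum_mono_inv) (use y card_power_eq_le[OF e] in auto)
qed

lemma diff_1_dvd_power_diff_1: "(x :: nat) - 1 dvd x ^ k - 1"
proof (cases "x = 0")
  case False
  have "int x - 1 dvd int x ^ k - 1 ^ k" by (subst power_diff_sumr2) simp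
  hence "int (x - 1) dvd int (x ^ k - 1)" using False by (simp add: of_nat_diff Suc_le_eq)
  thus ?thesis by (simp only: int_dvd_int_iff)
qed (cases k; simp)

section \<open>Subfields, traces and characters of the field with p ^ n elements\<close>

locale finite_field_pn =
  fixes p n :: nat and dummy :: "'a::{field,finite} itself"
  assumes prime_p: "prime p" and p_odd: "p > 2" and n_pos: "n > 0"
    and card_F: "card (UNIV :: 'a set) = p ^ n"
begin

definition \<zeta> :: complex where "\<zeta> = cis (2 * pi / real p)"

lemma p_pos: "p > 0" using p_odd by simp

sublocale prime_root p \<zeta>
proof
  show "prime p" by (rule prime_p)
  have "\<zeta> ^ p = cis (2 * pi)" using p_pos by (simp add: \<zeta>_def DeMoivre)
  thus "\<zeta> ^ p = 1" by (simp add: complex_eq_iff)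
  show "\<zeta> \<noteq> 1"
  proof
    assume "\<zeta> = 1"
    hence "cos (2 * pi / real p) = 1" by (simp add: \<zeta>_def complex_eq_iff)
    moreover have "cos (2 * pi / real p) < cos 0"
      using p_odd by (intro cos_monotone_0_pi) (auto simp: field_simps)
    ultimately show False by simp
  qed
qed

lemma CHAR_eq: "CHAR('a) = p"
proof -
  have "CHAR('a) dvd p ^ n"
    using of_nat_card_UNIV[where ?'a = 'a] unfolding card_F by (simp only: of_nat_eq_0_iff_char_dvd)
  moreover have "CHAR('a) > 0" by (rule finite_imp_CHAR_pos) simp
  hence "prime CHAR('a)" by (rule prime_CHAR_semidom)
  ultimately show ?thesis
    using prime_p prime_dvd_power primes_dvd_imp_eq by blast
qed

lemma of_nat_eq_0: "of_nat k = (0 :: 'a) \<longleftrightarrow> p dvd k"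
  by (simp add: of_nat_eq_0_iff_char_dvd CHAR_eq)

lemma of_nat_p: "of_nat p = (0 :: 'a)" by (simp add: of_nat_eq_0)

lemma frob_add: "(x + y :: 'a) ^ (p ^ k) = x ^ (p ^ k) + y ^ (p ^ k)"
  by (rule freshmans_dream') (use prime_p in \<open>simp_all add: CHAR_eq\<close>)

lemma frob_sum: "(sum f A :: 'a) ^ (p ^ k) = (\<Sum>x\<in>A. f x ^ (p ^ k))"
  by (rule freshmans_dream_sum') (use prime_p in \<open>simp_all add: CHAR_eq\<close>)

lemma odd_p: "odd p" using prime_p p_odd by (simp add: prime_odd_nat)

lemma frob_uminus: "(- x :: 'a) ^ (p ^ k) = - (x ^ (p ^ k))"
  using odd_p by simp

lemma frob_diff: "(x - y :: 'a) ^ (p ^ k) = x ^ (p ^ k) - y ^ (p ^ k)"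
  using frob_add[of x "- y"] by (simp add: frob_uminus)

lemma of_nat_eq_iff_mod: "of_nat i = (of_nat j :: 'a) \<longleftrightarrow> i mod p = j mod p"
  using of_nat_eq_iff_cong_CHAR[of i j, where ?'a = 'a] by (simp add: CHAR_eq cong_def)

lemma prime_subfield_eq: "(prime_subfield :: 'a set) = {x. x ^ p = x}" "(prime_subfield :: 'a set) = of_nat ` {..<p}"
proof -
  have fn: "of_nat k ^ p = (of_nat k :: 'a)" for k
    by (induction k) (use frob_add[of 1 _ 1] p_pos in \<open>simp_all\<close>)
  have sub: "(prime_subfield :: 'a set) \<subseteq> {x. x ^ p = x}"
  proof
    fix x :: 'a assume "x \<in> prime_subfield"
    then obtain k :: int where x: "x = of_int k" by (auto simp: prime_subfield_def)
    obtain l where "k = int l \<or> k = - int l" using int_cases2 by metis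
    thus "x \<in> {x. x ^ p = x}" using fn odd_p by (auto simp: x)
  qed
  have inj: "inj_on (of_nat :: nat \<Rightarrow> 'a) {..<p}" by (auto simp: inj_on_def of_nat_eq_iff_mod)
  have sub2: "of_nat ` {..<p} \<subseteq> (prime_subfield :: 'a set)"
    by (auto simp: prime_subfield_def) (metis of_int_of_nat_eq rangeI)
  have "{x :: 'a. x ^ p = x} = insert 0 {x. x ^ (p - 1) = 1}"
  proof -
    have "x ^ p = x \<longleftrightarrow> x = 0 \<or> x ^ (p - 1) = 1" for x :: 'a
      using p_pos by (cases p) auto
    thus ?thesis by auto
  qed
  hence "card {x :: 'a. x ^ p = x} \<le> Suc (card {x :: 'a. x ^ (p - 1) = 1})"
    by (simp add: card_insert_le_m1)
  also have "\<dots> \<le> p" using card_power_eq_le(2)[of "p - 1" "1 :: 'a"] p_odd by simp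
  also have "p = card (of_nat ` {..<p} :: 'a set)" using inj by (simp add: card_image)
  finally have "of_nat ` {..<p} = {x :: 'a. x ^ p = x}"
    by (intro card_seteq) (use sub sub2 in auto)
  thus "(prime_subfield :: 'a set) = {x. x ^ p = x}" "(prime_subfield :: 'a set) = of_nat ` {..<p}"
    using sub sub2 by auto
qed

abbreviation Fp :: "'a set" where "Fp \<equiv> prime_subfield"
abbreviation zp :: "'a \<Rightarrow> complex" where "zp \<equiv> zeta_pow p"

lemma zp_of_nat: "zp (of_nat k) = \<zeta> ^ k"
proof -
  define i where "i = (SOME i::int. of_int i = (of_nat k :: 'a))"
  have "of_int i = (of_nat k :: 'a)"
    unfolding i_def by (rule someI[of _ "int k"]) simp
  hence "of_int (int k) = (of_int i :: 'a)" by simp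
  hence "[int k = i] (mod int p)" by (simp only: of_int_eq_iff_cong_CHAR CHAR_eq)
  then obtain c where c: "i = int k + c * int p" by (metis cong_iff_lin mult.commute)
  have "zp (of_nat k) = cis (2 * pi * real_of_int i / real p)"
    by (simp add: zeta_pow_def i_def)
  also have "2 * pi * real_of_int i / real p = 2 * pi * of_int c + real k * (2 * pi / real p)"
    using p_pos by (simp add: c field_simps)
  also have "cis \<dots> = cis (2 * pi * of_int c) * \<zeta> ^ k"
    by (simp only: cis_mult[symmetric] \<zeta>_def DeMoivre)
  also have "cis (2 * pi * of_int c) = 1" by (simp add: complex_eq_iff)
  finally show ?thesis by simp
qed

lemma zp_0 [simp]: "zp 0 = 1" using zp_of_nat[of 0] by simp

lemma zp_add: "c \<in> Fp \<Longrightarrow> d \<in> Fp \<Longrightarrow> zp (c + d) = zp c * zp d"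
  unfolding prime_subfield_eq(2) by (auto simp: zp_of_nat power_add simp flip: of_nat_add)

lemma Fp_of_nat [simp, intro]: "of_nat k \<in> Fp"
  unfolding prime_subfield_def by (metis of_int_of_nat_eq rangeI)

lemma Fp_0 [simp, intro]: "0 \<in> Fp" using Fp_of_nat[of 0] by simp

lemma Fp_add [intro]: "c \<in> Fp \<Longrightarrow> d \<in> Fp \<Longrightarrow> c + d \<in> Fp"
  unfolding prime_subfield_def by (auto simp flip: of_int_add)

lemma Fp_uminus [intro]: "c \<in> Fp \<Longrightarrow> - c \<in> Fp"
  unfolding prime_subfield_def by (auto simp flip: of_int_minus)

lemma Fp_mult [intro]: "c \<in> Fp \<Longrightarrow> d \<in> Fp \<Longrightarrow> c * d \<in> Fp"
  unfolding prime_subfield_def by (auto simp flip: of_int_mult)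

lemma zp_uminus: "c \<in> Fp \<Longrightarrow> zp (- c) * zp c = 1"
  using zp_add[of "- c" c] by (auto simp: Fp_uminus)

lemma zp_diff: "c \<in> Fp \<Longrightarrow> d \<in> Fp \<Longrightarrow> zp (c - d) = zp c * zp (- d)"
  using zp_add[of c "- d"] by (auto simp: Fp_uminus)

definition idx :: "'a \<Rightarrow> nat" where "idx c = (SOME j. j < p \<and> of_nat j = c)"

lemma idx: "c \<in> Fp \<Longrightarrow> idx c < p \<and> of_nat (idx c) = c"
  unfolding idx_def by (rule someI_ex) (auto simp: prime_subfield_eq(2))

lemma zp_idx: "c \<in> Fp \<Longrightarrow> zp c = \<zeta> ^ idx c"
  using zp_of_nat[of "idx c"] idx by simp

lemma zp_eq_1: assumes "c \<in> Fp" "zp c = 1" shows "c = 0"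
proof (rule ccontr)
  assume c0: "c \<noteq> 0"
  let ?j = "idx c"
  have j: "?j < p" "?j \<noteq> 0" using idx[OF assms(1)] c0 by (metis, metis of_nat_0)
  define e :: "nat \<Rightarrow> int" where "e i = (if i = ?j then 1 else if i = 0 then - 1 else 0)" for i
  have "(\<Sum>i<p. of_int (e i) * \<zeta> ^ i) = (\<Sum>i\<in>{0, ?j}. of_int (e i) * \<zeta> ^ i)"
    by (rule sum.mono_neutral_right) (use j p_pos in \<open>auto simp: e_def\<close>)
  also have "\<dots> = 0" using j assms(2) zp_idx[OF assms(1)] by (simp add: e_def)
  finally have "e ?j = e (p - 1)" "e 0 = e (p - 1)" using int_relation j p_pos by auto
  thus False using j by (simp add: e_def)
qed

definition Fsub :: "nat \<Rightarrow> 'a set" where "Fsub j = {x. x ^ (p ^ j) = x}"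

lemma Fsub_alt: "Fsub j = insert 0 {x. x ^ (p ^ j - 1) = 1}" if "j > 0"
proof -
  have "x ^ (p ^ j) = x * x ^ (p ^ j - 1)" for x :: 'a
    using p_pos by (metis power_eq_if zero_less_power less_irrefl)
  moreover have "p ^ j - 1 \<noteq> 0" using that p_odd one_less_power[of p j] by simp
  ultimately show ?thesis using p_pos by (auto simp: Fsub_def power_0_left)
qed

lemma card_Fsub:
  assumes "j > 0" "j dvd n" shows "card (Fsub j) = p ^ j"
proof -
  obtain k where k: "n = j * k" using assms by blast
  have "p ^ j - 1 dvd p ^ n - 1" unfolding k power_mult by (rule diff_1_dvd_power_diff_1)
  then obtain d where "p ^ n - 1 = (p ^ j - 1) * d" by (rule dvdE)
  hence "(p ^ j - 1) * d = card (UNIV :: 'a set) - 1" by (simp only: card_F)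
  hence "card {x :: 'a. x ^ (p ^ j - 1) = 1} = p ^ j - 1"
    by (rule card_power_fibre) simp
  moreover have g: "p ^ j - 1 > 0" using assms p_odd one_less_power[of p j] by simp
  hence "0 \<notin> {x :: 'a. x ^ (p ^ j - 1) = 1}" by (simp only: mem_Collect_eq power_0_left) simp
  ultimately show ?thesis using g by (simp add: Fsub_alt[OF assms(1)])
qed

lemma Fsub_0 [simp, intro]: "0 \<in> Fsub j" using p_pos by (simp add: Fsub_def)
lemma Fsub_1 [simp, intro]: "1 \<in> Fsub j" by (simp add: Fsub_def)
lemma Fsub_add [intro]: "x \<in> Fsub j \<Longrightarrow> y \<in> Fsub j \<Longrightarrow> x + y \<in> Fsub j"
  by (simp add: Fsub_def frob_add)
lemma Fsub_diff [intro]: "x \<in> Fsub j \<Longrightarrow> y \<in> Fsub j \<Longrightarrow> x - y \<in> Fsub j"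
  by (simp add: Fsub_def frob_diff)
lemma Fsub_uminus [intro]: "x \<in> Fsub j \<Longrightarrow> - x \<in> Fsub j"
  by (simp add: Fsub_def frob_uminus)
lemma Fsub_mult [intro]: "x \<in> Fsub j \<Longrightarrow> y \<in> Fsub j \<Longrightarrow> x * y \<in> Fsub j"
  by (simp add: Fsub_def power_mult_distrib)
lemma Fsub_divide [intro]: "x \<in> Fsub j \<Longrightarrow> y \<in> Fsub j \<Longrightarrow> x / y \<in> Fsub j"
  by (simp add: Fsub_def power_divide)

lemma Fsub_n: "x \<in> Fsub n"
proof -
  have "x ^ (p ^ n - 1) = 1" if "x \<noteq> 0" using nonzero_power_card_minus_1[OF that] by (simp add: card_F)
  thus ?thesis using Fsub_alt[OF n_pos] by blast
qed

lemma tr_add: "tr p j (x + y) = tr p j x + (tr p j y :: 'a)"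
  by (simp add: tr_def frob_add sum.distrib)

lemma tr_0 [simp]: "tr p j 0 = (0 :: 'a)"
  using tr_add[of j 0 0] by (metis add_cancel_right_right)

lemma tr_uminus: "tr p j (- x) = - (tr p j x :: 'a)"
  by (simp add: tr_def frob_uminus sum_negf)

lemma tr_Fp: assumes "x \<in> Fsub j" shows "tr p j x \<in> Fp"
proof -
  have e: "(y ^ p ^ i) ^ p = y ^ p ^ Suc i" for y :: 'a and i by (simp add: mult.commute flip: power_mult)
  have "tr p j x ^ p = (\<Sum>i<j. x ^ (p ^ Suc i))"
    using frob_sum[of "\<lambda>i. x ^ p ^ i" "{..<j}" 1] by (simp add: tr_def e del: power_Suc)
  also have "\<dots> = tr p j x"
  proof (cases j)
    case (Suc l)
    have "(\<Sum>i<j. x ^ (p ^ Suc i)) = (\<Sum>i<l. x ^ (p ^ Suc i)) + x ^ (p ^ j)"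
      unfolding Suc by simp
    also have "x ^ (p ^ j) = x ^ (p ^ 0)" using assms by (simp add: Fsub_def)
    finally show ?thesis unfolding tr_def unfolding Suc sum.lessThan_Suc_shift by simp
  qed (simp add: tr_def)
  finally show ?thesis by (simp add: prime_subfield_eq(1))
qed

text \<open>As a polynomial the trace has degree at most \<open>p ^ (j - 1)\<close>, too small to
  vanish on the \<open>p ^ j\<close> elements of \<open>Fsub j\<close>; its coefficient at 1 shows
  that it is not the zero polynomial.\<close>

lemma tr_nontrivial:
  assumes "j > 0" "j dvd n" shows "\<exists>y\<in>Fsub j. tr p j y \<noteq> 0"
proof (rule ccontr)
  assume "\<not> ?thesis"
  hence z: "tr p j y = 0" if "y \<in> Fsub j" for y using that by blast
  define f :: "'a poly" where "f = (\<Sum>i<j. monom 1 (p ^ i))"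
  have pf: "poly f x = tr p j x" for x by (simp add: f_def tr_def poly_sum poly_monom)
  have "coeff f 1 = (\<Sum>i<j. if p ^ i = 1 then 1 else 0)" by (simp add: f_def coeff_sum)
  also have "\<dots> = (\<Sum>i\<in>{0}. if p ^ i = 1 then 1 else 0)"
    by (rule sum.mono_neutral_right) (use assms p_odd in auto)
  finally have "f \<noteq> 0" by auto
  have "degree f \<le> p ^ (j - 1)"
    unfolding f_def
  proof (intro degree_sum_le)
    fix i assume "i \<in> {..<j}"
    hence "p ^ i \<le> p ^ (j - 1)" using p_pos by (intro power_increasing) auto
    thus "degree (monom (1 :: 'a) (p ^ i)) \<le> p ^ (j - 1)" by (simp add: degree_monom_eq)
  qed simp
  moreover have "card (Fsub j) \<le> card {x. poly f x = 0}"
    using poly_roots_finite[OF \<open>f \<noteq> 0\<close>] by (intro card_mono) (auto simp: pf z)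
  moreover have "card {x. poly f x = 0} \<le> degree f" by (rule card_poly_roots_bound) fact
  moreover have "p ^ (j - 1) < p ^ j" using assms p_odd by (intro power_strict_increasing) auto
  ultimately show False using card_Fsub[OF assms] by linarith
qed

lemma sum_zp_tr:
  assumes j: "j > 0" "j dvd n" and c: "c \<in> Fsub j"
  shows "(\<Sum>y\<in>Fsub j. zp (tr p j (c * y))) = (if c = 0 then of_nat (p ^ j) else 0)"
proof (cases "c = 0")
  case True
  thus ?thesis using card_Fsub[OF j] by simp
next
  case False
  obtain s where s: "s \<in> Fsub j" "tr p j s \<noteq> 0" using tr_nontrivial[OF j] by blast
  have ne: "zp (tr p j s) \<noteq> 1" using zp_eq_1[OF tr_Fp[OF s(1)]] s(2) by blast
  define X where "X = (\<Sum>y\<in>Fsub j. zp (tr p j y))"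
  have "X = (\<Sum>y\<in>Fsub j. zp (tr p j (s + y)))" unfolding X_def
    by (rule sum.reindex_bij_witness[of _ "\<lambda>x. s + x" "\<lambda>x. x - s"]) (use s in auto)
  also have "\<dots> = (\<Sum>y\<in>Fsub j. zp (tr p j s) * zp (tr p j y))"
    by (intro sum.cong refl) (use s in \<open>simp add: tr_add zp_add tr_Fp\<close>)
  also have "\<dots> = zp (tr p j s) * X" by (simp add: X_def sum_distrib_left)
  finally have "X * (1 - zp (tr p j s)) = 0" by (simp add: algebra_simps)
  hence "X = 0" using ne by simp
  moreover have "(\<Sum>y\<in>Fsub j. zp (tr p j (c * y))) = X" unfolding X_def
    by (rule sum.reindex_bij_witness[of _ "\<lambda>x. x / c" "\<lambda>x. c * x"]) (use c False in auto)
  ultimately show ?thesis using False by simp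
qed

lemma tr_double: "tr p (j + j) x = tr p j (x + x ^ (p ^ j) :: 'a)"
proof -
  have "tr p (j + j) x = (\<Sum>i<j. x ^ (p ^ i)) + (\<Sum>i<j. x ^ (p ^ (j + i)))"
  proof -
    have "{..<j + j} = {..<j} \<union> (\<lambda>i. j + i) ` {..<j}"
    proof (intro equalityI subsetI)
      fix i assume "i \<in> {..<j + j}"
      thus "i \<in> {..<j} \<union> (\<lambda>i. j + i) ` {..<j}"
        by (cases "i < j") (auto intro!: image_eqI[of _ _ "i - j"])
    qed auto
    hence "tr p (j + j) x = (\<Sum>i\<in>{..<j} \<union> (\<lambda>i. j + i) ` {..<j}. x ^ (p ^ i))"
      by (simp add: tr_def)
    also have "\<dots> = (\<Sum>i<j. x ^ (p ^ i)) + (\<Sum>i\<in>(\<lambda>i. j + i) ` {..<j}. x ^ (p ^ i))"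
      by (rule sum.union_disjoint) auto
    finally show ?thesis by (simp add: sum.reindex)
  qed
  also have "(\<Sum>i<j. x ^ (p ^ (j + i))) = tr p j (x ^ (p ^ j))"
    by (simp add: tr_def power_add flip: power_mult)
  finally show ?thesis unfolding tr_add by (simp add: tr_def)
qed

end

section \<open>From regular bentness to a sum over the unit circle\<close>

locale bent_setup = finite_field_pn p "2 * m" "TYPE('a)"
  for p m :: nat and a b :: "'a::{field,finite}" +
  assumes even_m: "even m" and b_Fp: "b \<in> prime_subfield" and p_ge: "p \<ge> 13"
begin

definition q :: nat where "q = p ^ m"

lemma m_ge: "m \<ge> 2" using even_m n_pos by (auto elim!: evenE)
lemma m_pos: "m > 0" using m_ge by simp

lemma card_q: "card (UNIV :: 'a set) - 1 = (q - 1) * (q + 1)"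
proof -
  have "card (UNIV :: 'a set) = q * q" by (simp add: card_F q_def mult_2 power_add)
  thus ?thesis by (simp add: algebra_simps)
qed

lemma q_gt: "q > 13"
proof -
  have "p ^ 2 \<le> q" unfolding q_def using m_ge p_pos by (intro power_increasing) auto
  moreover have "13 * 13 \<le> p * p" using p_ge by (intro mult_mono) auto
  ultimately show ?thesis by (simp add: power2_eq_square)
qed

lemma odd_q: "odd q" using odd_p m_pos by (simp add: q_def)

definition Fq :: "'a set" where "Fq = Fsub m"
definition U :: "'a set" where "U = {u. u ^ (q + 1) = 1}"

lemma Fq_iff: "x \<in> Fq \<longleftrightarrow> x ^ q = x" by (simp add: Fq_def Fsub_def q_def)

lemma card_Fq: "card Fq = q" unfolding Fq_def q_def using m_pos by (intro card_Fsub) auto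

lemma card_fib: "u \<in> U \<Longrightarrow> card {x :: 'a. x ^ (q - 1) = u} = q - 1"
  unfolding U_def by (rule card_power_fibre[OF card_q[symmetric]]) simp

lemma card_U: "card U = q + 1"
  unfolding U_def
  by (rule card_power_fibre[where d = "q - 1"]) (simp_all only: card_q mult.commute[of "q + 1"] power_one)

lemma pow_q_q: "(x :: 'a) ^ q ^ 2 = x"
  using Fsub_n[of x] by (simp add: Fsub_def q_def mult.commute flip: power_mult)

lemma U_nonzero: "u \<in> U \<Longrightarrow> u \<noteq> 0" by (auto simp: U_def)

lemma U_image: "x \<noteq> 0 \<Longrightarrow> x ^ (q - 1) \<in> U"
  unfolding U_def mem_Collect_eq power_mult[symmetric] card_q[symmetric] by (rule nonzero_power_card_minus_1)

lemma Fq_pow: "y \<in> Fq \<Longrightarrow> y \<noteq> 0 \<Longrightarrow> y ^ (q - 1) = 1"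
proof -
  assume y: "y \<in> Fq" "y \<noteq> 0"
  have "y ^ q = y * y ^ (q - 1)" using q_gt by (simp flip: power_Suc)
  thus ?thesis using y by (simp add: Fq_iff)
qed

abbreviation Tr :: "'a \<Rightarrow> 'a" where "Tr \<equiv> tr p (2 * m)"

definition h :: "'a \<Rightarrow> 'a" where "h u = Tr (a * u) + b * u ^ ((q + 1) div 2)"

lemma eta_square: "u \<in> U \<Longrightarrow> (u ^ ((q + 1) div 2)) ^ 2 = 1"
proof -
  have "(q + 1) div 2 * 2 = q + 1" by (rule dvd_div_mult_self) (use odd_q in simp)
  thus "u \<in> U \<Longrightarrow> (u ^ ((q + 1) div 2)) ^ 2 = 1"
    unfolding U_def mem_Collect_eq power_mult[symmetric] by (simp only:)
qed

lemma eta_cases: "u \<in> U \<Longrightarrow> u ^ ((q + 1) div 2) = 1 \<or> u ^ ((q + 1) div 2) = - 1"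
  using eta_square[of u] by (simp add: power2_eq_1_iff)

lemma one_Fp [simp, intro]: "1 \<in> Fp" using Fp_of_nat[of 1] by simp

lemma h_Fp: "u \<in> U \<Longrightarrow> h u \<in> Fp"
  unfolding h_def using eta_cases[of u] b_Fp Fsub_n by (auto intro!: Fp_add tr_Fp Fp_mult Fp_uminus)

lemma exp_half: "(p ^ (2 * m) - 1) div 2 = (q - 1) * ((q + 1) div 2)"
proof -
  have "p ^ (2 * m) - 1 = (q - 1) * (q + 1)" using card_q by (simp add: card_F)
  moreover have "q + 1 = 2 * ((q + 1) div 2)" using odd_q by simp
  ultimately have "p ^ (2 * m) - 1 = 2 * ((q - 1) * ((q + 1) div 2))" by (metis mult.left_commute)
  thus ?thesis by simp
qed

lemma U_powi: "u \<in> U \<Longrightarrow> u powi k \<in> U"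
  unfolding U_def by (simp flip: power_int_of_nat power_int_mult)
     (metis mult.commute power_int_1_left power_int_mult power_int_of_nat)

text \<open>The quadratic character takes the values 1 and - 1 only, so for odd \<open>t\<close> an
  extra power \<open>t\<close> may be inserted into it. Then both terms depend on the same element
  of \<open>U\<close>.\<close>

lemma f_eq:
  assumes t: "odd t" and x: "x \<noteq> 0"
  shows "f_abt p m a b t x = h ((x ^ (q - 1)) powi t)"
proof -
  have "int (q - 1) = int p ^ m - 1" using q_gt by (simp add: q_def of_nat_diff)
  hence e1: "x powi (t * (int p ^ m - 1)) = (x ^ (q - 1)) powi t"
    by (metis mult.commute power_int_mult power_int_of_nat)
  let ?u = "x ^ (q - 1)" let ?e = "(q + 1) div 2"
  have "x ^ ((p ^ (2 * m) - 1) div 2) = ?u ^ ?e" unfolding exp_half by (rule power_mult)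
  moreover have "(?u powi t) ^ ?e = (?u ^ ?e) powi t"
    by (metis mult.commute power_int_mult power_int_of_nat)
  moreover have "(?u ^ ?e) powi t = ?u ^ ?e"
    using eta_cases[OF U_image[OF x]] t by (auto simp: power_int_minus_left)
  ultimately show ?thesis by (simp add: f_abt_def h_def e1)
qed

lemma f_0:
  assumes "t \<noteq> 0" shows "f_abt p m a b t 0 = 0"
proof -
  have "t * (int p ^ m - 1) \<noteq> 0" 
  proof -
    have "int p ^ m > 13" using q_gt unfolding q_def by (metis of_nat_less_iff of_nat_numeral of_nat_power)
    thus ?thesis using assms by simp
  qed
  moreover have "(p ^ (2 * m) - 1) div 2 \<noteq> 0" unfolding exp_half using q_gt odd_q by simp
  ultimately show ?thesis by (simp add: f_abt_def power_int_0_left)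
qed

theorem regular_bent_imp:
  assumes bent: "regular_bent p (2 * m) (f_abt p m a b t)" and t: "odd t"
  shows "(\<Sum>x\<in>UNIV - {0}. zp (f_abt p m a b t x)) = of_nat (q - 1)"
proof -
  let ?f = "f_abt p m a b t"
  have t0: "t \<noteq> 0" using t by auto
  have fFp: "?f x \<in> Fp" for x
    using f_0[OF t0] f_eq[OF t] h_Fp U_powi U_image by (cases "x = 0") auto
  have fmult: "?f (y * x) = ?f x" if "y \<in> Fq" "y \<noteq> 0" "x \<noteq> 0" for x y
    using that by (simp add: f_eq[OF t] power_mult_distrib Fq_pow[unfolded One_nat_def])
  define K where "K = (\<Sum>x\<in>UNIV - {0}. zp (?f x))"
  have sq: "complex_of_real (sqrt (real p) ^ (2 * m)) = of_nat q"
    by (simp add: power_mult q_def)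
  have W: "walsh p (2 * m) ?f l = 1 + (\<Sum>x\<in>UNIV - {0}. zp (?f x) * zp (- Tr (l * x)))" for l
  proof -
    have "walsh p (2 * m) ?f l = (\<Sum>x\<in>insert 0 (UNIV - {0}). zp (?f x - Tr (l * x)))"
      unfolding walsh_def by (rule sum.cong) auto
    also have "\<dots> = 1 + (\<Sum>x\<in>UNIV - {0}. zp (?f x - Tr (l * x)))"
      by (subst sum.insert) (auto simp: f_0[OF t0])
    finally show ?thesis by (simp add: zp_diff fFp tr_Fp Fsub_n)
  qed
  obtain c where c: "c \<in> Fp" "walsh p (2 * m) ?f 0 = of_nat q * zp c"
    using bent unfolding regular_bent_def sq by blast
  obtain c' where c': "c' \<in> Fp" "walsh p (2 * m) ?f 1 = of_nat q * zp c'"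
    using bent unfolding regular_bent_def sq by blast
  have W0: "1 + K = of_nat q * zp c"
    using c W[of 0] by (simp add: K_def)
  hence Kc: "K = of_nat q * zp c - 1" by (simp add: eq_diff_eq add.commute)
  \<comment> \<open>The nonzero kernel of the relative trace x + x ^ q; exactly on it
    \<open>Tr (y * x)\<close> vanishes for all \<open>y\<close> in \<open>Fq\<close>. It is a single
    coset of the group of \<open>Fq\<close>, so \<open>?f\<close> is constant there.\<close>
  define Z where "Z = {x :: 'a. x ^ (q - 1) = - 1}"
  have q2: "even (q + 1)" "q - 1 > 0" using odd_q q_gt by auto
  have mU: "- 1 \<in> U" using odd_q by (simp add: U_def)
  have cardZ: "card Z = q - 1" unfolding Z_def by (rule card_fib[OF mU])
  have Z0: "x \<noteq> 0" if "x \<in> Z" for x using that q2 by (auto simp: Z_def power_0_left split: if_splits)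
  obtain x0 where x0: "x0 \<in> Z" using cardZ q2 by (metis card.empty equals0I less_irrefl)
  define g where "g = ?f x0"
  have gFp: "g \<in> Fp" by (simp add: g_def fFp)
  have fZ: "?f x = g" if "x \<in> Z" for x
    using that x0 Z0 by (simp add: g_def f_eq[OF t] Z_def)
  have inner: "(\<Sum>y\<in>Fq - {0}. zp (- Tr (y * x))) = (if x \<in> Z then of_nat q else 0) - 1"
    if x: "x \<noteq> 0" for x
  proof -
    let ?c = "- (x + x ^ q)"
    have cF: "?c \<in> Fsub m"
    proof -
      have "(x ^ q) ^ (p ^ m) = x" using pow_q_q[of x] by (simp add: q_def power2_eq_square power_mult)
      hence "x + x ^ q \<in> Fsub m" unfolding Fsub_def using frob_add[of x "x ^ q" m] by (simp add: q_def add.commute)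
      thus ?thesis by (rule Fsub_uminus)
    qed
    have xq: "x ^ q = x * x ^ (q - 1)" using q2 by (simp flip: power_Suc)
    have cz: "?c = 0 \<longleftrightarrow> x \<in> Z"
    proof -
      have "?c = - (x * (1 + x ^ (q - 1)))" unfolding xq by (simp add: algebra_simps)
      thus ?thesis using x by (auto simp: Z_def eq_neg_iff_add_eq_0 add.commute)
    qed
    have "- Tr (y * x) = tr p m (?c * y)" if "y \<in> Fq" for y
    proof -
      have "- Tr (y * x) = tr p m (- (y * x + (y * x) ^ q))"
        unfolding tr_uminus mult_2 tr_double q_def by (rule refl)
      also have "- (y * x + (y * x) ^ q) = ?c * y"
        using that by (simp add: power_mult_distrib Fq_iff algebra_simps)
      finally show ?thesis .
    qed
    hence "(\<Sum>y\<in>Fq. zp (- Tr (y * x))) = (\<Sum>y\<in>Fsub m. zp (tr p m (?c * y)))"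
      by (intro sum.cong) (auto simp: Fq_def)
    also have "\<dots> = (if x \<in> Z then of_nat q else 0)"
      using sum_zp_tr[OF m_pos _ cF] cz by (simp add: q_def)
    finally have "(\<Sum>y\<in>Fq. zp (- Tr (y * x))) = (if x \<in> Z then of_nat q else 0)" .
    moreover have "(\<Sum>y\<in>Fq. zp (- Tr (y * x))) = 1 + (\<Sum>y\<in>Fq - {0}. zp (- Tr (y * x)))"
      by (subst sum.remove[of _ 0]) (auto simp: Fq_def)
    ultimately show ?thesis by (simp add: algebra_simps)
  qed
  \<comment> \<open>By the scaling invariance of \<open>?f\<close> the Walsh value at 1 equals the
    one at every \<open>y\<close> in \<open>Fq - {0}\<close>; summing over \<open>y\<close> makes
    the evaluation of the inner sum applicable.\<close>
  have "of_nat (q - 1) * (walsh p (2 * m) ?f 1 - 1)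
      = (\<Sum>y\<in>Fq - {0}. \<Sum>x\<in>UNIV - {0}. zp (?f x) * zp (- Tr x))"
    by (simp add: W card_Diff_singleton card_Fq[unfolded Fq_def] Fq_def)
  also have "\<dots> = (\<Sum>y\<in>Fq - {0}. \<Sum>x\<in>UNIV - {0}. zp (?f x) * zp (- Tr (y * x)))"
  proof (rule sum.cong)
    fix y assume y: "y \<in> Fq - {0}"
    have fdiv: "?f (x / y) = ?f x" if "x \<noteq> 0" for x
      using fmult[of y "x / y"] y that by simp
    show "(\<Sum>x\<in>UNIV - {0}. zp (?f x) * zp (- Tr x))
        = (\<Sum>x\<in>UNIV - {0}. zp (?f x) * zp (- Tr (y * x)))"
      by (rule sum.reindex_bij_witness[of _ "\<lambda>x. y * x" "\<lambda>x. x / y"])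
         (use y fdiv in auto)
  qed simp
  also have "\<dots> = (\<Sum>x\<in>UNIV - {0}. zp (?f x) * (\<Sum>y\<in>Fq - {0}. zp (- Tr (y * x))))"
    by (subst sum.swap) (simp add: sum_distrib_left)
  also have "\<dots> = (\<Sum>x\<in>UNIV - {0}. zp (?f x) * ((if x \<in> Z then of_nat q else 0) - 1))"
    by (intro sum.cong refl) (simp add: inner)
  also have "\<dots> = (\<Sum>x\<in>UNIV - {0}. if x \<in> Z then zp (?f x) * of_nat q else 0) - K"
    unfolding K_def sum_subtractf[symmetric] by (intro sum.cong refl) (simp add: algebra_simps)
  also have "(\<Sum>x\<in>UNIV - {0}. if x \<in> Z then zp (?f x) * of_nat q else 0) = (\<Sum>x\<in>Z. zp (?f x) * of_nat q)"
    by (rule sum.mono_neutral_cong_right) (use Z0 in auto)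
  also have "\<dots> = of_nat (q - 1) * of_nat q * zp g"
    by (simp add: fZ cardZ)
  finally have "of_nat (q - 1) * (of_nat q * zp c' - 1) = of_nat (q - 1) * of_nat q * zp g - (of_nat q * zp c - 1)"
    unfolding c'(2) Kc .
  hence "of_nat q * ((of_nat q - 1) * zp c' - (of_nat q - 1) * zp g + zp c - 1) = 0"
    using q_gt by (simp add: of_nat_diff algebra_simps)
  hence rel: "(of_nat q - 1) * zp c' - (of_nat q - 1) * zp g + zp c - 1 = 0"
    using q_gt by simp
  define d :: "nat \<Rightarrow> int" where
    "d j = (int q - 1) * of_bool (j = idx c') - (int q - 1) * of_bool (j = idx g) + of_bool (j = idx c) - of_bool (j = 0)" for j
  have pick: "(\<Sum>j<p. of_bool (j = i) * \<zeta> ^ j) = \<zeta> ^ i" if "i < p" for i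
    using that by (simp add: of_bool_def if_distrib[of "\<lambda>x. x * _"] cong: if_cong)
  have "(\<Sum>j<p. of_int (d j) * \<zeta> ^ j)
      = (of_nat q - 1) * (\<Sum>j<p. of_bool (j = idx c') * \<zeta> ^ j) - (of_nat q - 1) * (\<Sum>j<p. of_bool (j = idx g) * \<zeta> ^ j)
        + (\<Sum>j<p. of_bool (j = idx c) * \<zeta> ^ j) - (\<Sum>j<p. of_bool (j = 0) * \<zeta> ^ j)"
    unfolding sum_distrib_left sum_subtractf[symmetric] sum.distrib[symmetric]
    by (intro sum.cong refl) (simp add: d_def algebra_simps)
  also have "\<dots> = 0"
    using rel idx c(1) c'(1) gFp p_pos by (simp add: pick zp_idx)
  finally have deq: "d j = d (p - 1)" if "j < p" for j
    using int_relation[of d] that by blast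
  \<comment> \<open>Four exponents cannot exhaust \<open>p \<ge> 13\<close> residues, so the common
    value of the coefficients is 0.\<close>
  have "card {idx c', idx g, idx c, 0} \<le> 4" by (simp add: card_insert_if)
  hence "\<not> {..<p} \<subseteq> {idx c', idx g, idx c, 0}"
    using p_ge card_mono[of "{idx c', idx g, idx c, 0}" "{..<p}"] by auto
  then obtain j where "j < p" "j \<notin> {idx c', idx g, idx c, 0}" by blast
  hence "d (p - 1) = 0" using deq[of j] by (simp add: d_def)
  hence d0: "d j = 0" if "j < p" for j using deq[OF that] by simp
  have "idx c' = idx g"
  proof (rule ccontr)
    assume ne: "idx c' \<noteq> idx g"
    have "d (idx g) = 0" using d0 idx[OF gFp] by blast
    hence "int q - 1 = of_bool (idx g = idx c) - of_bool (idx g = 0)" using ne by (simp add: d_def)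
    also have "\<dots> \<le> 1" by simp
    finally show False using q_gt by simp
  qed
  hence "of_bool (0 = idx c) - of_bool (0 = (0::nat)) = (0 :: int)"
    using d0[of 0] p_pos by (simp add: d_def)
  hence "idx c = 0" by (simp split: if_splits)
  hence "zp c = 1" using zp_idx[OF c(1)] by simp
  hence "K = of_nat (q - 1)" using W0 q_gt by (simp add: of_nat_diff algebra_simps)
  thus ?thesis by (simp add: K_def)
qed

text \<open>Each element of \<open>U\<close> has \<open>q - 1\<close> preimages under
  \<open>x ^ (q - 1)\<close>, which cancels the factor in \<open>regular_bent_imp\<close>; the
  exponent \<open>t\<close> only permutes \<open>U\<close>.\<close>

lemma sum_U_eq_1:
  assumes bent: "regular_bent p (2 * m) (f_abt p m a b t)" and t: "odd t" and cop: "coprime t (int q + 1)"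
  shows "(\<Sum>u\<in>U. zp (h u)) = 1"
proof -
  have "of_nat (q - 1) = (\<Sum>x\<in>UNIV - {0}. zp (h ((x ^ (q - 1)) powi t)))"
    unfolding regular_bent_imp[OF bent t, symmetric] by (intro sum.cong) (auto simp: f_eq[OF t])
  also have "\<dots> = (\<Sum>u\<in>U. \<Sum>x\<in>{x \<in> UNIV - {0}. x ^ (q - 1) = u}. zp (h ((x ^ (q - 1)) powi t)))"
    by (rule sum.group[symmetric]) (use U_image in auto)
  also have "\<dots> = (\<Sum>u\<in>U. of_nat (q - 1) * zp (h (u powi t)))"
  proof (rule sum.cong)
    fix u assume u: "u \<in> U"
    have "{x \<in> UNIV - {0}. x ^ (q - 1) = u} = {x. x ^ (q - 1) = u}"
      using U_nonzero[OF u] q_gt by (auto simp: power_0_left)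
    hence "card {x \<in> UNIV - {0}. x ^ (q - 1) = u} = q - 1" using card_fib[OF u] by simp
    thus "(\<Sum>x\<in>{x \<in> UNIV - {0}. x ^ (q - 1) = u}. zp (h ((x ^ (q - 1)) powi t)))
        = of_nat (q - 1) * zp (h (u powi t))"
      by (simp del: of_nat_diff)
  qed simp
  finally have "of_nat (q - 1) * 1 = of_nat (q - 1) * (\<Sum>u\<in>U. zp (h (u powi t)))"
    by (simp add: sum_distrib_left)
  hence "(\<Sum>u\<in>U. zp (h (u powi t))) = 1" using q_gt by simp
  moreover obtain s where s: "[t * s = 1] (mod (int q + 1))"
    using cong_solve_coprime_int[OF cop] by blast
  have inv: "u powi (t * s) = u" if u: "u \<in> U" for u
  proof -
    have "int q + 1 dvd t * s - 1" using s by (simp add: cong_iff_dvd_diff)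
    then obtain k where k: "t * s = 1 + (int q + 1) * k" by (metis add.commute diff_add_cancel dvdE)
    have "u powi (t * s) = u powi 1 * (u powi (int q + 1)) powi k"
      unfolding k using U_nonzero[OF u] by (subst power_int_add) (auto simp only: power_int_mult)
    also have "u powi (int q + 1) = u ^ (q + 1)"
      by (metis of_nat_1 of_nat_add power_int_of_nat)
    finally show ?thesis using u by (simp add: U_def)
  qed
  have "(\<Sum>u\<in>U. zp (h (u powi t))) = (\<Sum>u\<in>U. zp (h u))"
    by (rule sum.reindex_bij_witness[of _ "\<lambda>u. u powi s" "\<lambda>u. u powi t"])
       (use inv in \<open>auto simp: U_powi mult.commute simp flip: power_int_mult\<close>)
  ultimately show ?thesis by simp
qed

text \<open>A sum equal to 1 means that all values are taken \<open>M\<close> times, with one extra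
  0. Then p * M = q, so M = p ^ (m - 1) is 0 in the field because \<open>m \<ge> 2\<close>, and the
  extra 0 is invisible for \<open>k > 0\<close>.\<close>

lemma moments:
  assumes one: "(\<Sum>u\<in>U. zp (h u)) = 1" and k: "k > 0"
  shows "(\<Sum>u\<in>U. h u ^ k) = 0"
proof -
  define N where "N j = int (card {u\<in>U. idx (h u) = j})" for j
  have ix: "idx (h u) mod p = idx (h u)" if "u \<in> U" for u using idx[OF h_Fp[OF that]] by simp
  have "1 = (\<Sum>u\<in>U. of_int 1 * \<zeta> ^ idx (h u))"
    using one by (simp add: zp_idx h_Fp)
  also have "\<dots> = (\<Sum>j<p. of_int (\<Sum>u\<in>{u\<in>U. idx (h u) mod p = j}. 1) * \<zeta> ^ j)"
    by (rule fold_exponents) simp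
  also have "\<dots> = (\<Sum>j<p. of_int (N j) * \<zeta> ^ j)"
    by (intro sum.cong refl arg_cong2[where f = "(*)"] arg_cong[where f = of_int])
       (auto simp: N_def ix intro!: arg_cong[where f = card] cong: conj_cong)
  finally have "(\<Sum>j<p. of_int (N j - of_bool (j = 0)) * \<zeta> ^ j) = 1 - (\<Sum>j<p. of_bool (j = 0) * \<zeta> ^ j)"
    by (simp add: left_diff_distrib sum_subtractf)
  also have "(\<Sum>j<p. of_bool (j = 0) * \<zeta> ^ j) = (\<Sum>j\<in>{0}. of_bool (j = 0) * \<zeta> ^ j)"
    by (rule sum.mono_neutral_right) (use p_pos in auto)
  finally have "(\<Sum>j<p. of_int (N j - of_bool (j = 0)) * \<zeta> ^ j) = 0" by simp
  hence eq: "N j - of_bool (j = 0) = N (p - 1) - of_bool (p - 1 = 0)" if "j < p" for j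
    using int_relation[of "\<lambda>j. N j - of_bool (j = 0)"] that by blast
  define M where "M = N (p - 1)"
  have NM: "N j = M + of_bool (j = 0)" if "j < p" for j
    using eq[OF that] p_ge by (simp add: M_def)
  have "(\<Sum>j<p. N j) = (\<Sum>j<p. \<Sum>u\<in>{u\<in>U. idx (h u) = j}. 1)" by (simp add: N_def)
  also have "\<dots> = (\<Sum>u\<in>U. 1)"
    by (rule sum.group) (use idx h_Fp in auto)
  finally have "(\<Sum>j<p. N j) = int q + 1" by (simp add: card_U)
  moreover have "(\<Sum>j<p. N j) = (\<Sum>j<p. M + of_bool (j = 0))" by (intro sum.cong) (auto simp: NM)
  moreover have "(\<Sum>j<p. of_bool (j = 0) :: int) = (\<Sum>j\<in>{0::nat}. of_bool (j = 0))"
    by (rule sum.mono_neutral_right) (use p_pos in auto)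
  ultimately have "int p * M = int q" by (simp add: sum.distrib)
  moreover have "q = p * p ^ (m - 1)" using m_pos by (simp add: q_def flip: power_Suc)
  ultimately have "int p * M = int p * int (p ^ (m - 1))" by simp
  hence M: "M = int (p ^ (m - 1))" using p_pos by simp
  have "of_nat (p ^ (m - 1)) = (0 :: 'a)" using m_ge by (simp add: of_nat_eq_0 dvd_power)
  hence M0: "of_int M = (0 :: 'a)" unfolding M of_int_of_nat_eq .
  have "(\<Sum>u\<in>U. h u ^ k) = (\<Sum>j<p. \<Sum>u\<in>{u\<in>U. idx (h u) = j}. h u ^ k)"
    by (rule sum.group[symmetric]) (use idx h_Fp in auto)
  also have "\<dots> = (\<Sum>j<p. \<Sum>u\<in>{u\<in>U. idx (h u) = j}. of_nat j ^ k)"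
    by (intro sum.cong refl) (use idx h_Fp in auto)
  also have "\<dots> = (\<Sum>j<p. of_int (N j) * of_nat j ^ k)" by (simp add: N_def)
  also have "\<dots> = (\<Sum>j<p. 0)"
  proof (rule sum.cong)
    fix j assume "j \<in> {..<p}"
    thus "of_int (N j) * of_nat j ^ k = (0 :: 'a)" using k M0 by (cases "j = 0") (auto simp: NM)
  qed simp
  finally show ?thesis by simp
qed

end

section \<open>Power moments modulo the characteristic\<close>

lemma signed_digits_zero:
  fixes e :: "nat \<Rightarrow> int"
  assumes "p > 0" "\<And>i. i < m \<Longrightarrow> \<bar>e i\<bar> < p" "(\<Sum>i<m. p ^ i * e i) = 0" "i < m"
  shows "e i = 0"
  using assms(2-4)
proof (induction m arbitrary: e i)
  case (Suc m)
  have s: "(\<Sum>i<Suc m. p ^ i * e i) = e 0 + p * (\<Sum>i<m. p ^ i * e (Suc i))"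
    unfolding sum.lessThan_Suc_shift by (simp add: sum_distrib_left mult.assoc)
  hence "e 0 = p * - (\<Sum>i<m. p ^ i * e (Suc i))" using Suc.prems(2) by simp
  hence "p dvd e 0" by (metis dvd_triv_left)
  moreover have "\<bar>e 0\<bar> < p" using Suc.prems(1)[of 0] by simp
  ultimately have e0: "e 0 = 0" using dvd_imp_le_int[of "e 0" p] by fastforce
  hence "(\<Sum>i<m. p ^ i * e (Suc i)) = 0" using s Suc.prems(2) assms(1) by simp
  hence "e (Suc j) = 0" if "j < m" for j
    using Suc.IH[of "\<lambda>i. e (Suc i)" j] Suc.prems(1) that by auto
  thus ?case using e0 Suc.prems(3) by (cases i) auto
qed simp

lemma abs_sum_digits_le:
  fixes e :: "nat \<Rightarrow> int"
  assumes "p \<ge> 1" shows "\<bar>\<Sum>i<m. p ^ i * e i\<bar> \<le> p ^ (m - 1) * (\<Sum>i<m. \<bar>e i\<bar>)"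
proof -
  have "\<bar>\<Sum>i<m. p ^ i * e i\<bar> \<le> (\<Sum>i<m. \<bar>p ^ i * e i\<bar>)" by (rule sum_abs)
  also have "\<dots> \<le> (\<Sum>i<m. p ^ (m - 1) * \<bar>e i\<bar>)"
  proof (rule sum_mono)
    fix i assume "i \<in> {..<m}"
    hence "p ^ i \<le> p ^ (m - 1)" using assms by (intro power_increasing) auto
    thus "\<bar>p ^ i * e i\<bar> \<le> p ^ (m - 1) * \<bar>e i\<bar>"
      using assms by (simp add: abs_mult mult_right_mono)
  qed
  finally show ?thesis by (simp add: sum_distrib_left)
qed

text \<open>A signed base \<open>p\<close> expansion of \<open>(p ^ m + 1) / 2\<close> has digit sum at least \<open>p - 1\<close>,
  already from its two lowest digits.\<close>

lemma half_digits_large: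
  fixes e :: "nat \<Rightarrow> int" and p :: int
  assumes p: "odd p" "p > 2" and m: "m \<ge> 2" and s: "2 * (\<Sum>i<m. p ^ i * e i) = p ^ m + 1"
  shows "(\<Sum>i<m. \<bar>e i\<bar>) \<ge> p - 1"
proof -
  obtain l where l: "m = Suc (Suc l)" using m by (metis One_nat_def Suc_1 Suc_le_D Suc_le_mono)
  define R where "R = (\<Sum>i<l. p ^ i * e (Suc (Suc i)))"
  have "(\<Sum>i<m. p ^ i * e i) = e 0 + p * e 1 + p ^ 2 * R"
    unfolding l sum.lessThan_Suc_shift by (simp add: R_def sum_distrib_left power2_eq_square mult.assoc)
  hence eq: "2 * (e 0 + p * e 1 + p ^ 2 * R) = p * p * p ^ l + 1"
    using s by (simp add: l mult.assoc)
  \<comment> \<open>Twice the expansion is compared with an odd power of an odd base: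
    \<open>g\<close> is left after the digits from index 2 on are removed, \<open>f\<close> after
    digit 1 as well. Both are odd, hence nonzero, which is what makes the two lowest digits
    large.\<close>
  define g where "g = p ^ l - 2 * R"
  define f where "f = p * g - 2 * e 1"
  have "odd g" using p by (simp add: g_def)
  hence g1: "\<bar>g\<bar> \<ge> 1" by presburger
  have "odd f" using p \<open>odd g\<close> by (simp add: f_def)
  hence f1: "\<bar>f\<bar> \<ge> 1" by presburger
  have e0: "2 * e 0 = p * f + 1" using eq by (simp add: f_def g_def algebra_simps power2_eq_square)
  have e1: "2 * e 1 = p * g - f" by (simp add: f_def)
  have a0: "2 * \<bar>e 0\<bar> \<ge> p * \<bar>f\<bar> - 1"
  proof -
    have "\<bar>p * f\<bar> \<le> \<bar>p * f + 1\<bar> + 1" by simp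
    also have "\<bar>p * f + 1\<bar> = 2 * \<bar>e 0\<bar>" unfolding e0[symmetric] by (simp add: abs_mult)
    finally show ?thesis using p by (simp add: abs_mult)
  qed
  have a1: "2 * \<bar>e 1\<bar> \<ge> p - \<bar>f\<bar>"
  proof -
    have "p * 1 \<le> p * \<bar>g\<bar>" using p g1 by (intro mult_left_mono) auto
    also have "\<dots> = \<bar>p * g\<bar>" using p by (simp add: abs_mult)
    also have "\<dots> \<le> \<bar>p * g - f\<bar> + \<bar>f\<bar>" by simp
    also have "\<bar>p * g - f\<bar> = 2 * \<bar>e 1\<bar>" unfolding e1[symmetric] by (simp add: abs_mult)
    finally show ?thesis by simp
  qed
  have "(p - 1) * 1 \<le> (p - 1) * \<bar>f\<bar>" using p f1 by (intro mult_left_mono) auto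
  hence "p - 1 \<le> \<bar>e 0\<bar> + \<bar>e 1\<bar>" using a0 a1 by (simp add: algebra_simps)
  also have "\<dots> \<le> (\<Sum>i<m. \<bar>e i\<bar>)"
    unfolding l sum.lessThan_Suc_shift by (simp add: sum_nonneg)
  finally show ?thesis .
qed

section \<open>The exponential generating function of the moments\<close>

context bent_setup
begin

lemma fact_nonzero: "k < p \<Longrightarrow> of_nat (fact k) \<noteq> (0 :: 'a)"
  using prime_dvd_fact_iff[OF prime_p] by (simp only: of_nat_eq_0)

text \<open>Factorials are invertible only below \<open>p\<close>, so the exponential is cut off at
  T ^ p. It still turns sums into products modulo T ^ p, which is the relation
  \<open>tcong\<close>.\<close>

definition trunc_exp :: "'a \<Rightarrow> 'a fps" where
  "trunc_exp y = Abs_fps (\<lambda>k. if k < p then y ^ k / of_nat (fact k) else 0)"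

definition tcong :: "'a fps \<Rightarrow> 'a fps \<Rightarrow> bool" where
  "tcong f g \<longleftrightarrow> (\<forall>k<p. fps_nth f k = fps_nth g k)"

lemma tcong_refl [simp]: "tcong f f" by (simp add: tcong_def)

lemma tcong_trans [trans]: "tcong f g \<Longrightarrow> tcong g k \<Longrightarrow> tcong f k" by (simp add: tcong_def)

lemma tcong_mult: "tcong f f' \<Longrightarrow> tcong g g' \<Longrightarrow> tcong (f * g) (f' * g')"
  unfolding tcong_def fps_mult_nth by (auto intro!: sum.cong arg_cong2[where f = "(*)"])

lemma tcong_sum: "(\<And>x. x \<in> S \<Longrightarrow> tcong (f x) (g x)) \<Longrightarrow> tcong (\<Sum>x\<in>S. f x) (\<Sum>x\<in>S. g x)"
  by (simp add: tcong_def fps_sum_nth)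

lemma trunc_exp_add: "tcong (trunc_exp (x + y)) (trunc_exp x * trunc_exp y)"
  unfolding tcong_def
proof (intro allI impI)
  fix k assume k: "k < p"
  have "fps_nth (trunc_exp x * trunc_exp y) k
      = (\<Sum>i\<le>k. x ^ i / of_nat (fact i) * (y ^ (k - i) / of_nat (fact (k - i))))"
    using k by (auto simp: fps_mult_nth trunc_exp_def atMost_atLeast0 intro!: sum.cong)
  also have "\<dots> = (\<Sum>i\<le>k. of_nat (k choose i) * x ^ i * y ^ (k - i) / of_nat (fact k))"
  proof (rule sum.cong)
    fix i assume i: "i \<in> {..k}"
    have "of_nat (fact k) = (of_nat (fact i) * of_nat (fact (k - i)) * of_nat (k choose i) :: 'a)"
      using binomial_fact_lemma[of i k] i by (metis atMost_iff of_nat_mult)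
    thus "x ^ i / of_nat (fact i) * (y ^ (k - i) / of_nat (fact (k - i)))
        = of_nat (k choose i) * x ^ i * y ^ (k - i) / of_nat (fact k)"
      using fact_nonzero[OF k] by (auto simp: field_simps)
  qed simp
  also have "\<dots> = (x + y) ^ k / of_nat (fact k)"
    by (simp add: binomial_ring sum_divide_distrib)
  finally show "fps_nth (trunc_exp (x + y)) k = fps_nth (trunc_exp x * trunc_exp y) k"
    using k by (simp add: trunc_exp_def)
qed

lemma trunc_exp_0: "trunc_exp 0 = 1"
  using p_pos by (intro fps_ext) (simp add: trunc_exp_def power_0_left)

lemma trunc_exp_sum: "finite S \<Longrightarrow> tcong (trunc_exp (\<Sum>i\<in>S. y i)) (\<Prod>i\<in>S. trunc_exp (y i))"
proof (induction S rule: finite_induct)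
  case (insert x S)
  have "tcong (trunc_exp (y x + (\<Sum>i\<in>S. y i))) (trunc_exp (y x) * trunc_exp (\<Sum>i\<in>S. y i))"
    by (rule trunc_exp_add)
  also have "tcong \<dots> (trunc_exp (y x) * (\<Prod>i\<in>S. trunc_exp (y i)))"
    by (intro tcong_mult insert.IH tcong_refl)
  finally show ?case using insert by simp
qed (simp add: trunc_exp_0)

lemma trunc_exp_expand: "trunc_exp y = (\<Sum>c<p. fps_const (y ^ c / of_nat (fact c)) * fps_X ^ c)"
  by (intro fps_ext) (simp add: trunc_exp_def fps_sum_nth fps_X_power_nth if_distrib[of "\<lambda>x. _ * x"] cong: if_cong)

text \<open>Orthogonality without a generator of \<open>U\<close>: if the power \<open>N\<close> is
  trivial on \<open>U\<close>, so is its gcd with \<open>q + 1\<close>, and counting roots makes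
  that gcd \<open>q + 1\<close>. The value 1 is \<open>q + 1\<close> in characteristic
  \<open>p\<close>.\<close>

lemma sum_U_power: "(\<Sum>u\<in>U. u ^ N) = (if q + 1 dvd N then 1 else 0)"
proof (cases "q + 1 dvd N")
  case True
  then obtain k where k: "N = (q + 1) * k" by blast
  have "(\<Sum>u\<in>U. u ^ N) = (\<Sum>u\<in>U. 1)"
    by (rule sum.cong) (simp_all only: k power_mult U_def mem_Collect_eq power_one)
  also have "\<dots> = of_nat (q + 1)" by (simp add: card_U)
  also have "of_nat q = (0 :: 'a)" using m_pos by (simp add: of_nat_eq_0 q_def dvd_power)
  hence "of_nat (q + 1) = (1 :: 'a)" by simp
  finally show ?thesis using True by simp
next
  case False
  have "\<exists>v\<in>U. v ^ N \<noteq> 1"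
  proof (rule ccontr)
    assume "\<not> ?thesis"
    hence all: "v ^ N = 1" if "v \<in> U" for v using that by blast
    define g where "g = gcd N (q + 1)"
    have "N \<noteq> 0" using False by (metis dvd_0_right)
    then obtain x y where xy: "N * x = (q + 1) * y + g" using bezout_nat[of N "q + 1"] by (auto simp: g_def)
    have "v ^ g = 1" if "v \<in> U" for v
    proof -
      have "(v ^ N) ^ x = (v ^ (q + 1)) ^ y * v ^ g" by (metis power_add power_mult xy)
      thus ?thesis using all[OF that] that unfolding U_def mem_Collect_eq by (simp only: power_one mult_1)
    qed
    hence "U \<subseteq> {v. v ^ g = 1}" by blast
    moreover have g0: "g > 0" by (simp add: g_def)
    ultimately have "card U \<le> g"
      using card_mono[OF card_power_eq_le(1)[OF g0]] card_power_eq_le(2)[OF g0, of "1 :: 'a"] le_trans by blast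
    hence "q + 1 \<le> g" by (simp add: card_U)
    moreover have "g dvd q + 1" "g dvd N" unfolding g_def by simp_all
    ultimately have "g = q + 1" using dvd_imp_le[of g "q + 1"] by simp
    thus False using \<open>g dvd N\<close> False by simp
  qed
  then obtain v where v: "v \<in> U" "v ^ N \<noteq> 1" by blast
  have v0: "v \<noteq> 0" by (rule U_nonzero[OF v(1)])
  have vU: "v * u \<in> U" "u / v \<in> U" if "u \<in> U" for u
    using v(1) that unfolding U_def mem_Collect_eq power_mult_distrib power_divide by simp_all
  have "(\<Sum>u\<in>U. u ^ N) = (\<Sum>u\<in>U. (v * u) ^ N)"
    by (rule sum.reindex_bij_witness[of _ "\<lambda>u. v * u" "\<lambda>u. u / v"])
       (use v0 vU in auto)
  also have "\<dots> = v ^ N * (\<Sum>u\<in>U. u ^ N)" by (simp add: power_mult_distrib sum_distrib_left)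
  finally have "(1 - v ^ N) * (\<Sum>u\<in>U. u ^ N) = 0" by (simp add: algebra_simps)
  thus ?thesis using v False by simp
qed

abbreviation dig :: "(nat \<times> nat) set" where "dig \<equiv> {..<p} \<times> {..<p}"

text \<open>\<open>f\<close> chooses one term from each exponential of a conjugate of
  \<open>a * u\<close>: the pair \<open>f i\<close> holds the exponents at the conjugates
  \<open>i\<close> and \<open>i + m\<close>. Then \<open>expo f\<close> is the exponent of
  \<open>u\<close>, and \<open>wt f\<close> below that of T. Since \<open>u ^ q\<close> is the
  inverse of \<open>u\<close>, only the signed digits \<open>sdig\<close> matter modulo
  \<open>q + 1\<close>.\<close>

definition expo :: "(nat \<Rightarrow> nat \<times> nat) \<Rightarrow> nat" where
  "expo f = (\<Sum>i<m. p ^ i * (fst (f i) + q * snd (f i)))"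

definition wt :: "(nat \<Rightarrow> nat \<times> nat) \<Rightarrow> nat" where
  "wt f = (\<Sum>i<m. fst (f i) + snd (f i))"

definition sdig :: "(nat \<Rightarrow> nat \<times> nat) \<Rightarrow> nat \<Rightarrow> int" where
  "sdig f i = int (fst (f i)) - int (snd (f i))"

lemma expo_cong: "int (q + 1) dvd int (expo f) - (\<Sum>i<m. int p ^ i * sdig f i)"
proof -
  have "int (expo f) - (\<Sum>i<m. int p ^ i * sdig f i) = (\<Sum>i<m. int (q + 1) * (int p ^ i * int (snd (f i))))"
    by (simp add: expo_def sdig_def algebra_simps flip: sum_subtractf sum.distrib)
  also have "\<dots> = int (q + 1) * (\<Sum>i<m. int p ^ i * int (snd (f i)))" by (simp only: sum_distrib_left)
  finally show ?thesis by simp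
qed

lemma sdig_sum_le: "(\<Sum>i<m. \<bar>sdig f i\<bar>) \<le> int (wt f)"
  unfolding wt_def sdig_def of_nat_sum by (rule sum_mono) auto

lemma sdig_value_le: "wt f \<le> w \<Longrightarrow> \<bar>\<Sum>i<m. int p ^ i * sdig f i\<bar> \<le> int p ^ (m - 1) * int w"
proof -
  assume "wt f \<le> w"
  hence w: "(\<Sum>i<m. \<bar>sdig f i\<bar>) \<le> int w" using sdig_sum_le[of f] by linarith
  have "\<bar>\<Sum>i<m. int p ^ i * sdig f i\<bar> \<le> int p ^ (m - 1) * (\<Sum>i<m. \<bar>sdig f i\<bar>)"
    by (rule abs_sum_digits_le) (use p_pos in simp)
  also have "\<dots> \<le> int p ^ (m - 1) * int w" by (rule mult_left_mono[OF w]) simp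
  finally show ?thesis .
qed

lemma q_split: "int q = int p ^ (m - 1) * int p"
  unfolding q_def using m_pos by (cases m) simp_all

text \<open>With weight below \<open>p\<close> the signed value is smaller than \<open>q + 1\<close>
  in absolute value, so divisibility makes it 0, and signed digits below \<open>p\<close> represent
  0 only trivially.\<close>

lemma dvd_expo_iff:
  assumes w: "wt f < p" shows "q + 1 dvd expo f \<longleftrightarrow> (\<forall>i<m. fst (f i) = snd (f i))"
proof
  assume "q + 1 dvd expo f"
  hence "int (q + 1) dvd int (expo f)" by (simp only: int_dvd_int_iff)
  hence "int (q + 1) dvd int (expo f) - (int (expo f) - (\<Sum>i<m. int p ^ i * sdig f i))"
    by (intro dvd_diff expo_cong)
  hence d: "int (q + 1) dvd (\<Sum>i<m. int p ^ i * sdig f i)" by (simp only: diff_diff_eq2 add_diff_cancel_left')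
  have "\<bar>\<Sum>i<m. int p ^ i * sdig f i\<bar> \<le> int p ^ (m - 1) * int (p - 1)"
    using w by (intro sdig_value_le) simp
  also have "\<dots> \<le> int p ^ (m - 1) * int p" by (intro mult_left_mono) auto
  finally have "\<bar>\<Sum>i<m. int p ^ i * sdig f i\<bar> < int (q + 1)" using q_split by simp
  hence small: "\<not> \<bar>int (q + 1)\<bar> \<le> \<bar>\<Sum>i<m. int p ^ i * sdig f i\<bar>" by simp
  have "(\<Sum>i<m. int p ^ i * sdig f i) = 0"
    using dvd_imp_le_int[OF _ d] small by blast
  moreover have "\<bar>sdig f i\<bar> < int p" if "i < m" for i
  proof -
    have "\<bar>sdig f i\<bar> \<le> (\<Sum>i<m. \<bar>sdig f i\<bar>)" using that by (intro member_le_sum) auto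
    thus ?thesis using sdig_sum_le[of f] w by linarith
  qed
  ultimately have "sdig f i = 0" if "i < m" for i
    using signed_digits_zero[of "int p" m "sdig f" i] that p_pos by simp
  thus "\<forall>i<m. fst (f i) = snd (f i)" by (simp add: sdig_def)
next
  assume "\<forall>i<m. fst (f i) = snd (f i)"
  hence "expo f = (q + 1) * (\<Sum>i<m. p ^ i * snd (f i))"
    by (simp add: expo_def sum_distrib_left algebra_simps flip: sum.distrib)
  thus "q + 1 dvd expo f" by (rule dvdI)
qed

text \<open>Divisibility would force the signed value to be (q + 1) / 2 or its negative, and by
  \<open>half_digits_large\<close> that costs a digit sum of at least \<open>p - 1\<close>.\<close>

lemma not_dvd_expo_half:
  assumes w: "wt f \<le> p - 2" shows "\<not> q + 1 dvd expo f + (q + 1) div 2"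
proof
  assume "q + 1 dvd expo f + (q + 1) div 2"
  hence d1: "int (q + 1) dvd int (expo f + (q + 1) div 2)" by (simp only: int_dvd_int_iff)
  define s where "s = (\<Sum>i<m. int p ^ i * sdig f i)"
  have "2 * ((q + 1) div 2) = q + 1" by (rule dvd_mult_div_cancel) (use odd_q in simp)
  hence hq: "2 * int ((q + 1) div 2) = int (q + 1)" by (metis of_nat_mult of_nat_numeral)
  have "int (q + 1) dvd int (expo f + (q + 1) div 2) - (int (expo f) - s)"
    unfolding s_def by (intro dvd_diff d1 expo_cong)
  hence "int (q + 1) dvd s + int ((q + 1) div 2)" by (simp add: algebra_simps)
  then obtain k where k: "s + int ((q + 1) div 2) = int (q + 1) * k" by blast
  hence k2: "2 * s = int (q + 1) * (2 * k - 1)" using hq by (simp add: algebra_simps)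
  have "\<bar>s\<bar> \<le> int p ^ (m - 1) * int (p - 2)"
    unfolding s_def by (rule sdig_value_le[OF w])
  also have "\<dots> \<le> int p ^ (m - 1) * int p" by (intro mult_left_mono) auto
  finally have "\<bar>2 * s\<bar> < 2 * int (q + 1)" using q_split by simp
  moreover have "\<bar>2 * s\<bar> = int (q + 1) * \<bar>2 * k - 1\<bar>" unfolding k2 abs_mult by simp
  ultimately have "int (q + 1) * \<bar>2 * k - 1\<bar> < int (q + 1) * 2" by (simp only: mult.commute)
  hence "\<bar>2 * k - 1\<bar> < 2" by (rule mult_left_less_imp_less) simp
  hence "2 * k - 1 = 1 \<or> 2 * k - 1 = - 1" by presburger
  hence "\<exists>e :: nat \<Rightarrow> int. 2 * (\<Sum>i<m. int p ^ i * e i) = int p ^ m + 1 \<and> (\<Sum>i<m. \<bar>e i\<bar>) = (\<Sum>i<m. \<bar>sdig f i\<bar>)"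
  proof
    assume "2 * k - 1 = 1"
    thus ?thesis using k2 by (intro exI[of _ "sdig f"]) (simp add: s_def q_def)
  next
    assume "2 * k - 1 = - 1"
    thus ?thesis using k2 by (intro exI[of _ "\<lambda>i. - sdig f i"]) (simp add: s_def q_def sum_negf)
  qed
  then obtain e :: "nat \<Rightarrow> int" where e: "2 * (\<Sum>i<m. int p ^ i * e i) = int p ^ m + 1"
    "(\<Sum>i<m. \<bar>e i\<bar>) = (\<Sum>i<m. \<bar>sdig f i\<bar>)" by blast
  have "int p - 1 \<le> (\<Sum>i<m. \<bar>e i\<bar>)"
    by (rule half_digits_large[OF _ _ _ e(1)]) (use odd_p p_odd m_ge in auto)
  also have "\<dots> \<le> int (p - 2)" using e(2) sdig_sum_le[of f] w by simp
  finally show False using p_odd by simp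
qed

definition kap :: "nat \<Rightarrow> nat \<times> nat \<Rightarrow> 'a" where
  "kap i x = (a ^ p ^ i) ^ fst x / of_nat (fact (fst x)) * ((a ^ p ^ (i + m)) ^ snd x / of_nat (fact (snd x)))"

definition Kap :: "(nat \<Rightarrow> nat \<times> nat) \<Rightarrow> 'a" where "Kap f = (\<Prod>i<m. kap i (f i))"

lemma trunc_exp_pair:
  "trunc_exp (a ^ p ^ i * u ^ p ^ i) * trunc_exp (a ^ p ^ (i + m) * u ^ p ^ (i + m))
    = (\<Sum>x\<in>dig. fps_const (kap i x * u ^ (p ^ i * (fst x + q * snd x))) * fps_X ^ (fst x + snd x))"
proof -
  have e: "u ^ (p ^ i * c) * u ^ (p ^ (i + m) * d) = u ^ (p ^ i * (c + q * d))" for c d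
    by (simp add: q_def power_add algebra_simps)
  have "trunc_exp (a ^ p ^ i * u ^ p ^ i) * trunc_exp (a ^ p ^ (i + m) * u ^ p ^ (i + m))
      = (\<Sum>c<p. \<Sum>d<p. fps_const (((a ^ p ^ i * u ^ p ^ i) ^ c / of_nat (fact c)) * ((a ^ p ^ (i + m) * u ^ p ^ (i + m)) ^ d / of_nat (fact d)))
          * fps_X ^ (c + d))"
    unfolding trunc_exp_expand sum_product
    by (intro sum.cong refl) (simp add: power_add mult_ac flip: fps_const_mult)
  also have "\<dots> = (\<Sum>c<p. \<Sum>d<p. fps_const (kap i (c,d) * u ^ (p ^ i * (c + q * d))) * fps_X ^ (c + d))"
  proof -
    have key: "(a ^ p ^ i * u ^ p ^ i) ^ c / of_nat (fact c) * ((a ^ p ^ (i + m) * u ^ p ^ (i + m)) ^ d / of_nat (fact d))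
        = kap i (c, d) * u ^ (p ^ i * (c + q * d))" for c d
    proof -
      have "(u ^ p ^ i) ^ c * (u ^ p ^ (i + m)) ^ d = u ^ (p ^ i * (c + q * d))"
      unfolding power_mult[symmetric] by (rule e)
    moreover have "\<alpha> * \<mu> / x * (\<beta> * \<nu> / y) = \<alpha> / x * (\<beta> / y) * (\<mu> * \<nu>)" for \<alpha> \<beta> \<mu> \<nu> x y :: 'a
      by simp
    ultimately show ?thesis
      unfolding kap_def fst_conv snd_conv power_mult_distrib by metis
    qed
    show ?thesis by (simp only: key)
  qed
  also have "\<dots> = (\<Sum>x\<in>dig. fps_const (kap i x * u ^ (p ^ i * (fst x + q * snd x))) * fps_X ^ (fst x + snd x))"
    by (simp add: sum.cartesian_product case_prod_unfold)
  finally show ?thesis .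
qed

lemma prod_fps_const: "(\<Prod>i\<in>S. fps_const (c i) :: 'a fps) = fps_const (\<Prod>i\<in>S. c i)"
  by (induction S rule: infinite_finite_induct) auto

definition Fun :: "(nat \<Rightarrow> nat \<times> nat) set" where "Fun = {..<m} \<rightarrow>\<^sub>E dig"

abbreviation gsum :: "((nat \<Rightarrow> nat \<times> nat) \<Rightarrow> 'a) \<Rightarrow> 'a fps" where
  "gsum g \<equiv> (\<Sum>f\<in>Fun. fps_const (Kap f * g f) * fps_X ^ wt f)"

abbreviation diag_sum :: "'a fps" where
  "diag_sum \<equiv> (\<Sum>f\<in>{f\<in>Fun. \<forall>i<m. fst (f i) = snd (f i)}. fps_const (Kap f) * fps_X ^ wt f)"

lemma finite_Fun: "finite Fun" unfolding Fun_def by (intro finite_PiE) auto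

lemma trunc_exp_tr:
  "tcong (trunc_exp (tr p (2 * m) (a * u))) (gsum (\<lambda>f. u ^ expo f))"
proof -
  have "tr p (2 * m) (a * u) = (\<Sum>i<m. a ^ p ^ i * u ^ p ^ i + a ^ p ^ (i + m) * u ^ p ^ (i + m))"
  proof -
    have "tr p (2 * m) (a * u) = tr p m (a * u) + tr p m ((a * u) ^ p ^ m)"
      unfolding mult_2 tr_double tr_add ..
    also have "tr p m ((a * u) ^ p ^ m) = (\<Sum>i<m. a ^ p ^ (i + m) * u ^ p ^ (i + m))"
      by (simp add: tr_def power_mult_distrib power_add mult.commute flip: power_mult)
    finally show ?thesis by (simp add: tr_def power_mult_distrib sum.distrib)
  qed
  hence "tcong (trunc_exp (tr p (2 * m) (a * u))) (\<Prod>i<m. trunc_exp (a ^ p ^ i * u ^ p ^ i + a ^ p ^ (i + m) * u ^ p ^ (i + m)))"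
    using trunc_exp_sum[of "{..<m}"] by simp
  also have "tcong \<dots> (\<Prod>i<m. trunc_exp (a ^ p ^ i * u ^ p ^ i) * trunc_exp (a ^ p ^ (i + m) * u ^ p ^ (i + m)))"
  proof -
    have prod: "tcong (\<Prod>i\<in>S. F i) (\<Prod>i\<in>S. G i)" if "\<And>i. tcong (F i) (G i)" for F G and S :: "nat set"
      by (induction S rule: infinite_finite_induct) (auto intro: tcong_mult that)
    show ?thesis by (rule prod) (rule trunc_exp_add)
  qed
  also have "(\<Prod>i<m. trunc_exp (a ^ p ^ i * u ^ p ^ i) * trunc_exp (a ^ p ^ (i + m) * u ^ p ^ (i + m)))
      = (\<Sum>f\<in>Fun. \<Prod>i<m. fps_const (kap i (f i) * u ^ (p ^ i * (fst (f i) + q * snd (f i)))) * fps_X ^ (fst (f i) + snd (f i)))"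
    unfolding trunc_exp_pair Fun_def by (rule prod_sum_PiE) auto
  also have "\<dots> = (gsum (\<lambda>f. u ^ expo f))"
    by (intro sum.cong refl)
       (simp add: prod.distrib prod_fps_const Kap_def expo_def wt_def power_sum)
  finally show ?thesis .
qed

text \<open>The truncated hyperbolic cosine of b T, and below it the sine. The quadratic character
  is 1 or - 1 on \<open>U\<close>, so it multiplies the odd part only.\<close>

definition ch :: "'a fps" where "ch = Abs_fps (\<lambda>k. if even k then fps_nth (trunc_exp b) k else 0)"
definition sh :: "'a fps" where "sh = Abs_fps (\<lambda>k. if odd k then fps_nth (trunc_exp b) k else 0)"

lemma trunc_exp_eta:
  assumes "e = 1 \<or> e = - 1" shows "trunc_exp (b * e) = ch + fps_const e * sh"
  using assms by (intro fps_ext) (auto simp: ch_def sh_def trunc_exp_def power_mult_distrib)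

lemma generating_identity:
  assumes one: "(\<Sum>u\<in>U. zp (h u)) = 1"
  shows "tcong 1 (ch * diag_sum)"
proof -
  let ?e = "(q + 1) div 2"
  have "tcong 1 (\<Sum>u\<in>U. trunc_exp (h u))"
    unfolding tcong_def
  proof (intro allI impI)
    fix k assume k: "k < p"
    have "fps_nth (\<Sum>u\<in>U. trunc_exp (h u)) k = (\<Sum>u\<in>U. h u ^ k) / of_nat (fact k)"
      using k by (simp add: fps_sum_nth trunc_exp_def sum_divide_distrib)
    moreover have "(\<Sum>u\<in>U. h u ^ 0) = 1" using sum_U_power[of 0] by simp
    ultimately show "fps_nth 1 k = fps_nth (\<Sum>u\<in>U. trunc_exp (h u)) k"
      using moments[OF one, of k] by (cases "k = 0") auto
  qed
  also have "tcong \<dots> (\<Sum>u\<in>U. (ch + fps_const (u ^ ?e) * sh) * (gsum (\<lambda>f. u ^ expo f)))"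
  proof (rule tcong_sum)
    fix u assume u: "u \<in> U"
    have "tcong (trunc_exp (h u)) (trunc_exp (b * u ^ ?e) * trunc_exp (tr p (2 * m) (a * u)))"
      unfolding h_def using trunc_exp_add[of "b * u ^ ?e" "tr p (2 * m) (a * u)"] by (simp only: add.commute)
    also have "tcong \<dots> ((ch + fps_const (u ^ ?e) * sh) * (gsum (\<lambda>f. u ^ expo f)))"
      unfolding trunc_exp_eta[OF eta_cases[OF u]] by (intro tcong_mult tcong_refl trunc_exp_tr)
    finally show "tcong (trunc_exp (h u)) \<dots>" .
  qed
  also have "(\<Sum>u\<in>U. (ch + fps_const (u ^ ?e) * sh) * (gsum (\<lambda>f. u ^ expo f)))
     = ch * (gsum (\<lambda>f. \<Sum>u\<in>U. u ^ expo f))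
     + sh * (gsum (\<lambda>f. \<Sum>u\<in>U. u ^ (expo f + ?e)))"
  proof -
    have sc: "(\<Sum>u\<in>U. fps_const (c * g u)) = fps_const (c * (\<Sum>u\<in>U. g u))" for c :: 'a and g
      by (intro fps_ext) (simp add: fps_sum_nth sum_distrib_left)
    have "(\<Sum>u\<in>U. (ch + fps_const (u ^ ?e) * sh) * (gsum (\<lambda>f. u ^ expo f)))
       = (\<Sum>u\<in>U. \<Sum>f\<in>Fun. ch * (fps_const (Kap f * u ^ expo f) * fps_X ^ wt f))
       + (\<Sum>u\<in>U. \<Sum>f\<in>Fun. sh * (fps_const (Kap f * u ^ (expo f + ?e)) * fps_X ^ wt f))"
      unfolding sum.distrib[symmetric] sum_distrib_left
      by (intro sum.cong refl) (simp add: power_add algebra_simps flip: fps_const_mult)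
    also have "(\<Sum>u\<in>U. \<Sum>f\<in>Fun. ch * (fps_const (Kap f * u ^ expo f) * fps_X ^ wt f))
        = ch * (gsum (\<lambda>f. \<Sum>u\<in>U. u ^ expo f))"
      by (subst sum.swap) (simp only: sc flip: sum_distrib_left sum_distrib_right)
    also have "(\<Sum>u\<in>U. \<Sum>f\<in>Fun. sh * (fps_const (Kap f * u ^ (expo f + ?e)) * fps_X ^ wt f))
        = sh * (gsum (\<lambda>f. \<Sum>u\<in>U. u ^ (expo f + ?e)))"
      by (subst sum.swap) (simp only: sc flip: sum_distrib_left sum_distrib_right)
    finally show ?thesis .
  qed
  also have "tcong \<dots> (ch * diag_sum + 0)"
  proof -
    have nthX: "fps_nth (\<Sum>f\<in>S. fps_const (g f) * fps_X ^ wt f) k = (\<Sum>f\<in>S. if wt f = k then g f else 0)"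
      for S k and g :: "_ \<Rightarrow> 'a"
      by (auto simp: fps_sum_nth fps_X_power_nth intro!: sum.cong)
    \<comment> \<open>The half-shifted exponents are excluded up to weight \<open>p - 2\<close>
      only. This suffices below degree \<open>p\<close>, because \<open>sh\<close> has no constant
      term.\<close>
    have G1: "fps_nth (gsum (\<lambda>f. \<Sum>u\<in>U. u ^ (expo f + ?e))) k = 0" if "k \<le> p - 2" for k
      unfolding nthX using that not_dvd_expo_half by (intro sum.neutral) (auto simp: sum_U_power)
    have "fps_nth (sh * (gsum (\<lambda>f. \<Sum>u\<in>U. u ^ (expo f + ?e)))) k = 0" if "k < p" for k
      unfolding fps_mult_nth
    proof (intro sum.neutral ballI)
      fix i assume "i \<in> {0..k}"
      show "fps_nth sh i * fps_nth (gsum (\<lambda>f. \<Sum>u\<in>U. u ^ (expo f + ?e))) (k - i) = 0"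
      proof (cases "i = 0")
        case False
        hence "k - i \<le> p - 2" using that by simp
        thus ?thesis by (simp only: G1 mult_zero_right)
      qed (simp add: sh_def)
    qed
    hence t1: "tcong (sh * (gsum (\<lambda>f. \<Sum>u\<in>U. u ^ (expo f + ?e)))) 0"
      by (simp add: tcong_def)
    have "tcong (gsum (\<lambda>f. \<Sum>u\<in>U. u ^ expo f))
       diag_sum"
      unfolding tcong_def nthX
    proof (intro allI impI)
      fix k assume k: "k < p"
      have "(\<Sum>f\<in>Fun. if wt f = k then Kap f * (\<Sum>u\<in>U. u ^ expo f) else 0)
          = (\<Sum>f\<in>Fun. if \<forall>i<m. fst (f i) = snd (f i) then if wt f = k then Kap f else 0 else 0)"
        by (rule sum.cong) (use k dvd_expo_iff in \<open>auto simp: sum_U_power\<close>)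
      also have "\<dots> = (\<Sum>f\<in>{f\<in>Fun. \<forall>i<m. fst (f i) = snd (f i)}. if wt f = k then Kap f else 0)"
        using finite_Fun by (simp add: sum.inter_filter)
      finally show "(\<Sum>f\<in>Fun. if wt f = k then Kap f * (\<Sum>u\<in>U. u ^ expo f) else 0) = \<dots>" .
    qed
    from tcong_mult[OF tcong_refl this, of ch] t1 show ?thesis
      by (simp add: tcong_def)
  qed
  finally show ?thesis by simp
qed

text \<open>The truncated series of the modified Bessel function I_0 at 2 * sqrt y * T. It collects
  the choices with equal exponents at the conjugates \<open>i\<close> and
  \<open>i + m\<close>.\<close>

definition bess :: "'a \<Rightarrow> 'a fps" where
  "bess y = (\<Sum>c<p. fps_const (y ^ c / (of_nat (fact c) * of_nat (fact c))) * fps_X ^ (2 * c))"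

lemma diagonal_sum:
  "diag_sum
    = (\<Prod>i<m. bess ((a ^ (q + 1)) ^ p ^ i))"
proof -
  let ?D = "(\<lambda>c. (c, c)) ` {..<p}"
  have "{f\<in>Fun. \<forall>i<m. fst (f i) = snd (f i)} = {..<m} \<rightarrow>\<^sub>E ?D"
    by (auto simp: Fun_def PiE_def Pi_def image_iff) (metis lessThan_iff mem_Times_iff prod.collapse)+
  moreover have "fps_const (Kap f) * fps_X ^ wt f = (\<Prod>i<m. fps_const (kap i (f i)) * fps_X ^ (fst (f i) + snd (f i)))" for f
    by (simp add: prod.distrib prod_fps_const Kap_def wt_def power_sum)
  ultimately have "diag_sum
      = (\<Sum>f\<in>{..<m} \<rightarrow>\<^sub>E ?D. \<Prod>i<m. fps_const (kap i (f i)) * fps_X ^ (fst (f i) + snd (f i)))"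
    by simp
  also have "\<dots> = (\<Prod>i<m. \<Sum>x\<in>?D. fps_const (kap i x) * fps_X ^ (fst x + snd x))"
    by (rule prod_sum_PiE[symmetric]) auto
  also have "\<dots> = (\<Prod>i<m. bess ((a ^ (q + 1)) ^ p ^ i))"
  proof (rule prod.cong)
    fix i
    have k: "kap i (c, c) = ((a ^ (q + 1)) ^ p ^ i) ^ c / (of_nat (fact c) * of_nat (fact c))" for c
    proof -
      have "(a ^ p ^ i) ^ c * (a ^ p ^ (i + m)) ^ c = ((a ^ (q + 1)) ^ p ^ i) ^ c"
        by (simp add: q_def power_add power_mult_distrib algebra_simps flip: power_mult)
      thus ?thesis by (simp add: kap_def)
    qed
    show "(\<Sum>x\<in>?D. fps_const (kap i x) * fps_X ^ (fst x + snd x)) = bess ((a ^ (q + 1)) ^ p ^ i)"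
      unfolding bess_def by (subst sum.reindex) (auto simp: inj_on_def k mult_2)
  qed simp
  finally show ?thesis .
qed

end

section \<open>Logarithmic derivatives and Hankel determinants\<close>

definition fps_log_deriv :: "'a::field fps \<Rightarrow> 'a fps" where
  "fps_log_deriv f = fps_deriv f * inverse f"

lemma fps_log_deriv_mult:
  assumes "fps_nth f 0 \<noteq> 0" "fps_nth g 0 \<noteq> 0"
  shows "fps_log_deriv (f * g) = fps_log_deriv f + fps_log_deriv (g :: 'a::field fps)"
proof -
  have "fps_log_deriv (f * g) = (f * inverse f) * (fps_deriv g * inverse g) + (g * inverse g) * (fps_deriv f * inverse f)"
    by (simp add: fps_log_deriv_def fps_inverse_mult algebra_simps)
  moreover have "f * inverse f = 1" "g * inverse g = 1"
    using assms by (simp_all add: inverse_mult_eq_1')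
  ultimately show ?thesis by (simp add: fps_log_deriv_def)
qed

lemma fps_log_deriv_power:
  assumes "fps_nth f 0 = 1"
  shows "fps_log_deriv (f ^ n) = of_nat n * fps_log_deriv (f :: 'a::field fps)"
proof (induction n)
  case (Suc n)
  have "fps_nth (f ^ n) 0 = 1" using assms by (simp add: fps_nth_power_0)
  thus ?case using assms Suc by (simp add: fps_log_deriv_mult algebra_simps)
qed (simp add: fps_log_deriv_def)

lemma fps_log_deriv_nth:
  assumes "fps_nth f 0 \<noteq> 0"
  shows "of_nat (Suc k) * fps_nth f (Suc k) = (\<Sum>i\<le>k. fps_nth f i * fps_nth (fps_log_deriv (f :: 'a::field fps)) (k - i))"
proof -
  have "fps_deriv f = f * fps_log_deriv f"
    using assms by (simp add: fps_log_deriv_def inverse_mult_eq_1' mult.left_commute[of f])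
  hence "fps_nth (fps_deriv f) k = fps_nth (f * fps_log_deriv f) k" by simp
  thus ?thesis by (simp add: fps_mult_nth atMost_atLeast0)
qed

lemma log_deriv_recursion:
  fixes F L :: "nat \<Rightarrow> 'a::field"
  assumes rec: "\<And>k. of_nat (Suc k) * F (Suc k) = (\<Sum>i\<le>k. F i * L (k - i))"
    and F0: "F 0 = 1" and odd: "\<forall>k. odd k \<longrightarrow> F k = 0"
  shows "L 1 = 2 * F 2" "L 3 = 4 * F 4 - F 2 * L 1" "L 5 = 6 * F 6 - F 2 * L 3 - F 4 * L 1"
    "L 7 = 8 * F 8 - F 2 * L 5 - F 4 * L 3 - F 6 * L 1"
    "L 9 = 10 * F 10 - F 2 * L 7 - F 4 * L 5 - F 6 * L 3 - F 8 * L 1"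
    "L 11 = 12 * F 12 - F 2 * L 9 - F 4 * L 7 - F 6 * L 5 - F 8 * L 3 - F 10 * L 1"
proof -
  have o: "F 1 = 0" "F 3 = 0" "F 5 = 0" "F 7 = 0" "F 9 = 0" "F 11 = 0" by (simp_all add: odd)
  show "L 1 = 2 * F 2" "L 3 = 4 * F 4 - F 2 * L 1" "L 5 = 6 * F 6 - F 2 * L 3 - F 4 * L 1"
    "L 7 = 8 * F 8 - F 2 * L 5 - F 4 * L 3 - F 6 * L 1"
    "L 9 = 10 * F 10 - F 2 * L 7 - F 4 * L 5 - F 6 * L 3 - F 8 * L 1"
    "L 11 = 12 * F 12 - F 2 * L 9 - F 4 * L 7 - F 6 * L 5 - F 8 * L 3 - F 10 * L 1"
    using rec[of 1] rec[of 3] rec[of 5] rec[of 7] rec[of 9] rec[of 11] o F0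
    by (simp_all add: numeral_eq_Suc algebra_simps)
qed

context bent_setup
begin

definition A where "A = a ^ (q + 1)"

lemma A_power: "A ^ (p ^ 2) = A \<Longrightarrow> A ^ p ^ (2 * l) = A"
proof (induction l)
  case (Suc l)
  have "p ^ (2 * Suc l) = p ^ 2 * p ^ (2 * l)" by (simp flip: power_add)
  thus ?case using Suc by (metis power_mult)
qed simp

lemma prod_bess:
  assumes A: "A ^ (p ^ 2) = A"
  shows "(\<Prod>i<2 * l. bess (A ^ p ^ i)) = (bess A * bess (A ^ p)) ^ l"
proof -
  show ?thesis
  proof (induction l)
    case (Suc l)
    have "A ^ p ^ Suc (2 * l) = A ^ p" using A_power[OF A, of l] by (metis power_Suc mult.commute power_mult)
    thus ?case using Suc A_power[OF A, of l] by (simp add: mult_ac)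
  qed simp
qed

lemma ch_identity:
  assumes one: "(\<Sum>u\<in>U. zp (h u)) = 1" and A: "A ^ (p ^ 2) = A"
  shows "tcong 1 (ch * (bess A * bess (A ^ p)) ^ (m div 2))"
proof -
  have "m = 2 * (m div 2)" using even_m by simp
  hence "(\<Prod>i<m. bess (A ^ p ^ i)) = (bess A * bess (A ^ p)) ^ (m div 2)"
    using prod_bess[OF A, of "m div 2"] by simp
  thus ?thesis using generating_identity[OF one] unfolding diagonal_sum A_def[symmetric] by simp
qed

lemma bess_nth: "fps_nth (bess y) k = (if even k \<and> k div 2 < p then y ^ (k div 2) / (of_nat (fact (k div 2)) * of_nat (fact (k div 2))) else 0)"
proof -
  have "fps_nth (bess y) k = (\<Sum>c<p. if c = k div 2 \<and> even k then y ^ c / (of_nat (fact c) * of_nat (fact c)) else 0)"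
    unfolding bess_def by (auto simp: fps_sum_nth fps_X_power_nth intro!: sum.cong)
  also have "\<dots> = (\<Sum>c<p. if c = k div 2 then (if even k then y ^ c / (of_nat (fact c) * of_nat (fact c)) else 0) else 0)"
    by (intro sum.cong) auto
  finally show ?thesis by (simp add: sum.delta)
qed

lemma ch_nth: "fps_nth ch k = (if even k \<and> k < p then b ^ k / of_nat (fact k) else 0)"
  by (simp add: ch_def trunc_exp_def)

text \<open>A product that is 1 modulo T ^ p has a derivative vanishing modulo T ^ (p - 1). The
  largest index used later is 11, whence \<open>p \<ge> 13\<close>.\<close>

lemma log_deriv_sum:
  assumes one: "(\<Sum>u\<in>U. zp (h u)) = 1" and A: "A ^ (p ^ 2) = A" and k: "k < p - 1"
  shows "fps_nth (fps_log_deriv ch) k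
    + of_nat (m div 2) * (fps_nth (fps_log_deriv (bess A)) k + fps_nth (fps_log_deriv (bess (A ^ p))) k) = 0"
proof -
  let ?G = "ch * (bess A * bess (A ^ p)) ^ (m div 2)"
  have c0: "fps_nth ch 0 = 1" using p_pos by (simp add: ch_nth)
  have b0: "fps_nth (bess y) 0 = 1" for y using p_pos by (simp add: bess_nth)
  have b0': "fps_nth (bess A * bess (A ^ p)) 0 = 1" by (simp add: b0)
  have ld: "fps_log_deriv ?G = fps_log_deriv ch + of_nat (m div 2) * (fps_log_deriv (bess A) + fps_log_deriv (bess (A ^ p)))"
    using c0 b0 b0' by (simp add: fps_log_deriv_mult fps_log_deriv_power fps_nth_power_0)
  have "fps_nth (fps_deriv ?G) i = 0" if "i < p - 1" for i
  proof -
    have "fps_nth ?G (Suc i) = fps_nth 1 (Suc i)"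
      using ch_identity[OF one A] that unfolding tcong_def by (metis Suc_less_eq Suc_pred' p_pos)
    hence G0: "fps_nth ?G (Suc i) = 0" by simp
    show ?thesis by (simp only: fps_deriv_nth Suc_eq_plus1[symmetric] G0 mult_zero_right)
  qed
  hence "fps_nth (fps_log_deriv ?G) k = 0"
    using k unfolding fps_log_deriv_def fps_mult_nth by (intro sum.neutral) auto
  thus ?thesis unfolding ld by (simp add: fps_mult_of_nat_nth)
qed

section \<open>Explicit coefficients and their consequences\<close>

lemma numeral_nonzero: "\<not> p dvd numeral n \<Longrightarrow> (numeral n :: 'a) \<noteq> 0"
  using of_nat_eq_0[of "numeral n"] by simp

lemma smooth_numeral_nonzero:
  assumes "(numeral w :: nat) dvd 4303886290232220964100505600000000" shows "(numeral w :: 'a) \<noteq> 0"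
proof (rule numeral_nonzero)
  have small: "\<not> p dvd r" if "0 < r" "r < 13" for r using that p_ge by (auto dest: dvd_imp_le)
  have pw: "\<not> p dvd r ^ k" if "0 < r" "r < 13" for r k
    using prime_dvd_power[OF prime_p] small[OF that] by blast
  have "\<not> p dvd 2 ^ 24 * (3 ^ 12 * (5 ^ 8 * (7 ^ 8 * 11 ^ 8)))"
    unfolding prime_dvd_mult_iff[OF prime_p]
    using pw[of 2 24] pw[of 3 12] pw[of 5 8] pw[of 7 8] pw[of 11 8] by simp
  hence "\<not> p dvd 4303886290232220964100505600000000" by simp
  thus "\<not> p dvd numeral w" using assms dvd_trans by blast
qed

lemma fact_values: "fact 3 = (6 :: nat)" "fact 4 = (24 :: nat)" "fact 5 = (120 :: nat)" "fact 6 = (720 :: nat)" "fact 8 = (40320 :: nat)"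
  "fact 10 = (3628800 :: nat)" "fact 12 = (479001600 :: nat)"
  by (simp_all add: fact_numeral)

text \<open>The unit \<open>d\<close> will be 4620 = 2 ^ 2 * 3 * 5 * 7 * 11. In terms of b ^ 2 /
  4620 the coefficients up to degree 12 become integers, so later identities involve numerals
  only.\<close>

lemma ch_nth_scaled:
  assumes "b ^ 2 = d * \<gamma>" "k = 2 * j" "k < p" "d ^ j = c * of_nat (fact k)"
  shows "fps_nth ch k = c * \<gamma> ^ j"
proof -
  have "fps_nth ch k = (b ^ 2) ^ j / of_nat (fact k)"
    using assms(2,3) by (simp add: ch_nth power_mult)
  thus ?thesis
    unfolding assms(1) power_mult_distrib assms(4) using fact_nonzero[OF assms(3)] by simp
qed

lemma bess_nth_scaled:
  assumes "y = d * w" "k = 2 * j" "j < p" "d ^ j = c * (of_nat (fact j) * of_nat (fact j))"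
  shows "fps_nth (bess y) k = c * w ^ j"
proof -
  have "fps_nth (bess y) k = y ^ j / (of_nat (fact j) * of_nat (fact j))"
    using assms(2,3) by (simp add: bess_nth)
  thus ?thesis
    unfolding assms(1) power_mult_distrib assms(4) using fact_nonzero[OF assms(3)] by simp
qed

text \<open>Since cosh (b T) has the logarithmic derivative b * tanh (b T), these are, up to powers
  of 4620, the tanh coefficients 1, - 1/3, 2/15, - 17/315, 62/2835, - 1382/155925.\<close>

lemma log_deriv_ch:
  assumes "b ^ 2 = 4620 * \<gamma>"
  defines "L \<equiv> fps_nth (fps_log_deriv ch)"
  shows "L 1 = 4620 * \<gamma>"
    "L 3 = - (7114800 * \<gamma> ^ 2)"
    "L 5 = 13148150400 * \<gamma> ^ 3"
    "L 7 = - (24587041248000 * \<gamma> ^ 4)"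
    "L 9 = 46030798007040000 * \<gamma> ^ 5"
    "L 11 = - (86187472242600960000 * \<gamma> ^ 6)"
proof -
  have c0: "fps_nth ch 0 = 1" using p_pos by (simp add: ch_nth)
  have F2: "fps_nth ch 2 = 2310 * \<gamma>"
    using ch_nth_scaled[OF assms(1), of 2 1 2310] p_ge by (simp add: fact_values)
  have F4: "fps_nth ch 4 = 889350 * \<gamma> ^ 2"
    using ch_nth_scaled[OF assms(1), of 4 2 889350] p_ge by (simp add: fact_values)
  have F6: "fps_nth ch 6 = 136959900 * \<gamma> ^ 3"
    using ch_nth_scaled[OF assms(1), of 6 3 136959900] p_ge by (simp add: fact_values)
  have F8: "fps_nth ch 8 = 11299191750 * \<gamma> ^ 4"
    using ch_nth_scaled[OF assms(1), of 8 4 11299191750] p_ge by (simp add: fact_values)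
  have F10: "fps_nth ch 10 = 580025176500 * \<gamma> ^ 5"
    using ch_nth_scaled[OF assms(1), of 10 5 580025176500] p_ge by (simp add: fact_values)
  have F12: "fps_nth ch 12 = 20300881177500 * \<gamma> ^ 6"
    using ch_nth_scaled[OF assms(1), of 12 6 20300881177500] p_ge by (simp add: fact_values)
  have rec: "of_nat (Suc k) * fps_nth ch (Suc k) = (\<Sum>i\<le>k. fps_nth ch i * L (k - i))" for k
    unfolding L_def by (rule fps_log_deriv_nth) (simp add: c0)
  have odd0: "\<forall>k. odd k \<longrightarrow> fps_nth ch k = 0" by (simp add: ch_nth)
  note R = log_deriv_recursion[of "fps_nth ch" L, OF rec c0 odd0]
  show v1: "L 1 = 4620 * \<gamma>"
    unfolding R(1) F2  by (simp add: power_numeral_reduce algebra_simps)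
  show v3: "L 3 = - (7114800 * \<gamma> ^ 2)"
    unfolding R(2) F2 F4 v1 by (simp add: power_numeral_reduce algebra_simps)
  show v5: "L 5 = 13148150400 * \<gamma> ^ 3"
    unfolding R(3) F2 F4 F6 v1 v3 by (simp add: power_numeral_reduce algebra_simps)
  show v7: "L 7 = - (24587041248000 * \<gamma> ^ 4)"
    unfolding R(4) F2 F4 F6 F8 v1 v3 v5 by (simp add: power_numeral_reduce algebra_simps)
  show v9: "L 9 = 46030798007040000 * \<gamma> ^ 5"
    unfolding R(5) F2 F4 F6 F8 F10 v1 v3 v5 v7 by (simp add: power_numeral_reduce algebra_simps)
  show v11: "L 11 = - (86187472242600960000 * \<gamma> ^ 6)"
    unfolding R(6) F2 F4 F6 F8 F10 F12 v1 v3 v5 v7 v9 by (simp add: power_numeral_reduce algebra_simps)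
qed

text \<open>As multiples of powers of \<open>y\<close> the values are 2, - 1, 2/3, - 11/24, 19/60, -
  473/2160, from the logarithmic derivative of the Bessel series.\<close>

lemma log_deriv_bess:
  assumes "y = 4620 * w"
  defines "L \<equiv> fps_nth (fps_log_deriv (bess y))"
  shows "L 1 = 9240 * w"
    "L 3 = - (21344400 * w ^ 2)"
    "L 5 = 65740752000 * w ^ 3"
    "L 7 = - (208809063540000 * w ^ 4)"
    "L 9 = 666518530819680000 * w ^ 5"
    "L 11 = - (2129409772893295200000 * w ^ 6)"
proof -
  have c0: "fps_nth (bess y) 0 = 1" using p_pos by (simp add: bess_nth)
  have F2: "fps_nth (bess y) 2 = 4620 * w"
    using bess_nth_scaled[OF assms(1), of 2 1 4620] p_ge by (simp add: fact_values)
  have F4: "fps_nth (bess y) 4 = 5336100 * w ^ 2"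
    using bess_nth_scaled[OF assms(1), of 4 2 5336100] p_ge by (simp add: fact_values)
  have F6: "fps_nth (bess y) 6 = 2739198000 * w ^ 3"
    using bess_nth_scaled[OF assms(1), of 6 3 2739198000] p_ge by (simp add: fact_values)
  have F8: "fps_nth (bess y) 8 = 790943422500 * w ^ 4"
    using bess_nth_scaled[OF assms(1), of 8 4 790943422500] p_ge by (simp add: fact_values)
  have F10: "fps_nth (bess y) 10 = 146166344478000 * w ^ 5"
    using bess_nth_scaled[OF assms(1), of 10 5 146166344478000] p_ge by (simp add: fact_values)
  have F12: "fps_nth (bess y) 12 = 18758014208010000 * w ^ 6"
    using bess_nth_scaled[OF assms(1), of 12 6 18758014208010000] p_ge by (simp add: fact_values)
  have rec: "of_nat (Suc k) * fps_nth (bess y) (Suc k) = (\<Sum>i\<le>k. fps_nth (bess y) i * L (k - i))" for k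
    unfolding L_def by (rule fps_log_deriv_nth) (simp add: c0)
  have odd0: "\<forall>k. odd k \<longrightarrow> fps_nth (bess y) k = 0" by (simp add: bess_nth)
  note R = log_deriv_recursion[of "fps_nth (bess y)" L, OF rec c0 odd0]
  show v1: "L 1 = 9240 * w"
    unfolding R(1) F2  by (simp add: power_numeral_reduce algebra_simps)
  show v3: "L 3 = - (21344400 * w ^ 2)"
    unfolding R(2) F2 F4 v1 by (simp add: power_numeral_reduce algebra_simps)
  show v5: "L 5 = 65740752000 * w ^ 3"
    unfolding R(3) F2 F4 F6 v1 v3 by (simp add: power_numeral_reduce algebra_simps)
  show v7: "L 7 = - (208809063540000 * w ^ 4)"
    unfolding R(4) F2 F4 F6 F8 v1 v3 v5 by (simp add: power_numeral_reduce algebra_simps)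
  show v9: "L 9 = 666518530819680000 * w ^ 5"
    unfolding R(5) F2 F4 F6 F8 F10 v1 v3 v5 v7 by (simp add: power_numeral_reduce algebra_simps)
  show v11: "L 11 = - (2129409772893295200000 * w ^ 6)"
    unfolding R(6) F2 F4 F6 F8 F10 F12 v1 v3 v5 v7 v9 by (simp add: power_numeral_reduce algebra_simps)
qed

text \<open>The power sums \<open>s k = l * (x ^ k + y ^ k)\<close> satisfy a linear recurrence of order two, so their
  Hankel determinants vanish; for the values forced by the logarithmic derivatives the first
  determinant is \<open>347\<close> times a unit and the second one \<open>2 ^ 5 * 3271\<close> times a unit.\<close>

lemma hankel_contradiction:
  fixes s :: "nat \<Rightarrow> 'a" and l x y \<gamma> :: 'a
  assumes s: "\<And>k. s k = l * (x ^ k + y ^ k)"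
    and e1: "2 * s 1 = - (\<gamma>)"
    and e2: "3 * s 2 = - (\<gamma> ^ 2)"
    and e3: "5 * s 3 = - (\<gamma> ^ 3)"
    and e4: "1155 * s 4 = - (136 * \<gamma> ^ 4)"
    and e5: "3591 * s 5 = - (248 * \<gamma> ^ 5)"
    and e6: "546315 * s 6 = - (22112 * \<gamma> ^ 6)"
  shows "\<gamma> = 0"
proof -
  have rec: "s (k + 2) = (x + y) * s (k + 1) - (x * y) * s k" for k
    by (simp add: s algebra_simps)
  have r3: "s 3 = (x + y) * s 2 - (x * y) * s 1" and r4: "s 4 = (x + y) * s 3 - (x * y) * s 2"
    and r5: "s 5 = (x + y) * s 4 - (x * y) * s 3" and r6: "s 6 = (x + y) * s 5 - (x * y) * s 4"
    using rec[of 1] rec[of 2] rec[of 3] rec[of 4] by (simp_all add: numeral_eq_Suc)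
  \<comment> \<open>The Hankel determinant with rows (s 1, s 2, s 3), (s 2, s 3, s 4), (s 3, s 4, s
    5); \<open>det2\<close> is the one starting at \<open>s 2\<close>. The multiplier in front of
    each clears denominators, so that every product can be grouped into left sides of
    \<open>e1\<close> to \<open>e6\<close>.\<close>
  have det1: "s 1 * s 3 * s 5 - s 2 * s 2 * s 5 - s 1 * s 4 * s 4 + 2 * (s 2 * s 3 * s 4) - s 3 * s 3 * s 3 = 0"
    using r3 r4 r5 by algebra
  have "6843548250 * (s 1 * s 3 * s 5 - s 2 * s 2 * s 5 - s 1 * s 4 * s 4 + 2 * (s 2 * s 3 * s 4) - s 3 * s 3 * s 3)
      = 190575 * ((2 * s 1) * (5 * s 3) * (3591 * s 5)) - 211750 * ((3 * s 2) * (3 * s 2) * (3591 * s 5)) - 2565 * ((2 * s 1) * (1155 * s 4) * (1155 * s 4)) + 790020 * ((3 * s 2) * (5 * s 3) * (1155 * s 4)) - 54748386 * ((5 * s 3) * (5 * s 3) * (5 * s 3))"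
    by (simp add: algebra_simps)
  hence g1: "694 * \<gamma> ^ 9 = 0"
    unfolding det1 e1 e2 e3 e4 e5 e6 by (simp add: power_numeral_reduce algebra_simps)
  have det2: "s 2 * s 4 * s 6 - s 3 * s 3 * s 6 - s 2 * s 5 * s 5 + 2 * (s 3 * s 4 * s 5) - s 4 * s 4 * s 4 = 0"
    using r4 r5 r6 by algebra
  have "1937343495866625 * (s 2 * s 4 * s 6 - s 3 * s 3 * s 6 - s 2 * s 5 * s 5 + 2 * (s 3 * s 4 * s 5) - s 4 * s 4 * s 4)
      = 1023435 * ((3 * s 2) * (1155 * s 4) * (546315 * s 6)) - 141848091 * ((5 * s 3) * (5 * s 3) * (546315 * s 6)) - 50078875 * ((3 * s 2) * (3591 * s 5) * (3591 * s 5)) + 186839730 * ((5 * s 3) * (1155 * s 4) * (3591 * s 5)) - 1257363 * ((1155 * s 4) * (1155 * s 4) * (1155 * s 4))"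
    by (simp add: algebra_simps)
  hence g2: "523360 * \<gamma> ^ 12 = 0"
    unfolding det2 e1 e2 e3 e4 e5 e6 by (simp add: power_numeral_reduce algebra_simps)
  \<comment> \<open>694 is 2 * 347, so the first determinant decides all cases but
    \<open>p = 347\<close>, and 347 does not divide 523360.\<close>
  show ?thesis
  proof (cases "p = 347")
    case False
    have "prime (347 :: nat)" by simp
    hence "\<not> p dvd 347" using False prime_p primes_dvd_imp_eq by blast
    hence "(347 :: 'a) \<noteq> 0" by (rule numeral_nonzero)
    moreover have "(2 :: 'a) \<noteq> 0" by (rule smooth_numeral_nonzero) simp
    ultimately have "347 * (2 :: 'a) \<noteq> 0" by (simp only: mult_eq_0_iff) blast
    hence "(694 :: 'a) \<noteq> 0" by simp
    thus ?thesis using g1 by simp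
  next
    case True
    have "(523360 :: 'a) \<noteq> 0" by (rule numeral_nonzero) (simp add: True)
    thus ?thesis using g2 by simp
  qed
qed

theorem b_zero_and_p_dvd:
  assumes one: "(\<Sum>u\<in>U. zp (h u)) = 1" and A: "A ^ (p ^ 2) = A"
  shows "b = 0" "a \<noteq> 0" "p dvd m div 2"
proof -
  have D: "(4620 :: 'a) \<noteq> 0" by (rule smooth_numeral_nonzero) simp
  define \<gamma> where "\<gamma> = b ^ 2 / 4620"
  define w where "w = A / 4620"
  define w' where "w' = A ^ p / 4620"
  have scale: "b ^ 2 = 4620 * \<gamma>" "A = 4620 * w" "A ^ p = 4620 * w'"
    using D by (simp_all add: \<gamma>_def w_def w'_def)
  note ld = log_deriv_ch[OF scale(1)] log_deriv_bess[OF scale(2)] log_deriv_bess[OF scale(3)]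
  define s where "s k = of_nat (m div 2) * (w ^ k + w' ^ k)" for k
  have e: "fps_nth (fps_log_deriv ch) k + of_nat (m div 2) * (fps_nth (fps_log_deriv (bess A)) k + fps_nth (fps_log_deriv (bess (A ^ p))) k) = 0"
    if "k \<le> 11" for k using log_deriv_sum[OF one A, of k] that p_ge by simp
  have e1: "2 * s 1 = - (\<gamma>)"
  proof -
    have "4620 * (\<gamma> + 2 * s 1) = 0"
      using e[of 1] unfolding ld by (simp add: s_def algebra_simps neg_eq_iff_add_eq_0)
    moreover have "(4620 :: 'a) \<noteq> 0" by (rule smooth_numeral_nonzero) simp
    ultimately have "\<gamma> + 2 * s 1 = 0" by (simp only: mult_eq_0_iff) blast
    thus ?thesis by (simp only: eq_neg_iff_add_eq_0 add.commute)
  qed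
  have e2: "3 * s 2 = - (\<gamma> ^ 2)"
  proof -
    have "7114800 * (\<gamma> ^ 2 + 3 * s 2) = 0"
      using e[of 3] unfolding ld by (simp add: s_def algebra_simps neg_eq_iff_add_eq_0)
    moreover have "(7114800 :: 'a) \<noteq> 0" by (rule smooth_numeral_nonzero) simp
    ultimately have "\<gamma> ^ 2 + 3 * s 2 = 0" by (simp only: mult_eq_0_iff) blast
    thus ?thesis by (simp only: eq_neg_iff_add_eq_0 add.commute)
  qed
  have e3: "5 * s 3 = - (\<gamma> ^ 3)"
  proof -
    have "13148150400 * (\<gamma> ^ 3 + 5 * s 3) = 0"
      using e[of 5] unfolding ld by (simp add: s_def algebra_simps neg_eq_iff_add_eq_0)
    moreover have "(13148150400 :: 'a) \<noteq> 0" by (rule smooth_numeral_nonzero) simp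
    ultimately have "\<gamma> ^ 3 + 5 * s 3 = 0" by (simp only: mult_eq_0_iff) blast
    thus ?thesis by (simp only: eq_neg_iff_add_eq_0 add.commute)
  qed
  \<comment> \<open>The coefficients 17/315 and 11/24 are brought to the common denominator 2520,
    which gives 136 and 1155; \<open>e5\<close> and \<open>e6\<close> arise in the same way.\<close>
  have e4: "1155 * s 4 = - (136 * \<gamma> ^ 4)"
  proof -
    have "180787068000 * (136 * \<gamma> ^ 4 + 1155 * s 4) = 0"
      using e[of 7] unfolding ld by (simp add: s_def algebra_simps neg_eq_iff_add_eq_0)
    moreover have "(180787068000 :: 'a) \<noteq> 0" by (rule smooth_numeral_nonzero) simp
    ultimately have "136 * \<gamma> ^ 4 + 1155 * s 4 = 0" by (simp only: mult_eq_0_iff) blast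
    thus ?thesis by (simp only: eq_neg_iff_add_eq_0 add.commute)
  qed
  have e5: "3591 * s 5 = - (248 * \<gamma> ^ 5)"
  proof -
    have "185608056480000 * (248 * \<gamma> ^ 5 + 3591 * s 5) = 0"
      using e[of 9] unfolding ld by (simp add: s_def algebra_simps neg_eq_iff_add_eq_0)
    moreover have "(185608056480000 :: 'a) \<noteq> 0" by (rule smooth_numeral_nonzero) simp
    ultimately have "248 * \<gamma> ^ 5 + 3591 * s 5 = 0" by (simp only: mult_eq_0_iff) blast
    thus ?thesis by (simp only: eq_neg_iff_add_eq_0 add.commute)
  qed
  have e6: "546315 * s 6 = - (22112 * \<gamma> ^ 6)"
  proof -
    have "3897769186080000 * (22112 * \<gamma> ^ 6 + 546315 * s 6) = 0"
      using e[of 11] unfolding ld by (simp add: s_def algebra_simps neg_eq_iff_add_eq_0)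
    moreover have "(3897769186080000 :: 'a) \<noteq> 0" by (rule smooth_numeral_nonzero) simp
    ultimately have "22112 * \<gamma> ^ 6 + 546315 * s 6 = 0" by (simp only: mult_eq_0_iff) blast
    thus ?thesis by (simp only: eq_neg_iff_add_eq_0 add.commute)
  qed
  have \<gamma>0: "\<gamma> = 0" by (rule hankel_contradiction[OF s_def e1 e2 e3 e4 e5 e6])
  thus b0: "b = 0" using scale(1) by simp
  show a0: "a \<noteq> 0"
  proof
    assume "a = 0"
    have "h u = 0" for u
    proof -
      have "h u = tr p (2 * m) (a * u) + b * u ^ ((q + 1) div 2)" by (rule h_def)
      also have "\<dots> = 0" using \<open>a = 0\<close> b0 by simp
      finally show ?thesis .
    qed
    hence "of_nat (q + 1) = (1 :: complex)" using one by (simp add: card_U)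
    thus False using q_gt by simp
  qed
  show "p dvd m div 2"
  proof (rule ccontr)
    assume "\<not> p dvd m div 2"
    hence l: "of_nat (m div 2) \<noteq> (0 :: 'a)" by (simp add: of_nat_eq_0)
    have two: "(2 :: 'a) \<noteq> 0" "(3 :: 'a) \<noteq> 0" by (rule smooth_numeral_nonzero; simp)+
    \<comment> \<open>With \<gamma> = 0 and \<open>m div 2\<close> invertible, the first two power
      sums of \<open>w\<close> and \<open>w'\<close> vanish, which forces
      \<open>w = 0\<close>.\<close>
    have "w' = - w" using e1 l two by (simp add: \<gamma>0 s_def eq_neg_iff_add_eq_0 add.commute)
    moreover have "w ^ 2 + w' ^ 2 = 0" using e2 l two by (simp add: \<gamma>0 s_def)
    ultimately have "2 * w ^ 2 = 0" by simp
    hence "A = 0" using two scale(2) by simp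
    thus False using a0 by (simp add: A_def)
  qed
qed

end

section \<open>The case of extension degree divisible by the characteristic\<close>

text \<open>A type cannot depend on \<open>p\<close> and \<open>m\<close>, so the exponent is
  recovered from the cardinality: for p ^ (2 * m) elements the multiplicity is 2 * m, and dividing
  it by 2 * p gives m div p.\<close>

definition frob_exp :: "'a::{field,finite} itself \<Rightarrow> nat" where
  "frob_exp _ = CHAR('a) ^ (multiplicity CHAR('a) (card (UNIV :: 'a set)) div (2 * CHAR('a)))"

text \<open>A polynomial ring over a subfield needs a type for that subfield. For a field with
  \<open>p ^ (2 * m)\<close> elements and \<open>p\<close> dividing \<open>m\<close> this is the subfield with \<open>p ^ (m div p)\<close> elements.\<close>

typedef (overloaded) ('a::"{field,finite}") frob_sub = "{x :: 'a. x ^ frob_exp TYPE('a) = x}"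
  morphisms of_frob_sub Abs_frob_sub
  by (rule exI[of _ 1]) simp

lemma frob_exp_add: "(x + y :: 'a) ^ frob_exp TYPE('a) = x ^ frob_exp TYPE('a) + y ^ frob_exp TYPE('a::{field,finite})"
proof -
  have "CHAR('a) > 0" by (rule finite_imp_CHAR_pos) simp
  hence "prime CHAR('a)" by (rule prime_CHAR_semidom)
  thus ?thesis unfolding frob_exp_def by (rule freshmans_dream') (rule refl)
qed

lemma frob_exp_pos: "frob_exp TYPE('a::{field,finite}) > 0"
proof -
  have "CHAR('a) > 0" by (rule finite_imp_CHAR_pos) simp
  thus ?thesis by (simp add: frob_exp_def)
qed

lemma frob_exp_uminus: "(- x :: 'a) ^ frob_exp TYPE('a) = - (x ^ frob_exp TYPE('a::{field,finite}))"
  using frob_exp_add[of x "- x"] frob_exp_pos[where ?'a = 'a]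
  by (simp add: eq_neg_iff_add_eq_0 add.commute power_0_left)

lemma frob_exp_diff: "(x - y :: 'a) ^ frob_exp TYPE('a) = x ^ frob_exp TYPE('a) - y ^ frob_exp TYPE('a::{field,finite})"
  using frob_exp_add[of x "- y"] by (simp add: frob_exp_uminus)

setup_lifting type_definition_frob_sub

instantiation frob_sub :: ("{field,finite}") field
begin

lift_definition zero_frob_sub :: "'a frob_sub" is 0 using frob_exp_pos by (simp add: power_0_left)
lift_definition one_frob_sub :: "'a frob_sub" is 1 by simp
lift_definition plus_frob_sub :: "'a frob_sub \<Rightarrow> 'a frob_sub \<Rightarrow> 'a frob_sub" is "(+)" by (simp add: frob_exp_add)
lift_definition minus_frob_sub :: "'a frob_sub \<Rightarrow> 'a frob_sub \<Rightarrow> 'a frob_sub" is "(-)" by (simp add: frob_exp_diff)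
lift_definition uminus_frob_sub :: "'a frob_sub \<Rightarrow> 'a frob_sub" is uminus by (simp add: frob_exp_uminus)
lift_definition times_frob_sub :: "'a frob_sub \<Rightarrow> 'a frob_sub \<Rightarrow> 'a frob_sub" is "(*)" by (simp add: power_mult_distrib)
lift_definition inverse_frob_sub :: "'a frob_sub \<Rightarrow> 'a frob_sub" is inverse by (simp add: power_inverse)
lift_definition divide_frob_sub :: "'a frob_sub \<Rightarrow> 'a frob_sub \<Rightarrow> 'a frob_sub" is "(/)" by (simp add: power_divide)

instance by standard (transfer; simp add: field_simps)+

end

instance frob_sub :: ("{field,finite}") finite
proof
  have "inj (of_frob_sub :: 'a frob_sub \<Rightarrow> 'a)" by (rule injI) (simp add: of_frob_sub_inject)
  thus "finite (UNIV :: 'a frob_sub set)" by (rule finite_imageD[OF finite])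
qed

text \<open>The factorisation of polynomials used for L-series needs coefficients in
  \<open>field_gcd\<close>, hence the trivial Euclidean structure of a field on the new
  type.\<close>

instantiation frob_sub :: ("{field,finite}")
  "{unique_euclidean_ring, normalization_euclidean_semiring, normalization_semidom_multiplicative}"
begin

definition [simp]: "normalize_frob_sub = (normalize_field :: 'a frob_sub \<Rightarrow> _)"
definition [simp]: "unit_factor_frob_sub = (unit_factor_field :: 'a frob_sub \<Rightarrow> _)"
definition [simp]: "modulo_frob_sub = (mod_field :: 'a frob_sub \<Rightarrow> _)"
definition [simp]: "euclidean_size_frob_sub = (euclidean_size_field :: 'a frob_sub \<Rightarrow> _)"
definition [simp]: "division_segment (x :: 'a frob_sub) = 1"

instance by standard (simp_all add: dvd_field_iff field_split_simps split: if_splits)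

end

instantiation frob_sub :: ("{field,finite}") euclidean_ring_gcd
begin

definition "gcd_frob_sub = (Euclidean_Algorithm.gcd :: 'a frob_sub \<Rightarrow> _)"
definition "lcm_frob_sub = (Euclidean_Algorithm.lcm :: 'a frob_sub \<Rightarrow> _)"
definition "Gcd_frob_sub = (Euclidean_Algorithm.Gcd :: 'a frob_sub set \<Rightarrow> _)"
definition "Lcm_frob_sub = (Euclidean_Algorithm.Lcm :: 'a frob_sub set \<Rightarrow> _)"

instance by standard (simp_all add: gcd_frob_sub_def lcm_frob_sub_def Gcd_frob_sub_def Lcm_frob_sub_def)

end

instance frob_sub :: ("{field,finite}") field_gcd ..

context bent_setup
begin

text \<open>Every \<open>c\<close> in the subfield with \<open>q\<close> elements is hit exactly twice by \<open>z + A / z\<close> when \<open>z\<close> ranges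
  over the nonzero elements of that subfield and over the elements of norm \<open>A\<close> together.\<close>

lemma kloosterman_sum:
  assumes one: "(\<Sum>u\<in>U. zp (h u)) = 1" and A2: "A ^ (p ^ 2) = A" and b0: "b = 0" and a0: "a \<noteq> 0"
  shows "A \<in> Fq" "(\<Sum>x\<in>Fq - {0}. zp (tr p m (x + A / x))) = - 1"
proof -
  have Aq: "A ^ q = A" using A_power[OF A2, of "m div 2"] even_m by (simp add: q_def)
  thus AF: "A \<in> Fq" by (simp add: Fq_iff)
  have A0: "A \<noteq> 0" using a0 by (simp add: A_def)
  define W where "W = {v. v ^ (q + 1) = A}"
  have W0: "v \<noteq> 0" if "v \<in> W" for v using that A0 by (auto simp: W_def)
  have aU: "(\<lambda>u. a * u) ` U = W"
  proof (intro equalityI subsetI)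
    fix v assume "v \<in> (\<lambda>u. a * u) ` U"
    thus "v \<in> W" by (auto simp only: U_def W_def A_def mem_Collect_eq power_mult_distrib mult_1_right image_iff)
  next
    fix v assume "v \<in> W"
    hence "(v / a) ^ (q + 1) = A / A" by (simp only: W_def mem_Collect_eq power_divide A_def[symmetric])
    hence "(v / a) ^ (q + 1) = 1" unfolding divide_self[OF A0] .
    hence "v / a \<in> U" by (simp only: U_def mem_Collect_eq)
    thus "v \<in> (\<lambda>u. a * u) ` U" using a0 by (intro image_eqI[of _ _ "v / a"]) auto
  qed
  have inj: "inj_on (\<lambda>u. a * u) U" using a0 by (auto simp: inj_on_def)
  have cardW: "card W = q + 1" unfolding aU[symmetric] using inj card_U by (simp add: card_image)
  have Wq: "v ^ q = A / v" if "v \<in> W" for v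
  proof -
    have "v ^ q * v = A" using that by (simp add: W_def mult.commute)
    thus ?thesis using W0[OF that] by (simp add: eq_divide_eq)
  qed
  define g where "g z = z + A / z" for z :: 'a
  have "(\<Sum>u\<in>U. zp (h u)) = (\<Sum>u\<in>U. zp (tr p (2 * m) (a * u)))"
  proof (rule sum.cong)
    fix u
    have "h u = tr p (2 * m) (a * u) + b * u ^ ((q + 1) div 2)" by (rule h_def)
    thus "zp (h u) = zp (tr p (2 * m) (a * u))" using b0 by simp
  qed simp
  also have "\<dots> = (\<Sum>v\<in>W. zp (tr p (2 * m) v))"
    unfolding aU[symmetric] using inj by (simp add: sum.reindex)
  also have "\<dots> = (\<Sum>v\<in>W. zp (tr p m (g v)))"
    by (intro sum.cong refl) (simp only: g_def Wq[symmetric] mult_2 tr_double q_def)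
  finally have sW: "(\<Sum>v\<in>W. zp (tr p m (g v))) = 1" using one by simp
  have gF: "g x \<in> Fq" if "x \<in> Fq" for x
    using that AF unfolding g_def Fq_def by (intro Fsub_add Fsub_divide)
  have gW: "g v \<in> Fq" if "v \<in> W" for v
  proof -
    have "(A / v) ^ q = v" using Wq[OF that] W0[OF that] A0 Aq by (simp add: power_divide)
    moreover have "(v + A / v) ^ q = v ^ q + (A / v) ^ q" unfolding q_def by (rule frob_add)
    ultimately show ?thesis using Wq[OF that] by (simp add: g_def Fq_iff add.commute)
  qed
  define n1 where "n1 c = card {x \<in> Fq - {0}. g x = c}" for c
  define n2 where "n2 c = card {v \<in> W. g v = c}" for c
  have le: "n1 c + n2 c \<le> 2" for c
  proof -
    let ?R = "{z. poly [:A, - c, 1:] z = 0}"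
    have root: "z \<in> ?R" if "z \<noteq> 0" "g z = c" for z
      using that by (auto simp: g_def algebra_simps)
    have fR: "finite ?R" by (rule finite)
    have cR: "card ?R \<le> 2" using card_poly_roots_bound[of "[:A, - c, 1:]"] by simp
    have sub: "{x \<in> Fq - {0}. g x = c} \<union> {v \<in> W. g v = c} \<subseteq> ?R" using root W0 by blast
    show ?thesis
    proof (cases "{x \<in> Fq - {0}. g x = c} \<inter> {v \<in> W. g v = c} = {}")
      case True
      hence "n1 c + n2 c = card ({x \<in> Fq - {0}. g x = c} \<union> {v \<in> W. g v = c})"
        unfolding n1_def n2_def by (intro card_Un_disjoint[symmetric]) auto
      also have "\<dots> \<le> card ?R" by (rule card_mono[OF fR sub])
      finally show ?thesis using cR by simp
    next
      case False
      \<comment> \<open>A common point satisfies \<open>z * z = A\<close> and is a double root of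
        the quadratic, so each of the two sets contains nothing else.\<close>
      then obtain z where z: "z \<in> Fq" "z \<in> W" "g z = c" by blast
      have z0: "z \<noteq> 0" using W0 z by blast
      have zA: "z * z = A" using z by (simp add: Fq_iff W_def)
      have c: "c = 2 * z" using z(3) z0 by (simp add: g_def zA[symmetric])
      have "?R \<subseteq> {z}"
      proof
        fix w assume "w \<in> ?R"
        hence "(w - z) * (w - z) = 0" by (simp add: c zA[symmetric] algebra_simps)
        thus "w \<in> {z}" by simp
      qed
      hence "n1 c \<le> card {z}" "n2 c \<le> card {z}"
        unfolding n1_def n2_def using sub by (intro card_mono; auto)+
      thus ?thesis by simp
    qed
  qed
  have s1: "(\<Sum>c\<in>Fq. of_nat (n1 c) * \<phi> c) = (\<Sum>x\<in>Fq - {0}. \<phi> (g x))" for \<phi> :: "'a \<Rightarrow> 'c :: semiring_1"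
  proof -
    have "(\<Sum>x\<in>Fq - {0}. \<phi> (g x)) = (\<Sum>c\<in>Fq. \<Sum>x\<in>{x \<in> Fq - {0}. g x = c}. \<phi> (g x))"
      by (rule sum.group[symmetric]) (use gF in auto)
    also have "\<dots> = (\<Sum>c\<in>Fq. \<Sum>x\<in>{x \<in> Fq - {0}. g x = c}. \<phi> c)" by (intro sum.cong refl) auto
    finally show ?thesis by (simp add: n1_def)
  qed
  have s2: "(\<Sum>c\<in>Fq. of_nat (n2 c) * \<phi> c) = (\<Sum>x\<in>W. \<phi> (g x))" for \<phi> :: "'a \<Rightarrow> 'c :: semiring_1"
  proof -
    have "(\<Sum>x\<in>W. \<phi> (g x)) = (\<Sum>c\<in>Fq. \<Sum>x\<in>{x \<in> W. g x = c}. \<phi> (g x))"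
      by (rule sum.group[symmetric]) (use gW in auto)
    also have "\<dots> = (\<Sum>c\<in>Fq. \<Sum>x\<in>{x \<in> W. g x = c}. \<phi> c)" by (intro sum.cong refl) auto
    finally show ?thesis by (simp add: n2_def)
  qed
  \<comment> \<open>The two sets have 2 * q elements in total over \<open>q\<close> values, each
    value being hit at most twice, so each is hit exactly twice.\<close>
  have "(\<Sum>c\<in>Fq. n1 c + n2 c) = (q - 1) + (q + 1)"
    using s1[of "\<lambda>_. 1 :: nat"] s2[of "\<lambda>_. 1 :: nat"] cardW card_Fq
    by (simp add: sum.distrib card_Diff_singleton Fq_def)
  also have "\<dots> = (\<Sum>c\<in>Fq. 2)" using card_Fq q_gt by simp
  finally have eq2: "n1 c + n2 c = 2" if "c \<in> Fq" for c
    using le that by (rule sum_mono_inv) auto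
  have "(\<Sum>x\<in>Fq - {0}. zp (tr p m (g x))) + (\<Sum>v\<in>W. zp (tr p m (g v)))
      = (\<Sum>c\<in>Fq. of_nat (n1 c + n2 c) * zp (tr p m c))"
    using s1[of "\<lambda>c. zp (tr p m c)"] s2[of "\<lambda>c. zp (tr p m c)"] by (simp add: sum.distrib distrib_right)
  also have "\<dots> = 2 * (\<Sum>c\<in>Fsub m. zp (tr p m (1 * c)))"
    by (simp add: eq2 sum_distrib_left Fq_def[symmetric])
  also have "\<dots> = 0" using sum_zp_tr[OF m_pos, of 1] by simp
  finally show "(\<Sum>x\<in>Fq - {0}. zp (tr p m (x + A / x))) = - 1"
    using sW by (simp add: g_def eq_neg_iff_add_eq_0)
qed

section \<open>Descent to the subfield with p ^ (m / p) elements\<close>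

lemma tr_transitive: "tr p (j * r) y = tr p j (\<Sum>i<r. (y :: 'a) ^ ((p ^ j) ^ i))"
proof -
  have "tr p j (\<Sum>i<r. y ^ ((p ^ j) ^ i)) = (\<Sum>k<j. \<Sum>i<r. y ^ (p ^ (j * i + k)))"
    unfolding tr_def frob_sum by (intro sum.cong refl) (simp add: power_add flip: power_mult)
  also have "\<dots> = (\<Sum>i<r. \<Sum>k<j. y ^ (p ^ (i * j + k)))"
    by (subst sum.swap) (simp add: mult.commute)
  also have "\<dots> = (\<Sum>i<r. \<Sum>k\<in>{i * j..<i * j + j}. y ^ (p ^ k))"
  proof (rule sum.cong)
    fix i
    show "(\<Sum>k<j. y ^ (p ^ (i * j + k))) = (\<Sum>k\<in>{i * j..<i * j + j}. y ^ (p ^ k))"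
      by (rule sum.reindex_bij_witness[of _ "\<lambda>k. k - i * j" "\<lambda>k. i * j + k"]) auto
  qed simp
  also have "\<dots> = tr p (j * r) y"
    unfolding tr_def by (simp add: sum.nat_group mult.commute)
  finally show ?thesis ..
qed

theorem no_sum_one:
  assumes A2: "A ^ (p ^ 2) = A"
  shows "(\<Sum>u\<in>U. zp (h u)) \<noteq> 1"
proof
  assume one: "(\<Sum>u\<in>U. zp (h u)) = 1"
  note bz = b_zero_and_p_dvd[OF one A2]
  note K = kloosterman_sum[OF one A2 bz(1,2)]
  obtain i where i: "m div 2 = p * i" using bz(3) by blast
  \<comment> \<open>\<open>j\<close> is m / p, and it is even because \<open>p\<close> already
    divides \<open>m div 2\<close>. So A, lying in the field with p ^ 2 elements, also lies in the
    one with p ^ j elements, and \<open>j \<ge> 2\<close> as the Lucas argument requires.\<close>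
  define j where "j = 2 * i"
  have m: "m = j * p" using i even_m by (auto simp: j_def elim!: evenE)
  have j2: "j \<ge> 2" using m m_pos by (cases i) (auto simp: j_def)
  hence j0: "j > 0" by simp
  have jd: "j dvd 2 * m" by (simp add: m)
  define Q where "Q = p ^ j"
  have Qp: "Q ^ p = p ^ m" by (simp add: Q_def m power_mult)
  have "multiplicity p (p ^ (2 * m)) = 2 * m"
    by (rule multiplicity_same_power) (use prime_p in auto)
  hence fe: "frob_exp TYPE('a) = Q"
    using p_pos by (simp add: frob_exp_def CHAR_eq card_F Q_def m)
  let ?\<iota> = "of_frob_sub :: 'a frob_sub \<Rightarrow> 'a"
  have range: "range ?\<iota> = {x. x ^ Q = x}"
    unfolding fe[symmetric] by (rule type_definition.Rep_range[OF type_definition_frob_sub])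
  hence rangeF: "range ?\<iota> = Fsub j" by (simp add: Fsub_def Q_def)
  have inj: "inj ?\<iota>" by (rule injI) (simp add: of_frob_sub_inject)
  have iF: "?\<iota> x \<in> Fsub j" for x using rangeF by blast
  have "A \<in> range ?\<iota>" unfolding rangeF Fsub_def j_def using A_power[OF A2] by simp
  then obtain A' where A': "A = ?\<iota> A'" by blast
  have A0: "A \<noteq> 0" using bz(2) by (simp add: A_def)
  define \<psi> where "\<psi> x = zp (tr p j (?\<iota> x))" for x
  have z: "?\<iota> 0 = 0" "?\<iota> 1 = 1" and add: "?\<iota> (x + y) = ?\<iota> x + ?\<iota> y" and mul: "?\<iota> (x * y) = ?\<iota> x * ?\<iota> y"
    and dv: "?\<iota> (x / y) = ?\<iota> x / ?\<iota> y" for x y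
    by (simp_all add: zero_frob_sub.rep_eq one_frob_sub.rep_eq plus_frob_sub.rep_eq times_frob_sub.rep_eq divide_frob_sub.rep_eq)
  have cardk: "card (UNIV :: 'a frob_sub set) = Q"
    using card_image[OF inj] rangeF card_Fsub[OF j0 jd] by (simp add: Q_def)
  interpret kl: kloosterman_lift \<psi> A' ?\<iota> Q p
  proof
    show "\<psi> 0 = 1" by (simp add: \<psi>_def z)
    show "\<psi> (x + y) = \<psi> x * \<psi> y" for x y
      by (simp add: \<psi>_def add tr_add zp_add tr_Fp iF)
    obtain y where y: "y \<in> Fsub j" "tr p j y \<noteq> 0" using tr_nontrivial[OF j0 jd] by blast
    then obtain s where "y = ?\<iota> s" using rangeF by blast
    thus "\<exists>s. \<psi> s \<noteq> 1" using y zp_eq_1[OF tr_Fp[OF y(1)]] by (auto simp: \<psi>_def)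
    show "A' \<noteq> 0" using A0 A' z by auto
    show "(u + v) ^ Q = u ^ Q + v ^ Q" for u v :: 'a unfolding Q_def by (rule frob_add)
    show "prime p" by (rule prime_p)
    show "card {x :: 'a. x ^ Q ^ p = x} = Q ^ p"
      unfolding Qp using card_Fsub[OF m_pos] by (simp add: Fsub_def)
  qed (simp_all add: add mul z range cardk)
  have E: "kl.E = Fq" by (simp add: kl.E_def Qp Fq_def Fsub_def)
  have ext: "kl.ext_char y = zp (tr p m y)" if "y \<in> Fq" for y
  proof -
    let ?s = "\<Sum>i<p. y ^ (Q ^ i)"
    obtain l where l: "p = Suc l" using p_pos by (cases p) auto
    have "?s ^ Q = (\<Sum>i<p. y ^ (Q ^ Suc i))"
      by (simp add: kl.frob_sum mult.commute flip: power_mult)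
    also have "\<dots> = (\<Sum>i<l. y ^ (Q ^ Suc i)) + y ^ (Q ^ p)" unfolding l by simp
    also have "y ^ (Q ^ p) = y ^ (Q ^ 0)" using that by (simp add: Qp Fq_iff q_def)
    also have "(\<Sum>i<l. y ^ (Q ^ Suc i)) + y ^ (Q ^ 0) = ?s"
      unfolding l sum.lessThan_Suc_shift by simp
    finally have inv: "?\<iota> (inv ?\<iota> ?s) = ?s" by (rule kl.iota_inv)
    have "kl.ext_char y = zp (tr p j (?\<iota> (inv ?\<iota> ?s)))"
      unfolding kl.ext_char_def by (rule \<psi>_def)
    also have "\<dots> = zp (tr p j ?s)" unfolding inv ..
    also have "tr p j ?s = tr p m y" unfolding m tr_transitive Q_def ..
    finally show ?thesis .
  qed
  have "kl.V p = - (\<Sum>x\<in>Fq - {0}. zp (tr p m (x + A / x)))"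
    unfolding kl.V_r E A'[symmetric]
  proof (intro arg_cong[where f = uminus] sum.cong refl ext)
    fix x assume "x \<in> Fq - {0}"
    thus "x + A / x \<in> Fq" using K(1) unfolding Fq_def by (intro Fsub_add Fsub_divide) auto
  qed
  hence Vp: "kl.V p = 1" using K(2) by simp
  define e where "e x = idx (tr p j (?\<iota> x + A / ?\<iota> x))" for x
  have eF: "tr p j (?\<iota> x + A / ?\<iota> x) \<in> Fp" for x
    by (rule tr_Fp) (use iF A' in auto)
  have e: "\<psi> (x + A' / x) = \<zeta> ^ e x" for x
    using eF[of x] by (simp add: \<psi>_def e_def zp_idx add dv A')
  have "kl.V p \<noteq> 1"
  proof (rule lucas_character_sum_neq_1[where X = "UNIV - {0}" and \<sigma> = uminus and h = e and N = j])
    \<comment> \<open>The function x + A / x is odd, so negation pairs inverse character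
      values.\<close>
    show "bij_betw uminus (UNIV - {0 :: 'a frob_sub}) (UNIV - {0})"
      by (rule bij_betw_byWitness[of _ uminus]) auto
    show "\<zeta> ^ e x * \<zeta> ^ e (- x) = 1" for x
    proof -
      have "\<psi> (x + A' / x) * \<psi> (- x + A' / - x) = \<psi> ((x + A' / x) + (- x + A' / - x))"
        by (rule kl.psi_add[symmetric])
      also have "\<dots> = 1" by (simp add: kl.psi_0)
      finally show ?thesis by (simp only: e)
    qed
    show "card (UNIV - {0 :: 'a frob_sub}) + 1 = p ^ j"
      using cardk kl.Q_pos by (simp add: Q_def card_Diff_singleton)
    show "kl.V 1 = - (\<Sum>x\<in>UNIV - {0}. \<zeta> ^ e x)" unfolding kl.V_1 e ..
    show "kl.V (n + 2) = kl.V 1 * kl.V (n + 1) - of_nat (p ^ j) * kl.V n" for n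
      using kl.V_rec[of n] unfolding cardk Q_def .
  qed (use p_odd j2 kl.V_0 in auto)
  thus False using Vp by simp
qed

end

theorem theorem10:
  fixes a b :: "'a::{field,finite}" and p m :: nat and t :: int
  assumes "prime p" and "p \<ge> 13"
    and "even m" and "m > 0"
    and "card (UNIV :: 'a set) = p ^ (2*m)"
    and "(a ^ (p ^ m + 1)) ^ (p ^ 2) = a ^ (p ^ m + 1)"
    and "b \<in> prime_subfield"
    and "gcd t (int p ^ m + 1) = 1"
  shows "\<not> regular_bent p (2*m) (f_abt p m a b t)"
proof
  assume bent: "regular_bent p (2*m) (f_abt p m a b t)"
  interpret bent_setup p m a b
    by standard (use assms in auto)
  have cop: "coprime t (int q + 1)" using assms(8) by (simp add: q_def coprime_iff_gcd_eq_1)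
  have "odd t"
  proof
    assume "even t"
    moreover have "even (int q + 1)" using odd_q by simp
    ultimately show False using cop by (meson coprime_common_divisor odd_one dvd_trans dvd_refl even_numeral not_coprimeI)
  qed
  moreover have "A ^ (p ^ 2) = A" using assms(6) by (simp add: A_def q_def)
  ultimately show False using sum_U_eq_1[OF bent _ cop] no_sum_one by blast
qed

end
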